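(* Let $\Gamma$ be a connected Coxeter graph with exactly $4$ vertices all of whose edge labels equal a single integer $n\ge 2$, where $n\neq 4k+2$ for every $k\geq 1$. Then every Coxeter group $W$ with $\widehat W\cong\widehat{W_\Gamma}$ is isomorphic to $W_\Gamma$.
   Context: For a finite simplicial graph $\Gamma$ with edge labels $m\colon E(\Gamma)\to\mathbb{N}_{\ge2}$, $W_\Gamma=\langle V(\Gamma)\mid v^2,\ (vw)^{m(\{v,w\})}\text{ for }\{v,w\}\in E(\Gamma)\rangle$. $\widehat{G}$ is profinite completion. *)

theory Defs
  imports "HOL-Algebra.Algebra"
begin

definition coxeter_graph :: "'a set \<Rightarrow> 'a set set \<Rightarrow> ('a set \<Rightarrow> nat) \<Rightarrow> bool" where
  "coxeter_graph V E m \<longleftrightarrow> finite V \<and>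
     (\<forall>e\<in>E. \<exists>u v. e = {u, v} \<and> u \<noteq> v \<and> u \<in> V \<and> v \<in> V) \<and>
     (\<forall>e\<in>E. m e \<ge> 2)"

definition graph_connected :: "'a set \<Rightarrow> 'a set set \<Rightarrow> bool" where
  "graph_connected V E \<longleftrightarrow> (\<forall>u\<in>V. \<forall>v\<in>V. (\<lambda>x y. {x, y} \<in> E)\<^sup>*\<^sup>* u v)"

text \<open>Since all generators are involutions, the group presented by
  < V | v^2, (vw)^m(v,w) > is the quotient of the free monoid on V by the
  congruence generated by the relators.\<close>

definition alt_word :: "'a \<Rightarrow> 'a \<Rightarrow> nat \<Rightarrow> 'a list" where
  "alt_word v w k = concat (replicate k [v, w])"

inductive cox_step :: "'a set \<Rightarrow> 'a set set \<Rightarrow> ('a set \<Rightarrow> nat) \<Rightarrow> 'a list \<Rightarrow> 'a list \<Rightarrow> bool"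
  for V E m where
  square: "\<lbrakk>xs \<in> lists V; ys \<in> lists V; v \<in> V\<rbrakk> \<Longrightarrow> cox_step V E m (xs @ [v, v] @ ys) (xs @ ys)"
| braid: "\<lbrakk>xs \<in> lists V; ys \<in> lists V; v \<in> V; w \<in> V; {v, w} \<in> E\<rbrakk>
           \<Longrightarrow> cox_step V E m (xs @ alt_word v w (m {v, w}) @ ys) (xs @ ys)"

definition cox_rel :: "'a set \<Rightarrow> 'a set set \<Rightarrow> ('a set \<Rightarrow> nat) \<Rightarrow> ('a list \<times> 'a list) set" where
  "cox_rel V E m = {(xs, ys). xs \<in> lists V \<and> ys \<in> lists V \<and> equivclp (cox_step V E m) xs ys}"

definition coxeter_group :: "'a set \<Rightarrow> 'a set set \<Rightarrow> ('a set \<Rightarrow> nat) \<Rightarrow> 'a list set monoid" where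
  "coxeter_group V E m =
    \<lparr> carrier = lists V // cox_rel V E m,
      monoid.mult = (\<lambda>A B. cox_rel V E m `` {(SOME x. x \<in> A) @ (SOME y. y \<in> B)}),
      one = cox_rel V E m `` {[]} \<rparr>"

definition fin_index_normals :: "('g, 'b) monoid_scheme \<Rightarrow> 'g set set" where
  "fin_index_normals G = {N. N \<lhd> G \<and> finite (rcosets\<^bsub>G\<^esub> N)}"

definition profinite_completion :: "('g, 'b) monoid_scheme \<Rightarrow> ('g set \<Rightarrow> 'g set) monoid" where
  "profinite_completion G =
    \<lparr> carrier = {x. (\<forall>N\<in>fin_index_normals G. x N \<in> rcosets\<^bsub>G\<^esub> N) \<and>
                   (\<forall>N. N \<notin> fin_index_normals G \<longrightarrow> x N = undefined) \<and>
                   (\<forall>N\<in>fin_index_normals G. \<forall>M\<in>fin_index_normals G. N \<subseteq> M \<longrightarrow> x N \<subseteq> x M)},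
      monoid.mult = (\<lambda>x y N. if N \<in> fin_index_normals G then x N <#>\<^bsub>G\<^esub> y N else undefined),
      one = (\<lambda>N. if N \<in> fin_index_normals G then N else undefined) \<rparr>"

text \<open>Basic open subgroups (kernels of projections to finite quotients); they form a
  neighbourhood basis of the identity of the inverse-limit topology.\<close>

definition pc_basic_open :: "('g, 'b) monoid_scheme \<Rightarrow> 'g set \<Rightarrow> ('g set \<Rightarrow> 'g set) set" where
  "pc_basic_open G N = {x \<in> carrier (profinite_completion G). x N = N}"

definition pc_continuous :: "('g, 'b) monoid_scheme \<Rightarrow> ('h, 'c) monoid_scheme
     \<Rightarrow> (('g set \<Rightarrow> 'g set) \<Rightarrow> ('h set \<Rightarrow> 'h set)) \<Rightarrow> bool" where
  "pc_continuous G H f \<longleftrightarrow>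
     (\<forall>M\<in>fin_index_normals H. \<exists>N\<in>fin_index_normals G.
        f ` pc_basic_open G N \<subseteq> pc_basic_open H M)"

definition profinite_iso :: "('g, 'b) monoid_scheme \<Rightarrow> ('h, 'c) monoid_scheme \<Rightarrow> bool" where
  "profinite_iso G H \<longleftrightarrow>
     (\<exists>f. f \<in> iso (profinite_completion G) (profinite_completion H) \<and>
          pc_continuous G H f \<and>
          pc_continuous H G (inv_into (carrier (profinite_completion G)) f))"

end

(* An isomorphism of profinite completions gives, for every finite group Q, a bijection between
   the sets of homomorphisms from the two Coxeter groups to Q, natural in Q; so all counts of such
   homomorphisms, and of their fibres over a quotient of Q, agree.  Counting into small dihedral
   groups shows that the vertices of the second graph fall into exactly four classes under the
   edges whose label is odd (n even) or prime to a fixed prime divisor of n (n odd).  Finer counts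
   (into a wreath product with a dihedral group for odd n, over sign and parity maps for even n)
   show that n divides every label between different classes.  Homomorphisms into a dihedral group
   of large prime degree count colourings of the quotient graph on the four classes, which
   determines it among the graphs on four vertices up to path versus star; these give isomorphic
   groups for odd n by a diagram twist.  Finally the second group maps onto the group of the quotient
   graph with constant label n, and both have equally many homomorphisms to every finite group.  A
   finite reflection quotient in which the generators are distinct and the labels are the exact
   orders then forces the classes to be singletons and the labels to be n. *)
theory Submission
  imports Defs "HOL-Number_Theory.Number_Theory"
begin

section \<open>Homomorphisms from Coxeter groups\<close>

text \<open>Nothing bounds the vertices or labels of the second graph in advance, so the two graphs
  cannot be compared edge by edge. Passing to classes makes them comparable, and the last count
  rules out a proper quotient: collapsing generators or shrinking labels would lose a homomorphism
  to some finite group. The excluded labels come from the dihedral group of order 8k+4, which is the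
  product of the one of order 4k+2 with a group of order two and so has Coxeter generating sets of
  different sizes. In the proof, 4 dividing n makes every assignment of involutions of the dihedral
  group of order 8 a homomorphism, and the unequal fibres of its parity character count the
  generators of sign -1. For odd n there is only one nontrivial sign. Wreath products replace that
  count: reflections at different positions leave the base components free, reflections at the same
  position do not, so fibre sizes see which edges are monochromatic. The modulus n yields
  divisibility of labels, a large prime modulus yields proper colourings. For even n the identity
  acts as an additional colour, which already separates the path from the star.\<close>

declare in_listsI [rule del] in_listsD [rule del]

text \<open>These assignments stand for the homomorphisms themselves, since \<open>cox_lift\<close>
  extends each of them. They are extensional outside \<open>V\<close>, so that counting them counts
  homomorphisms.\<close>

definition cox_homs :: "'a set \<Rightarrow> 'a set set \<Rightarrow> ('a set \<Rightarrow> nat) \<Rightarrow> ('q, 'x) monoid_scheme \<Rightarrow> ('a \<Rightarrow> 'q) set" where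
  "cox_homs V E m Q = {x \<in> V \<rightarrow>\<^sub>E carrier Q. (\<forall>v\<in>V. x v \<otimes>\<^bsub>Q\<^esub> x v = \<one>\<^bsub>Q\<^esub>) \<and>
     (\<forall>v\<in>V. \<forall>w\<in>V. {v, w} \<in> E \<longrightarrow> (x v \<otimes>\<^bsub>Q\<^esub> x w) [^]\<^bsub>Q\<^esub> m {v, w} = \<one>\<^bsub>Q\<^esub>)}"

definition word_eval :: "('q, 'x) monoid_scheme \<Rightarrow> ('a \<Rightarrow> 'q) \<Rightarrow> 'a list \<Rightarrow> 'q" where
  "word_eval Q x ws = foldr (\<lambda>v a. x v \<otimes>\<^bsub>Q\<^esub> a) ws \<one>\<^bsub>Q\<^esub>"

definition cox_class :: "'a set \<Rightarrow> 'a set set \<Rightarrow> ('a set \<Rightarrow> nat) \<Rightarrow> 'a list \<Rightarrow> 'a list set" where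
  "cox_class V E m ws = cox_rel V E m `` {ws}"

lemma word_eval_Nil [simp]: "word_eval Q x [] = \<one>\<^bsub>Q\<^esub>"
  by (simp add: word_eval_def)

lemma word_eval_Cons [simp]: "word_eval Q x (v # ws) = x v \<otimes>\<^bsub>Q\<^esub> word_eval Q x ws"
  by (simp add: word_eval_def)

lemma alt_word_lists: "v \<in> V \<Longrightarrow> w \<in> V \<Longrightarrow> alt_word v w k \<in> lists V"
  by (induction k) (auto simp: alt_word_def)

context group begin

lemma word_eval_closed: "x \<in> V \<rightarrow> carrier G \<Longrightarrow> ws \<in> lists V \<Longrightarrow> word_eval G x ws \<in> carrier G"
  by (induction ws) auto

lemma word_eval_append:
  "x \<in> V \<rightarrow> carrier G \<Longrightarrow> us \<in> lists V \<Longrightarrow> ws \<in> lists V \<Longrightarrow>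
    word_eval G x (us @ ws) = word_eval G x us \<otimes> word_eval G x ws"
proof (induction us)
  case (Cons v us)
  then have "x v \<in> carrier G" "word_eval G x us \<in> carrier G" "word_eval G x ws \<in> carrier G"
    using word_eval_closed[of x V us] word_eval_closed[of x V ws] by auto
  with Cons show ?case by (simp add: m_assoc)
next
  case Nil
  then show ?case using word_eval_closed[of x V ws] by simp
qed

lemma word_eval_alt_word:
  "x v \<in> carrier G \<Longrightarrow> x w \<in> carrier G \<Longrightarrow> word_eval G x (alt_word v w k) = (x v \<otimes> x w) [^] k"
proof (induction k)
  case (Suc k)
  have "alt_word v w (Suc k) = v # w # alt_word v w k"
    by (simp add: alt_word_def)
  then show ?case
    using Suc nat_pow_Suc2[of "x v \<otimes> x w" k] by (simp add: m_assoc)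
qed (simp add: alt_word_def)

lemma cox_step_word_eval:
  assumes "x \<in> cox_homs V E m G" "cox_step V E m us ws"
  shows "word_eval G x us = word_eval G x ws"
proof -
  have x: "x \<in> V \<rightarrow> carrier G" using assms(1) by (auto simp: cox_homs_def)
  have x1: "x v \<otimes> x v = \<one>" if "v \<in> V" for v using that assms(1) by (auto simp: cox_homs_def)
  have x2: "(x v \<otimes> x w) [^] m {v, w} = \<one>" if "v \<in> V" "w \<in> V" "{v, w} \<in> E" for v w
    using that assms(1) by (auto simp: cox_homs_def)
  from assms(2) show ?thesis
  proof cases
    case (square xs ys v)
    have "x v \<in> carrier G" using square x by auto
    then have "word_eval G x [v, v] = \<one>" using square x1[of v] by simp
    then show ?thesis using square x word_eval_closed[OF x]
      by (simp add: word_eval_append[OF x] del: append.simps word_eval_Cons)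
  next
    case (braid xs ys v w)
    then have "word_eval G x (alt_word v w (m {v, w})) = \<one>"
      using x x2[of v w] by (subst word_eval_alt_word) auto
    then show ?thesis using braid x word_eval_closed[OF x] alt_word_lists[of v V w]
      by (simp add: word_eval_append[OF x])
  qed
qed

lemma equivclp_word_eval:
  assumes "x \<in> cox_homs V E m G" "equivclp (cox_step V E m) us ws"
  shows "word_eval G x us = word_eval G x ws"
  using assms(2) by (induction rule: equivclp_induct) (auto dest: cox_step_word_eval[OF assms(1)])

end

section \<open>The group structure on classes of words\<close>

lemma cox_step_context:
  "cox_step V E m us ws \<Longrightarrow> as \<in> lists V \<Longrightarrow> bs \<in> lists V \<Longrightarrow> cox_step V E m (as @ us @ bs) (as @ ws @ bs)"
proof (induction rule: cox_step.induct)
  case (square xs ys v)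
  then show ?case using cox_step.square[of "as @ xs" V "ys @ bs" v E m] by simp
next
  case (braid xs ys v w)
  then show ?case using cox_step.braid[of "as @ xs" V "ys @ bs" v w E m] by simp
qed

lemma equivclp_context:
  assumes "equivclp (cox_step V E m) us ws" "as \<in> lists V" "bs \<in> lists V"
  shows "equivclp (cox_step V E m) (as @ us @ bs) (as @ ws @ bs)"
  using assms(1)
proof (induction rule: equivclp_induct)
  case (step y z)
  then show ?case using cox_step_context[OF _ assms(2,3)] by (meson equivclp_into_equivclp)
qed simp

lemma equiv_cox_rel: "equiv (lists V) (cox_rel V E m)"
proof (rule equivI)
  show "cox_rel V E m \<subseteq> lists V \<times> lists V" by (auto simp: cox_rel_def)
  show "refl_on (lists V) (cox_rel V E m)" by (auto simp: cox_rel_def refl_on_def)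
  show "sym (cox_rel V E m)" by (auto simp: cox_rel_def sym_def intro: equivclp_sym)
  show "trans (cox_rel V E m)" by (auto simp: cox_rel_def trans_def intro: equivclp_trans)
qed

lemma cox_class_eq_iff:
  "us \<in> lists V \<Longrightarrow> ws \<in> lists V \<Longrightarrow> cox_class V E m us = cox_class V E m ws \<longleftrightarrow> equivclp (cox_step V E m) us ws"
  using equiv_cox_rel[of V E m] unfolding cox_class_def
  by (subst eq_equiv_class_iff[OF equiv_cox_rel]) (auto simp: cox_rel_def)

lemma some_in_cox_class:
  assumes "us \<in> lists V"
  shows "(SOME x. x \<in> cox_class V E m us) \<in> lists V"
        "equivclp (cox_step V E m) us (SOME x. x \<in> cox_class V E m us)"
proof -
  have "us \<in> cox_class V E m us" using assms by (auto simp: cox_class_def cox_rel_def)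
  then have "(SOME x. x \<in> cox_class V E m us) \<in> cox_class V E m us" by (rule someI)
  moreover have "ws \<in> lists V \<and> equivclp (cox_step V E m) us ws" if "ws \<in> cox_class V E m us" for ws
    using that by (auto simp: cox_class_def cox_rel_def)
  ultimately show "(SOME x. x \<in> cox_class V E m us) \<in> lists V"
        "equivclp (cox_step V E m) us (SOME x. x \<in> cox_class V E m us)"
    by blast+
qed

lemma cox_carrier: "carrier (coxeter_group V E m) = cox_class V E m ` lists V"
  by (auto simp: coxeter_group_def quotient_def cox_class_def)

lemma cox_one: "\<one>\<^bsub>coxeter_group V E m\<^esub> = cox_class V E m []"
  by (simp add: coxeter_group_def cox_class_def)

text \<open>The product is defined through representatives chosen by \<open>SOME\<close>. Rewriting
  is compatible with words attached on either side, so any representatives may be used.\<close>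

lemma cox_mult:
  assumes "us \<in> lists V" "ws \<in> lists V"
  shows "cox_class V E m us \<otimes>\<^bsub>coxeter_group V E m\<^esub> cox_class V E m ws = cox_class V E m (us @ ws)"
proof -
  let ?u = "SOME x. x \<in> cox_class V E m us" and ?w = "SOME x. x \<in> cox_class V E m ws"
  note u = some_in_cox_class[OF assms(1), of E m] and w = some_in_cox_class[OF assms(2), of E m]
  have "equivclp (cox_step V E m) (us @ ws) (?u @ ws)"
    using equivclp_context[OF u(2), of "[]" ws] assms by simp
  moreover have "equivclp (cox_step V E m) (?u @ ws) (?u @ ?w)"
    using equivclp_context[OF w(2), of ?u "[]"] u(1) by simp
  ultimately have "equivclp (cox_step V E m) (us @ ws) (?u @ ?w)" by (rule equivclp_trans)
  then have "cox_class V E m (us @ ws) = cox_class V E m (?u @ ?w)"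
    using assms u(1) w(1) by (subst cox_class_eq_iff) auto
  then show ?thesis by (simp add: coxeter_group_def cox_class_def)
qed

lemma cox_class_square: "us \<in> lists V \<Longrightarrow> ws \<in> lists V \<Longrightarrow> v \<in> V \<Longrightarrow>
   cox_class V E m (us @ [v, v] @ ws) = cox_class V E m (us @ ws)"
  by (subst cox_class_eq_iff) (auto intro!: r_into_equivclp cox_step.square[simplified])

text \<open>Every generator is its own inverse, so reversing a word inverts it. This is why a
  quotient of the free monoid is already a group.\<close>

lemma cox_class_rev: "us \<in> lists V \<Longrightarrow> cox_class V E m (rev us @ us) = cox_class V E m []"
proof (induction us)
  case (Cons v us)
  have "cox_class V E m (rev us @ [v, v] @ us) = cox_class V E m (rev us @ us)"
    using Cons by (intro cox_class_square) (auto simp: lists_eq_set)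
  with Cons show ?case by simp
qed simp

lemma group_coxeter_group: "group (coxeter_group V E m)"
proof (rule groupI)
  fix x assume "x \<in> carrier (coxeter_group V E m)"
  then obtain us where us: "us \<in> lists V" "x = cox_class V E m us" by (auto simp: cox_carrier)
  then have "rev us \<in> lists V" by (auto simp: lists_eq_set)
  with us show "\<exists>y\<in>carrier (coxeter_group V E m). y \<otimes>\<^bsub>coxeter_group V E m\<^esub> x = \<one>\<^bsub>coxeter_group V E m\<^esub>"
    by (intro bexI[of _ "cox_class V E m (rev us)"]) (auto simp: cox_mult cox_carrier cox_one cox_class_rev)
qed (auto simp: cox_carrier cox_mult cox_one)

interpretation cox: group "coxeter_group V E m" for V :: "'a set" and E m
  by (rule group_coxeter_group)

section \<open>The universal property of the presentation\<close>

definition cox_gen :: "'a set \<Rightarrow> 'a set set \<Rightarrow> ('a set \<Rightarrow> nat) \<Rightarrow> 'a \<Rightarrow> 'a list set" where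
  "cox_gen V E m = (\<lambda>v\<in>V. cox_class V E m [v])"

lemma word_eval_cox_gen: "us \<in> lists V \<Longrightarrow> word_eval (coxeter_group V E m) (cox_gen V E m) us = cox_class V E m us"
  by (induction us) (auto simp: cox_one cox_gen_def cox_mult)

lemma cox_gen_in_cox_homs: "cox_gen V E m \<in> cox_homs V E m (coxeter_group V E m)"
proof -
  let ?W = "coxeter_group V E m"
  have c: "cox_gen V E m \<in> V \<rightarrow>\<^sub>E carrier ?W" by (auto simp: cox_gen_def cox_carrier)
  have "cox_gen V E m v \<otimes>\<^bsub>?W\<^esub> cox_gen V E m v = \<one>\<^bsub>?W\<^esub>" if "v \<in> V" for v
    using that cox_class_square[of "[]" V "[]" v E m] by (simp add: cox_gen_def cox_mult cox_one)
  moreover have "(cox_gen V E m v \<otimes>\<^bsub>?W\<^esub> cox_gen V E m w) [^]\<^bsub>?W\<^esub> m {v, w} = \<one>\<^bsub>?W\<^esub>"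
    if "v \<in> V" "w \<in> V" "{v, w} \<in> E" for v w
  proof -
    have "(cox_gen V E m v \<otimes>\<^bsub>?W\<^esub> cox_gen V E m w) [^]\<^bsub>?W\<^esub> m {v, w}
        = word_eval ?W (cox_gen V E m) (alt_word v w (m {v, w}))"
      using c that by (subst cox.word_eval_alt_word) auto
    also have "\<dots> = cox_class V E m (alt_word v w (m {v, w}))"
      using that by (intro word_eval_cox_gen alt_word_lists)
    also have "\<dots> = cox_class V E m []"
      using that alt_word_lists[of v V w] cox_step.braid[of "[]" V "[]" v w E m]
      by (subst cox_class_eq_iff) auto
    finally show ?thesis by (simp add: cox_one)
  qed
  ultimately show ?thesis using c by (auto simp: cox_homs_def)
qed

text \<open>Evaluates a representative of the class; for assignments in \<open>cox_homs\<close> the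
  value does not depend on the choice, because rewriting steps preserve
  \<open>word_eval\<close>.\<close>

definition cox_lift :: "('q, 'x) monoid_scheme \<Rightarrow> ('a \<Rightarrow> 'q) \<Rightarrow> 'a list set \<Rightarrow> 'q" where
  "cox_lift Q x = (\<lambda>A. word_eval Q x (SOME w. w \<in> A))"

context group begin

lemma cox_lift_class:
  assumes "x \<in> cox_homs V E m G" "us \<in> lists V"
  shows "cox_lift G x (cox_class V E m us) = word_eval G x us"
  using equivclp_word_eval[OF assms(1) some_in_cox_class(2)[OF assms(2)]] by (simp add: cox_lift_def)

lemma cox_lift_hom:
  assumes "x \<in> cox_homs V E m G"
  shows "cox_lift G x \<in> hom (coxeter_group V E m) G"
proof -
  have "x \<in> V \<rightarrow> carrier G" using assms by (auto simp: cox_homs_def)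
  then show ?thesis
    by (auto simp: hom_def cox_carrier cox_mult cox_lift_class[OF assms] word_eval_append word_eval_closed)
qed

lemma cox_lift_gen:
  assumes "x \<in> cox_homs V E m G" "v \<in> V"
  shows "cox_lift G x (cox_gen V E m v) = x v"
proof -
  have "x v \<in> carrier G" using assms by (auto simp: cox_homs_def)
  then show ?thesis
  using assms cox_lift_class[OF assms(1), of "[v]"] by (simp add: cox_gen_def)
qed

lemma hom_word_eval:
  assumes "h \<in> hom G H" "group H" "x \<in> V \<rightarrow> carrier G" "us \<in> lists V"
  shows "h (word_eval G x us) = word_eval H (h \<circ> x) us"
  using assms(4)
proof (induction us)
  case Nil show ?case using hom_one[OF assms(1) _ assms(2)] by (simp add: is_group)
next
  case (Cons v us)
  then have "x v \<in> carrier G" "word_eval G x us \<in> carrier G"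
    using assms word_eval_closed[OF assms(3), of us] by auto
  then show ?case using Cons hom_mult[OF assms(1)] by simp
qed

end

lemma word_eval_cong: "us \<in> lists V \<Longrightarrow> (\<And>v. v \<in> V \<Longrightarrow> x v = y v) \<Longrightarrow> word_eval Q x us = word_eval Q y us"
  by (induction us) auto

lemma cox_hom_eqI:
  assumes "h \<in> hom (coxeter_group V E m) H" "h' \<in> hom (coxeter_group V E m) H" "group H"
    and "\<And>v. v \<in> V \<Longrightarrow> h (cox_gen V E m v) = h' (cox_gen V E m v)"
    and "a \<in> carrier (coxeter_group V E m)"
  shows "h a = h' a"
proof -
  obtain us where us: "us \<in> lists V" "a = cox_class V E m us" using assms(5) by (auto simp: cox_carrier)
  have c: "cox_gen V E m \<in> V \<rightarrow> carrier (coxeter_group V E m)" by (auto simp: cox_gen_def cox_carrier)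
  have "h a = word_eval H (h \<circ> cox_gen V E m) us"
    using us cox.hom_word_eval[OF assms(1,3) c us(1)] by (simp add: word_eval_cox_gen)
  also have "\<dots> = word_eval H (h' \<circ> cox_gen V E m) us"
    using us assms(4) by (intro word_eval_cong) auto
  also have "\<dots> = h' a"
    using us cox.hom_word_eval[OF assms(2,3) c us(1)] by (simp add: word_eval_cox_gen)
  finally show ?thesis .
qed

lemma cox_homs_comp:
  assumes "x \<in> cox_homs V E m G" "h \<in> hom G H" "group G" "group H"
  shows "restrict (h \<circ> x) V \<in> cox_homs V E m H"
proof -
  interpret group_hom G H h using assms by (simp add: group_hom_def group_hom_axioms_def)
  have c: "x v \<in> carrier G" if "v \<in> V" for v using that assms(1) by (auto simp: cox_homs_def)
  have "h (x v) \<otimes>\<^bsub>H\<^esub> h (x v) = \<one>\<^bsub>H\<^esub>" if "v \<in> V" for v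
    using that assms(1) c[OF that] by (auto simp: cox_homs_def simp flip: hom_mult)
  moreover have "(h (x v) \<otimes>\<^bsub>H\<^esub> h (x w)) [^]\<^bsub>H\<^esub> m {v, w} = \<one>\<^bsub>H\<^esub>" if "v \<in> V" "w \<in> V" "{v, w} \<in> E" for v w
    using that assms(1) c[of v] c[of w] by (auto simp: cox_homs_def simp flip: hom_mult hom_nat_pow)
  ultimately show ?thesis using c by (auto simp: cox_homs_def)
qed

text \<open>Homomorphisms are determined on generators, so two assignments that undo each other
  there already lift to mutually inverse homomorphisms.\<close>

lemma coxeter_group_isoI:
  assumes x: "x \<in> cox_homs V E m (coxeter_group V' E' m')"
    and y: "y \<in> cox_homs V' E' m' (coxeter_group V E m)"
    and xy: "\<And>v. v \<in> V \<Longrightarrow> cox_lift (coxeter_group V E m) y (x v) = cox_gen V E m v"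
    and yx: "\<And>v. v \<in> V' \<Longrightarrow> cox_lift (coxeter_group V' E' m') x (y v) = cox_gen V' E' m' v"
  shows "coxeter_group V E m \<cong> coxeter_group V' E' m'"
proof -
  let ?W = "coxeter_group V E m" and ?W' = "coxeter_group V' E' m'"
  let ?f = "cox_lift ?W' x" and ?g = "cox_lift ?W y"
  have f: "?f \<in> hom ?W ?W'" and g: "?g \<in> hom ?W' ?W"
    using cox.cox_lift_hom[OF x] cox.cox_lift_hom[OF y] .
  have fc: "?f \<in> carrier ?W \<rightarrow> carrier ?W'" and gc: "?g \<in> carrier ?W' \<rightarrow> carrier ?W"
    using f g by (auto simp: hom_def)
  have 1: "?g (?f a) = a" if "a \<in> carrier ?W" for a
    using cox_hom_eqI[of "?g \<circ> ?f" V E m ?W "\<lambda>a. a" a] that hom_compose[OF f g]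
    by (auto simp: cox.is_group cox.cox_lift_gen[OF x] xy hom_def)
  have 2: "?f (?g a) = a" if "a \<in> carrier ?W'" for a
    using cox_hom_eqI[of "?f \<circ> ?g" V' E' m' ?W' "\<lambda>a. a" a] that hom_compose[OF g f]
    by (auto simp: cox.is_group cox.cox_lift_gen[OF y] yx hom_def)
  have "bij_betw ?f (carrier ?W) (carrier ?W')"
    by (rule bij_betwI[OF fc gc]) (use 1 2 in auto)
  with f show ?thesis by (auto simp: is_iso_def iso_def)
qed

lemma cox_homs_mono_finite: "finite V \<Longrightarrow> finite (carrier Q) \<Longrightarrow> finite (cox_homs V E m Q)"
  by (rule finite_subset[of _ "V \<rightarrow>\<^sub>E carrier Q"]) (auto simp: cox_homs_def intro: finite_PiE)

lemma cox_homs_ext: "x \<in> cox_homs V E m Q \<Longrightarrow> restrict x V = x"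
  by (auto simp: cox_homs_def PiE_restrict)


text \<open>Precomposition with the isomorphism and with its inverse, read on generators. At the end
  it carries counts from the first group to the group of the quotient graph.\<close>

lemma card_cox_homs_iso:
  assumes "coxeter_group V E m \<cong> coxeter_group V' E' m'" "group Q"
  shows "card (cox_homs V E m Q) = card (cox_homs V' E' m' Q)"
proof -
  let ?W = "coxeter_group V E m" and ?W' = "coxeter_group V' E' m'"
  interpret Q: group Q by fact
  obtain f where f: "f \<in> iso ?W ?W'" using assms(1) by (auto simp: is_iso_def)
  let ?g = "inv_into (carrier ?W) f"
  have g: "?g \<in> iso ?W' ?W" using cox.iso_set_sym[OF f] by simp
  have bij: "bij_betw f (carrier ?W) (carrier ?W')" using f by (auto simp: iso_def)
  have fh: "f \<in> hom ?W ?W'" and gh: "?g \<in> hom ?W' ?W" using f g by (auto simp: iso_def)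
  have gen: "cox_gen V E m v \<in> carrier ?W" if "v \<in> V" for v using that by (auto simp: cox_gen_def cox_carrier)
  have gen': "cox_gen V' E' m' v \<in> carrier ?W'" if "v \<in> V'" for v using that by (auto simp: cox_gen_def cox_carrier)
  have fg: "f (?g a) = a" if "a \<in> carrier ?W'" for a using that bij by (simp add: bij_betw_inv_into_right)
  have gf: "?g (f a) = a" if "a \<in> carrier ?W" for a using that bij by (simp add: bij_betw_inv_into_left)
  let ?F = "\<lambda>x. \<lambda>v\<in>V'. cox_lift Q x (?g (cox_gen V' E' m' v))"
  let ?G = "\<lambda>x. \<lambda>v\<in>V. cox_lift Q x (f (cox_gen V E m v))"
  have F: "?F x \<in> cox_homs V' E' m' Q" if "x \<in> cox_homs V E m Q" for x
    using cox_homs_comp[OF cox_gen_in_cox_homs hom_compose[OF gh Q.cox_lift_hom[OF that]]]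
    by (simp add: comp_def cox.is_group Q.is_group)
  have G: "?G x \<in> cox_homs V E m Q" if "x \<in> cox_homs V' E' m' Q" for x
    using cox_homs_comp[OF cox_gen_in_cox_homs hom_compose[OF fh Q.cox_lift_hom[OF that]]]
    by (simp add: comp_def cox.is_group Q.is_group)
  have FX: "cox_lift Q (?F x) a = cox_lift Q x (?g a)" if "x \<in> cox_homs V E m Q" "a \<in> carrier ?W'" for x a
    using cox_hom_eqI[OF Q.cox_lift_hom[OF F[OF that(1)]] hom_compose[OF gh Q.cox_lift_hom[OF that(1)]] Q.is_group _ that(2)]
    using Q.cox_lift_gen[OF F[OF that(1)]] by simp
  have GX: "cox_lift Q (?G x) a = cox_lift Q x (f a)" if "x \<in> cox_homs V' E' m' Q" "a \<in> carrier ?W" for x a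
    using cox_hom_eqI[OF Q.cox_lift_hom[OF G[OF that(1)]] hom_compose[OF fh Q.cox_lift_hom[OF that(1)]] Q.is_group _ that(2)]
    using Q.cox_lift_gen[OF G[OF that(1)]] by simp
  have "bij_betw ?F (cox_homs V E m Q) (cox_homs V' E' m' Q)"
  proof (rule bij_betwI)
    show "?F \<in> cox_homs V E m Q \<rightarrow> cox_homs V' E' m' Q" using F by blast
    show "?G \<in> cox_homs V' E' m' Q \<rightarrow> cox_homs V E m Q" using G by blast
    show "?G (?F x) = x" if x: "x \<in> cox_homs V E m Q" for x
    proof -
      have "?G (?F x) = restrict x V"
        using hom_in_carrier[OF fh gen] by (intro restrict_ext) (simp add: FX[OF x] gf gen Q.cox_lift_gen[OF x])
      then show ?thesis using cox_homs_ext[OF x] by simp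
    qed
    show "?F (?G x) = x" if x: "x \<in> cox_homs V' E' m' Q" for x
    proof -
      have "?F (?G x) = restrict x V'"
        using hom_in_carrier[OF gh gen'] by (intro restrict_ext) (simp add: GX[OF x] fg gen' Q.cox_lift_gen[OF x])
      then show ?thesis using cox_homs_ext[OF x] by simp
    qed
  qed
  then show ?thesis by (rule bij_betw_same_card)
qed

section \<open>Transfer along an isomorphism of profinite completions\<close>

definition pc_unit :: "('g, 'x) monoid_scheme \<Rightarrow> 'g \<Rightarrow> ('g set \<Rightarrow> 'g set)" where
  "pc_unit G g = (\<lambda>N. if N \<in> fin_index_normals G then N #>\<^bsub>G\<^esub> g else undefined)"

text \<open>A homomorphism to a finite group extends to the completion by reading the coordinate at
  its kernel. It is constant on that coset, so the choice by \<open>SOME\<close> is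
  harmless.\<close>

definition pc_extend :: "('g, 'x) monoid_scheme \<Rightarrow> ('q, 'y) monoid_scheme \<Rightarrow> ('g \<Rightarrow> 'q) \<Rightarrow> ('g set \<Rightarrow> 'g set) \<Rightarrow> 'q" where
  "pc_extend G Q h x = h (SOME g. g \<in> x (kernel G Q h))"

context group begin

lemma fin_index_normalsD: "N \<in> fin_index_normals G \<Longrightarrow> N \<lhd> G"
  by (simp add: fin_index_normals_def)

lemma pc_unit_carrier:
  assumes "g \<in> carrier G" shows "pc_unit G g \<in> carrier (profinite_completion G)"
proof -
  have "N #> g \<in> rcosets N" if "N \<in> fin_index_normals G" for N
    using that assms fin_index_normalsD by (intro rcosetsI) (auto dest: normal_imp_subgroup subgroup.subset)
  then show ?thesis by (auto simp: profinite_completion_def pc_unit_def r_coset_def)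
qed

lemma pc_unit_mult:
  assumes "g \<in> carrier G" "h \<in> carrier G"
  shows "pc_unit G (g \<otimes> h) = pc_unit G g \<otimes>\<^bsub>profinite_completion G\<^esub> pc_unit G h"
  using assms by (auto simp: profinite_completion_def pc_unit_def fun_eq_iff normal.rcos_sum fin_index_normalsD)

lemma pc_obtain_rep:
  assumes "x \<in> carrier (profinite_completion G)" "N \<in> fin_index_normals G"
  obtains g where "g \<in> carrier G" "x N = N #> g" "g \<in> x N"
proof -
  have "x N \<in> rcosets N" using assms by (auto simp: profinite_completion_def)
  then obtain g where g: "g \<in> carrier G" "x N = N #> g" by (auto simp: RCOSETS_def)
  then show ?thesis using that rcos_self[of g N] fin_index_normalsD[OF assms(2)] by (auto dest: normal_imp_subgroup)
qed

lemma pc_mono: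
  "x \<in> carrier (profinite_completion G) \<Longrightarrow> N \<in> fin_index_normals G \<Longrightarrow> M \<in> fin_index_normals G \<Longrightarrow>
    N \<subseteq> M \<Longrightarrow> x N \<subseteq> x M"
  by (simp add: profinite_completion_def)

lemma pc_mult_closed:
  assumes a: "a \<in> carrier (profinite_completion G)" and b: "b \<in> carrier (profinite_completion G)"
  shows "a \<otimes>\<^bsub>profinite_completion G\<^esub> b \<in> carrier (profinite_completion G)"
proof -
  have "a M <#> b M \<in> rcosets M" if M: "M \<in> fin_index_normals G" for M
  proof -
    obtain k where k: "k \<in> carrier G" "a M = M #> k" using pc_obtain_rep[OF a M] .
    obtain l where l: "l \<in> carrier G" "b M = M #> l" using pc_obtain_rep[OF b M] .
    have "M \<subseteq> carrier G" using fin_index_normalsD[OF M] by (meson normal_imp_subgroup subgroup.subset)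
    then show ?thesis using k l normal.rcos_sum[OF fin_index_normalsD[OF M] k(1) l(1)]
      by (simp add: rcosetsI)
  qed
  moreover have "a M <#> b M \<subseteq> a M' <#> b M'"
    if "M \<in> fin_index_normals G" "M' \<in> fin_index_normals G" "M \<subseteq> M'" for M M'
    using pc_mono[OF a that] pc_mono[OF b that] by (auto simp: set_mult_def)
  ultimately show ?thesis by (simp add: profinite_completion_def)
qed

lemma kernel_fin_index:
  assumes "h \<in> hom G Q" "group Q" "finite (carrier Q)"
  shows "kernel G Q h \<in> fin_index_normals G"
proof -
  interpret hh: group_hom G Q h using assms by (simp add: group_hom_def group_hom_axioms_def is_group)
  have "inj_on (\<lambda>C. the_elem (h ` C)) (RCOSETS G (kernel G Q h))"
    using hh.FactGroup_inj_on by (simp add: FactGroup_def)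
  moreover have "(\<lambda>C. the_elem (h ` C)) ` (RCOSETS G (kernel G Q h)) \<subseteq> carrier Q"
    using hh.FactGroup_the_elem_mem by (auto simp: FactGroup_def)
  ultimately have "finite (RCOSETS G (kernel G Q h))"
    using assms(3) by (meson finite_imageD finite_subset)
  then show ?thesis by (simp add: fin_index_normals_def hh.normal_kernel)
qed

lemma pc_extend_eq:
  assumes "h \<in> hom G Q" "group Q" "finite (carrier Q)"
    and "x \<in> carrier (profinite_completion G)" "g \<in> x (kernel G Q h)"
  shows "pc_extend G Q h x = h g"
proof -
  interpret hh: group_hom G Q h using assms by (simp add: group_hom_def group_hom_axioms_def is_group)
  obtain k where k: "k \<in> carrier G" "x (kernel G Q h) = kernel G Q h #> k"
    using pc_obtain_rep[OF assms(4) kernel_fin_index[OF assms(1-3)]] .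
  have "h a = h k" if "a \<in> x (kernel G Q h)" for a
    using that k by (auto simp: r_coset_def kernel_def)
  then show ?thesis using assms(5) someI[of "\<lambda>g. g \<in> x (kernel G Q h)" g] by (simp add: pc_extend_def)
qed

lemma pc_extend_unit:
  assumes "h \<in> hom G Q" "group Q" "finite (carrier Q)" "g \<in> carrier G"
  shows "pc_extend G Q h (pc_unit G g) = h g"
  using kernel_fin_index[OF assms(1-3)] assms(4)
  by (intro pc_extend_eq[OF assms(1-3)] pc_unit_carrier)
     (auto simp: pc_unit_def dest!: fin_index_normalsD intro!: rcos_self normal_imp_subgroup)

lemma pc_extend_hom:
  assumes "h \<in> hom G Q" "group Q" "finite (carrier Q)"
  shows "pc_extend G Q h \<in> hom (profinite_completion G) Q"
proof -
  interpret hh: group_hom G Q h using assms by (simp add: group_hom_def group_hom_axioms_def is_group)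
  let ?P = "profinite_completion G" and ?K = "kernel G Q h"
  note K = kernel_fin_index[OF assms]
  have rep: "\<exists>g\<in>carrier G. g \<in> x ?K \<and> x ?K = ?K #> g \<and> pc_extend G Q h x = h g" if x: "x \<in> carrier ?P" for x
  proof -
    obtain g where "g \<in> carrier G" "x ?K = ?K #> g" "g \<in> x ?K" using pc_obtain_rep[OF x K] .
    then show ?thesis using pc_extend_eq[OF assms x] by blast
  qed
  have mult: "pc_extend G Q h (x \<otimes>\<^bsub>?P\<^esub> y) = pc_extend G Q h x \<otimes>\<^bsub>Q\<^esub> pc_extend G Q h y"
    if xy: "x \<in> carrier ?P" "y \<in> carrier ?P" for x y
  proof -
    obtain a where a: "a \<in> carrier G" "x ?K = ?K #> a" "pc_extend G Q h x = h a" using rep[OF xy(1)] by auto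
    obtain b where b: "b \<in> carrier G" "y ?K = ?K #> b" "pc_extend G Q h y = h b" using rep[OF xy(2)] by auto
    have "(x \<otimes>\<^bsub>?P\<^esub> y) ?K = ?K #> (a \<otimes> b)"
      using K by (simp add: profinite_completion_def a(2) b(2) normal.rcos_sum[OF fin_index_normalsD[OF K] a(1) b(1)])
    moreover have const: "h c = h (a \<otimes> b)" if "c \<in> ?K #> (a \<otimes> b)" for c
      using that a(1) b(1) by (auto simp: r_coset_def kernel_def)
    moreover have "a \<otimes> b \<in> ?K #> (a \<otimes> b)"
      using a(1) b(1) by (intro rcos_self hh.subgroup_kernel) auto
    then have "h (SOME g. g \<in> ?K #> (a \<otimes> b)) = h (a \<otimes> b)"
      by (intro const someI)
    ultimately have "pc_extend G Q h (x \<otimes>\<^bsub>?P\<^esub> y) = h (a \<otimes> b)"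
      by (simp only: pc_extend_def)
    then show ?thesis using a(1,3) b(1,3) by simp
  qed
  have "pc_extend G Q h x \<in> carrier Q" if "x \<in> carrier ?P" for x
    using rep[OF that] by auto
  then show ?thesis using mult by (intro homI)
qed

lemma pc_extend_basic_open:
  assumes "h \<in> hom G Q" "group Q" "finite (carrier Q)" "x \<in> pc_basic_open G (kernel G Q h)"
  shows "pc_extend G Q h x = \<one>\<^bsub>Q\<^esub>"
proof -
  interpret hh: group_hom G Q h using assms by (simp add: group_hom_def group_hom_axioms_def is_group)
  have "\<one> \<in> x (kernel G Q h)" using assms(4) by (simp add: pc_basic_open_def kernel_def)
  then show ?thesis using pc_extend_eq[OF assms(1-3), of x \<one>] assms(4) by (simp add: pc_basic_open_def)
qed

text \<open>The hypothesis on \<open>N\<close> is continuity of \<open>F\<close>. Density of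
  \<open>G\<close> gives the rest: if \<open>g\<close> represents \<open>x N\<close>, then
  \<open>x\<close> differs from the unit of \<open>g\<close> by an element of the basic open
  subgroup at \<open>N\<close>, on which \<open>F\<close> is trivial.\<close>

lemma pc_extend_unique:
  assumes "group Q" "finite (carrier Q)" and F: "F \<in> hom (profinite_completion G) Q"
    and N: "N \<in> fin_index_normals G" "\<And>x. x \<in> pc_basic_open G N \<Longrightarrow> F x = \<one>\<^bsub>Q\<^esub>"
    and x: "x \<in> carrier (profinite_completion G)"
  shows "(\<lambda>g. F (pc_unit G g)) \<in> hom G Q"
    and "pc_extend G Q (\<lambda>g. F (pc_unit G g)) x = F x"
proof -
  interpret Q: group Q by fact
  let ?P = "profinite_completion G" and ?h = "\<lambda>g. F (pc_unit G g)"
  have Fm: "F (a \<otimes>\<^bsub>?P\<^esub> b) = F a \<otimes>\<^bsub>Q\<^esub> F b" if "a \<in> carrier ?P" "b \<in> carrier ?P" for a b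
    using that F by (simp add: hom_def)
  have Fc: "F a \<in> carrier Q" if "a \<in> carrier ?P" for a
    using that F by (auto simp: hom_def)
  show h: "?h \<in> hom G Q"
  proof (rule homI)
    fix a b assume ab: "a \<in> carrier G" "b \<in> carrier G"
    show "?h a \<in> carrier Q" by (rule Fc[OF pc_unit_carrier[OF ab(1)]])
    show "?h (a \<otimes> b) = ?h a \<otimes>\<^bsub>Q\<^esub> ?h b"
      unfolding pc_unit_mult[OF ab] by (rule Fm[OF pc_unit_carrier[OF ab(1)] pc_unit_carrier[OF ab(2)]])
  qed
  interpret h: group_hom G Q ?h
    unfolding group_hom_def group_hom_axioms_def using h assms(1) is_group by blast
  note nN = fin_index_normalsD[OF N(1)]
  have sub: "N \<subseteq> kernel G Q ?h"
  proof
    fix g assume g: "g \<in> N"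
    then have gc: "g \<in> carrier G" by (rule subgroup.mem_carrier[OF normal_imp_subgroup[OF nN]])
    have "N #> g = N" using g normal_imp_subgroup[OF nN] by (simp add: subgroup.rcos_const is_group)
    then have "pc_unit G g \<in> pc_basic_open G N" using N(1) pc_unit_carrier[OF gc]
      by (simp add: pc_basic_open_def pc_unit_def)
    then show "g \<in> kernel G Q ?h" using N(2) gc by (simp add: kernel_def)
  qed
  obtain g where g: "g \<in> carrier G" "x N = N #> g" "g \<in> x N" using pc_obtain_rep[OF x N(1)] .
  have "x N \<subseteq> x (kernel G Q ?h)"
    by (rule pc_mono[OF x N(1) kernel_fin_index[OF h assms(1,2)] sub])
  with g(3) have "g \<in> x (kernel G Q ?h)" by blast
  from pc_extend_eq[OF h assms(1,2) x this]
  have "pc_extend G Q ?h x = F (pc_unit G g)" .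
  also have "\<dots> = F x"
  proof -
    let ?i = "pc_unit G (inv g)"
    have ic: "?i \<in> carrier ?P" using g by (simp add: pc_unit_carrier)
    have "?i \<otimes>\<^bsub>?P\<^esub> x \<in> carrier ?P" by (rule pc_mult_closed[OF ic x])
    moreover have "(?i \<otimes>\<^bsub>?P\<^esub> x) N = N"
    proof -
      have "N #> \<one> = N" using nN by (meson coset_mult_one normal_imp_subgroup subgroup.subset)
      then show ?thesis
        using N(1) g(1,2) nN by (simp add: profinite_completion_def pc_unit_def normal.rcos_sum)
    qed
    ultimately have "F (?i \<otimes>\<^bsub>?P\<^esub> x) = \<one>\<^bsub>Q\<^esub>" by (intro N(2)) (simp add: pc_basic_open_def)
    then have "?h (inv g) \<otimes>\<^bsub>Q\<^esub> F x = \<one>\<^bsub>Q\<^esub>" using Fm[OF ic x] by simp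
    then have "inv\<^bsub>Q\<^esub> (?h g) \<otimes>\<^bsub>Q\<^esub> F x = \<one>\<^bsub>Q\<^esub>" using g h.hom_inv[OF g(1)] by simp
    then have "inv\<^bsub>Q\<^esub> (F x) = inv\<^bsub>Q\<^esub> (?h g)"
      using Fc[OF x] h.hom_closed[OF g(1)] by (intro Q.inv_equality) auto
    then have "inv\<^bsub>Q\<^esub> (inv\<^bsub>Q\<^esub> (F x)) = inv\<^bsub>Q\<^esub> (inv\<^bsub>Q\<^esub> (?h g))" by simp
    then show ?thesis using Fc[OF x] h.hom_closed[OF g(1)] by simp
  qed
  finally show "pc_extend G Q ?h x = F x" .
qed

end

text \<open>The kernel of \<open>h\<close> is contained in that of \<open>h'\<close>, so a
  representative of the first coordinate of \<open>x\<close> also represents the second.\<close>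

lemma pc_extend_natural:
  assumes "group G" "h \<in> hom G Q" "group Q" "finite (carrier Q)"
    and "p \<in> hom Q P" "group P" "finite (carrier P)" "x \<in> carrier (profinite_completion G)"
    and eq: "\<And>g. g \<in> carrier G \<Longrightarrow> h' g = p (h g)"
  shows "pc_extend G P h' x = p (pc_extend G Q h x)"
proof -
  interpret G: group G by fact
  interpret p: group_hom Q P p using assms by (simp add: group_hom_def group_hom_axioms_def)
  have hc: "h g \<in> carrier Q" if "g \<in> carrier G" for g using that assms(2) by (auto simp: hom_def)
  have h': "h' \<in> hom G P"
  proof (rule homI)
    fix a b assume ab: "a \<in> carrier G" "b \<in> carrier G"
    then show "h' a \<in> carrier P" by (simp add: eq hc)
    show "h' (a \<otimes>\<^bsub>G\<^esub> b) = h' a \<otimes>\<^bsub>P\<^esub> h' b"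
      using ab by (simp add: eq hom_mult[OF assms(2)] hc)
  qed
  note K = G.kernel_fin_index[OF assms(2-4)] and K' = G.kernel_fin_index[OF h' assms(6,7)]
  have "kernel G Q h \<subseteq> kernel G P h'" by (auto simp: kernel_def eq)
  then have sub: "x (kernel G Q h) \<subseteq> x (kernel G P h')"
    using assms(8) K K' by (auto simp: profinite_completion_def)
  obtain g where g: "g \<in> carrier G" "g \<in> x (kernel G Q h)" using G.pc_obtain_rep[OF assms(8) K] .
  with sub have "g \<in> x (kernel G P h')" by blast
  then show ?thesis
    using G.pc_extend_eq[OF h' assms(6-8)] G.pc_extend_eq[OF assms(2-4,8) g(2)] g eq by simp
qed

text \<open>Pull-back along \<open>\<phi>\<close>, read on generators: extend \<open>x\<close> to
  the completion, compose with \<open>\<phi>\<close>, evaluate at the generators of the other group.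
  It runs against \<open>\<phi>\<close>, from assignments on \<open>V\<close> to assignments on
  \<open>V'\<close>.\<close>

definition cox_transfer ::
  "'b set \<Rightarrow> 'b set set \<Rightarrow> ('b set \<Rightarrow> nat) \<Rightarrow> 'a set \<Rightarrow> 'a set set \<Rightarrow> ('a set \<Rightarrow> nat)
   \<Rightarrow> (('b list set set \<Rightarrow> 'b list set set) \<Rightarrow> ('a list set set \<Rightarrow> 'a list set set))
   \<Rightarrow> ('q, 'x) monoid_scheme \<Rightarrow> ('a \<Rightarrow> 'q) \<Rightarrow> ('b \<Rightarrow> 'q)" where
  "cox_transfer V' E' m' V E m \<phi> Q x = (\<lambda>v\<in>V'. pc_extend (coxeter_group V E m) Q (cox_lift Q x)
       (\<phi> (pc_unit (coxeter_group V' E' m') (cox_gen V' E' m' v))))"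

text \<open>The composite with \<open>\<phi>\<close> is continuous, hence equal to the extension of
  its own restriction to the generators. The second claim records this on the whole completion,
  which is what allows transfers to be composed.\<close>

lemma cox_transfer_aux:
  assumes \<phi>: "\<phi> \<in> hom (profinite_completion (coxeter_group V' E' m')) (profinite_completion (coxeter_group V E m))"
    and cont: "pc_continuous (coxeter_group V' E' m') (coxeter_group V E m) \<phi>"
    and Q: "group Q" "finite (carrier Q)" and x: "x \<in> cox_homs V E m Q"
  defines "y \<equiv> cox_transfer V' E' m' V E m \<phi> Q x"
  shows "y \<in> cox_homs V' E' m' Q"
    and "a \<in> carrier (profinite_completion (coxeter_group V' E' m')) \<Longrightarrow>
         pc_extend (coxeter_group V' E' m') Q (cox_lift Q y) a = pc_extend (coxeter_group V E m) Q (cox_lift Q x) (\<phi> a)"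
proof -
  let ?W = "coxeter_group V E m" and ?W' = "coxeter_group V' E' m'"
  interpret Q: group Q by fact
  let ?F = "\<lambda>a. pc_extend ?W Q (cox_lift Q x) (\<phi> a)"
  note hx = Q.cox_lift_hom[OF x]
  have F: "?F \<in> hom (profinite_completion ?W') Q"
    using hom_compose[OF \<phi> cox.pc_extend_hom[OF hx Q]] by (simp add: comp_def)
  obtain N where N: "N \<in> fin_index_normals ?W'"
    "\<phi> ` pc_basic_open ?W' N \<subseteq> pc_basic_open ?W (kernel ?W Q (cox_lift Q x))"
    using cont cox.kernel_fin_index[OF hx Q] by (auto simp: pc_continuous_def)
  have FN: "?F a = \<one>\<^bsub>Q\<^esub>" if "a \<in> pc_basic_open ?W' N" for a
    using that N(2) by (intro cox.pc_extend_basic_open[OF hx Q]) auto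
  have u1: "pc_unit ?W' \<one>\<^bsub>?W'\<^esub> \<in> carrier (profinite_completion ?W')"
    by (simp add: cox.pc_unit_carrier)
  note h = cox.pc_extend_unique(1)[OF Q F N(1) FN u1]
  show y: "y \<in> cox_homs V' E' m' Q"
    using cox_homs_comp[OF cox_gen_in_cox_homs h cox.is_group Q(1)]
    by (simp add: y_def cox_transfer_def comp_def)
  have *: "cox_lift Q y g = ?F (pc_unit ?W' g)" if "g \<in> carrier ?W'" for g
    using cox_hom_eqI[OF Q.cox_lift_hom[OF y] h Q(1) _ that]
    by (simp add: Q.cox_lift_gen[OF y]) (simp add: y_def cox_transfer_def)
  show "pc_extend ?W' Q (cox_lift Q y) a = ?F a" if a: "a \<in> carrier (profinite_completion ?W')"
  proof -
    have "(\<lambda>x. x) \<in> hom Q Q" by (auto simp: hom_def)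
    from pc_extend_natural[OF cox.is_group h Q this Q a *]
    show ?thesis using cox.pc_extend_unique(2)[OF Q F N(1) FN a] by simp
  qed
qed

lemma cox_transfer_inverse:
  assumes "\<phi> \<in> hom (profinite_completion (coxeter_group V' E' m')) (profinite_completion (coxeter_group V E m))"
    and "pc_continuous (coxeter_group V' E' m') (coxeter_group V E m) \<phi>"
    and \<psi>: "\<psi> \<in> hom (profinite_completion (coxeter_group V E m)) (profinite_completion (coxeter_group V' E' m'))"
    and inv: "\<And>a. a \<in> carrier (profinite_completion (coxeter_group V E m)) \<Longrightarrow> \<phi> (\<psi> a) = a"
    and Q: "group Q" "finite (carrier Q)" and x: "x \<in> cox_homs V E m Q"
  shows "cox_transfer V E m V' E' m' \<psi> Q (cox_transfer V' E' m' V E m \<phi> Q x) = x"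
proof -
  let ?W = "coxeter_group V E m" and ?W' = "coxeter_group V' E' m'"
  interpret Q: group Q by fact
  have gen: "cox_gen V E m v \<in> carrier ?W" if "v \<in> V" for v
    using that by (auto simp: cox_gen_def cox_carrier)
  have "cox_transfer V E m V' E' m' \<psi> Q (cox_transfer V' E' m' V E m \<phi> Q x) = restrict x V"
    unfolding cox_transfer_def[of V E m]
  proof (rule restrict_ext)
    fix v assume v: "v \<in> V"
    let ?u = "pc_unit ?W (cox_gen V E m v)"
    have u: "?u \<in> carrier (profinite_completion ?W)" using gen[OF v] by (rule cox.pc_unit_carrier)
    then have "\<psi> ?u \<in> carrier (profinite_completion ?W')" using \<psi> by (auto simp: hom_def)
    from cox_transfer_aux(2)[OF assms(1,2) Q x this]
    have "pc_extend ?W' Q (cox_lift Q (cox_transfer V' E' m' V E m \<phi> Q x)) (\<psi> ?u) =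
        pc_extend ?W Q (cox_lift Q x) ?u" by (simp add: inv[OF u])
    also have "\<dots> = x v"
      using cox.pc_extend_unit[OF Q.cox_lift_hom[OF x] Q gen[OF v]] Q.cox_lift_gen[OF x v] by simp
    finally show "pc_extend ?W' Q (cox_lift Q (cox_transfer V' E' m' V E m \<phi> Q x)) (\<psi> ?u) = x v" .
  qed
  then show ?thesis using cox_homs_ext[OF x] by simp
qed

lemma cox_transfer_natural:
  assumes \<phi>: "\<phi> \<in> hom (profinite_completion (coxeter_group V' E' m')) (profinite_completion (coxeter_group V E m))"
    and Q: "group Q" "finite (carrier Q)" and P: "group P" "finite (carrier P)"
    and p: "p \<in> hom Q P" and x: "x \<in> cox_homs V E m Q"
  shows "cox_transfer V' E' m' V E m \<phi> P (restrict (p \<circ> x) V) = restrict (p \<circ> cox_transfer V' E' m' V E m \<phi> Q x) V'"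
proof -
  let ?W = "coxeter_group V E m" and ?W' = "coxeter_group V' E' m'"
  interpret Q: group Q by fact
  interpret P: group P by fact
  note px = cox_homs_comp[OF x p Q(1) P(1)]
  have *: "cox_lift P (restrict (p \<circ> x) V) a = p (cox_lift Q x a)" if "a \<in> carrier ?W" for a
    using cox_hom_eqI[OF P.cox_lift_hom[OF px] hom_compose[OF Q.cox_lift_hom[OF x] p] P(1) _ that]
    using P.cox_lift_gen[OF px] Q.cox_lift_gen[OF x] by simp
  have "pc_extend ?W P (cox_lift P (restrict (p \<circ> x) V)) a = p (pc_extend ?W Q (cox_lift Q x) a)"
    if "a \<in> carrier (profinite_completion ?W)" for a
    using pc_extend_natural[OF cox.is_group Q.cox_lift_hom[OF x] Q p P that *] by simp
  moreover have "\<phi> (pc_unit ?W' (cox_gen V' E' m' v)) \<in> carrier (profinite_completion ?W)" if "v \<in> V'" for v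
  proof -
    have "cox_gen V' E' m' v \<in> carrier ?W'" using that by (auto simp: cox_gen_def cox_carrier)
    then show ?thesis by (rule hom_in_carrier[OF \<phi> cox.pc_unit_carrier])
  qed
  ultimately show ?thesis by (auto simp: cox_transfer_def fun_eq_iff)
qed

definition pc_iso_witness where
  "pc_iso_witness V' E' m' V E m \<phi> \<longleftrightarrow>
     \<phi> \<in> iso (profinite_completion (coxeter_group V' E' m')) (profinite_completion (coxeter_group V E m)) \<and>
     pc_continuous (coxeter_group V' E' m') (coxeter_group V E m) \<phi> \<and>
     pc_continuous (coxeter_group V E m) (coxeter_group V' E' m')
       (inv_into (carrier (profinite_completion (coxeter_group V' E' m'))) \<phi>)"

lemma cox_transfer_bij:
  assumes w: "pc_iso_witness V' E' m' V E m \<phi>" and Q: "group Q" "finite (carrier Q)"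
  shows "bij_betw (cox_transfer V' E' m' V E m \<phi> Q) (cox_homs V E m Q) (cox_homs V' E' m' Q)"
proof -
  let ?W = "coxeter_group V E m" and ?W' = "coxeter_group V' E' m'"
  let ?P = "profinite_completion ?W" and ?P' = "profinite_completion ?W'"
  have \<phi>: "\<phi> \<in> iso ?P' ?P" "pc_continuous ?W' ?W \<phi>" "pc_continuous ?W ?W' (inv_into (carrier ?P') \<phi>)"
    using w by (simp_all add: pc_iso_witness_def)
  let ?\<psi> = "inv_into (carrier ?P') \<phi>"
  have \<phi>h: "\<phi> \<in> hom ?P' ?P" and bij: "bij_betw \<phi> (carrier ?P') (carrier ?P)" using \<phi>(1) by (auto simp: iso_def)
  note mc = group.pc_mult_closed[OF group_coxeter_group, of _ V' E' m']
  have inv1: "\<phi> (?\<psi> a) = a" if "a \<in> carrier ?P" for a using that bij by (simp add: bij_betw_inv_into_right)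
  have inv2: "?\<psi> (\<phi> a) = a" if "a \<in> carrier ?P'" for a using that bij by (simp add: bij_betw_inv_into_left)
  have \<psi>c: "?\<psi> a \<in> carrier ?P'" if "a \<in> carrier ?P" for a using that bij by (metis bij_betw_def inv_into_into)
  \<comment> \<open>Multiplicativity of the inverse follows by applying \<open>\<phi>\<close> to the
    product of the two preimages, which lies in the completion by closure.\<close>
  have \<psi>h: "?\<psi> \<in> hom ?P ?P'"
  proof (rule homI)
    fix a b assume ab: "a \<in> carrier ?P" "b \<in> carrier ?P"
    have "\<phi> (?\<psi> a \<otimes>\<^bsub>?P'\<^esub> ?\<psi> b) = a \<otimes>\<^bsub>?P\<^esub> b" using ab \<phi>h by (simp add: hom_def \<psi>c inv1)
    then show "?\<psi> (a \<otimes>\<^bsub>?P\<^esub> b) = ?\<psi> a \<otimes>\<^bsub>?P'\<^esub> ?\<psi> b" using inv2[OF mc[OF \<psi>c[OF ab(1)] \<psi>c[OF ab(2)]]] by simp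
  qed (rule \<psi>c)
  show ?thesis
  proof (rule bij_betwI)
    show "cox_transfer V' E' m' V E m \<phi> Q \<in> cox_homs V E m Q \<rightarrow> cox_homs V' E' m' Q"
      using cox_transfer_aux(1)[OF \<phi>h \<phi>(2) Q] by blast
    show "cox_transfer V E m V' E' m' ?\<psi> Q \<in> cox_homs V' E' m' Q \<rightarrow> cox_homs V E m Q"
      using cox_transfer_aux(1)[OF \<psi>h \<phi>(3) Q] by blast
    show "cox_transfer V E m V' E' m' ?\<psi> Q (cox_transfer V' E' m' V E m \<phi> Q x) = x" if "x \<in> cox_homs V E m Q" for x
      using cox_transfer_inverse[OF \<phi>h \<phi>(2) \<psi>h inv1 Q that] .
    show "cox_transfer V' E' m' V E m \<phi> Q (cox_transfer V E m V' E' m' ?\<psi> Q x) = x" if "x \<in> cox_homs V' E' m' Q" for x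
      using cox_transfer_inverse[OF \<psi>h \<phi>(3) \<phi>h inv2 Q that] .
  qed
qed

text \<open>By naturality the transfers for \<open>Q\<close> and \<open>P\<close> commute with
  \<open>p\<close>, so the fibre over \<open>y\<close> is carried onto the fibre over its transfer.
  Not only total counts but individual fibre sizes are thereby invariants.\<close>

lemma cox_transfer_fibre:
  assumes w: "pc_iso_witness V' E' m' V E m \<phi>"
    and Q: "group Q" "finite (carrier Q)" and P: "group P" "finite (carrier P)" and p: "p \<in> hom Q P"
    and y: "y \<in> cox_homs V E m P"
  shows "card {x \<in> cox_homs V' E' m' Q. restrict (p \<circ> x) V' = cox_transfer V' E' m' V E m \<phi> P y} =
    card {x \<in> cox_homs V E m Q. restrict (p \<circ> x) V = y}"
proof -
  let ?T = "cox_transfer V' E' m' V E m \<phi>"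
  have \<phi>h: "\<phi> \<in> hom (profinite_completion (coxeter_group V' E' m')) (profinite_completion (coxeter_group V E m))"
    using w by (simp add: pc_iso_witness_def iso_def)
  note TQ = cox_transfer_bij[OF w Q] and TP = cox_transfer_bij[OF w P]
  have nat: "?T P (restrict (p \<circ> x) V) = restrict (p \<circ> ?T Q x) V'" if "x \<in> cox_homs V E m Q" for x
    by (rule cox_transfer_natural[OF \<phi>h Q P p that])
  have img: "?T Q ` {x \<in> cox_homs V E m Q. restrict (p \<circ> x) V = y} =
      {x \<in> cox_homs V' E' m' Q. restrict (p \<circ> x) V' = ?T P y}"
  proof (intro equalityI subsetI)
    fix x' assume "x' \<in> {x \<in> cox_homs V' E' m' Q. restrict (p \<circ> x) V' = ?T P y}"
    then have x': "x' \<in> cox_homs V' E' m' Q" "restrict (p \<circ> x') V' = ?T P y" by auto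
    obtain x where x: "x \<in> cox_homs V E m Q" "x' = ?T Q x"
      using x'(1) TQ by (auto simp: bij_betw_def)
    have "?T P (restrict (p \<circ> x) V) = ?T P y" using nat[OF x(1)] x'(2) x(2) by simp
    then have "restrict (p \<circ> x) V = y"
      using TP cox_homs_comp[OF x(1) p Q(1) P(1)] y by (auto simp: bij_betw_def inj_on_def)
    then show "x' \<in> ?T Q ` {x \<in> cox_homs V E m Q. restrict (p \<circ> x) V = y}" using x by blast
  next
    fix x' assume "x' \<in> ?T Q ` {x \<in> cox_homs V E m Q. restrict (p \<circ> x) V = y}"
    then obtain x where x: "x \<in> cox_homs V E m Q" "restrict (p \<circ> x) V = y" "x' = ?T Q x" by auto
    then show "x' \<in> {x \<in> cox_homs V' E' m' Q. restrict (p \<circ> x) V' = ?T P y}"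
      using nat[OF x(1)] TQ by (auto simp: bij_betw_def)
  qed
  have "inj_on (?T Q) {x \<in> cox_homs V E m Q. restrict (p \<circ> x) V = y}"
    using TQ by (auto simp: bij_betw_def intro: inj_on_subset)
  from card_image[OF this] show ?thesis by (simp only: img)
qed

section \<open>Primes with an element of prescribed order\<close>

hide_const (open) Divisibility.prime

text \<open>The cofactor of \<open>b - 1\<close> is a geometric sum of \<open>q\<close> terms, each
  congruent to 1 modulo \<open>p\<close>; the sum is congruent to \<open>q\<close> and hence prime
  to \<open>p\<close>.\<close>

lemma multiplicity_power_minus_one:
  fixes b q p :: nat
  assumes p: "prime p" and q: "\<not> p dvd q" and b: "b \<ge> 2" "p dvd b - 1"
  shows "multiplicity p (b ^ q - 1) = multiplicity p (b - 1)"
proof -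
  have "int (b ^ q - 1) = int b ^ q - 1" using b by (simp add: of_nat_diff)
  also have "\<dots> = (int b - 1) * (\<Sum>i<q. int b ^ i)" by (rule power_diff_1_eq)
  also have "\<dots> = int ((b - 1) * (\<Sum>i<q. b ^ i))" using b by (simp add: of_nat_diff)
  finally have eq: "b ^ q - 1 = (b - 1) * (\<Sum>i<q. b ^ i)" by linarith
  have "[b = 1] (mod p)" using b by (metis cong_altdef_nat cong_sym diff_is_0_eq' le_trans nat_le_linear one_le_numeral)
  then have "[(\<Sum>i<q. b ^ i) = (\<Sum>i<q. 1 ^ i)] (mod p)" by (intro cong_sum cong_pow)
  then have "\<not> p dvd (\<Sum>i<q. b ^ i)" using q by (simp add: cong_dvd_iff)
  moreover from this have "(\<Sum>i<q. b ^ i) \<noteq> 0" by (metis dvd_0_right)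
  moreover have "b - 1 \<noteq> 0" using b by simp
  ultimately show ?thesis unfolding eq using p
    by (subst prime_elem_multiplicity_mult_distrib) (auto simp: not_dvd_imp_multiplicity_0)
qed

text \<open>Following Niven and Powell: if no prime had order exactly $M$, then
  $\prod_T (a^{M/\prod T} - 1)^{(-1)^{|T|}}$ over the sets $T$ of prime factors of $M$ would be $1$,
  which is refuted modulo $a^{2k}$, where $k$ is the smallest exponent.\<close>

lemma exists_prime_ord:
  fixes M :: nat
  assumes M: "M \<ge> 2"
  shows "\<exists>(p::nat) (a::nat). prime p \<and> ord p a = M"
proof (rule ccontr)
  assume contra: "\<not> ?thesis"
  \<comment> \<open>Since \<open>M\<close> divides \<open>a\<close>, a prime divisor of
    \<open>M\<close> divides no \<open>f T\<close>. This removes the exceptional primes at which a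
    multiplicity could jump when the exponent is multiplied by a prime factor of
    \<open>M\<close>.\<close>
  define a where "a = 2 * M"
  define P where "P = prime_factors M"
  define e where "e T = M div \<Prod>T" for T :: "nat set"
  define f where "f T = a ^ e T - 1" for T
  have a: "a \<ge> 4" using M by (simp add: a_def)
  have fin: "finite P" by (simp add: P_def)
  have Pp: "prime q" "q dvd M" if "q \<in> P" for q using that by (auto simp: P_def)
  have prod_dvd: "\<Prod>T dvd m" if "T \<subseteq> P" "\<And>q. q \<in> T \<Longrightarrow> q dvd m" for T m
    using that fin
  proof (induction T rule: infinite_finite_induct)
    case (insert q T)
    have "coprime q (\<Prod>T)"
    proof (rule prod_coprime_right)
      fix i assume "i \<in> T"
      then have "prime i" "prime q" "q \<noteq> i" using insert Pp(1) by auto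
      then show "coprime q i" by (intro primes_coprime)
    qed
    then show ?case using insert by (auto intro!: divides_mult)
  qed auto
  have eM: "\<Prod>T * e T = M" if "T \<subseteq> P" for T
  proof -
    have "\<Prod>T dvd M" using that Pp(2) by (intro prod_dvd) auto
    then show ?thesis by (simp add: e_def)
  qed
  have prod_nz: "\<Prod>T \<noteq> 0" if "T \<subseteq> P" for T
  proof
    assume "\<Prod>T = 0"
    then show False using eM[OF that] M by simp
  qed
  have epos: "e T \<ge> 1" if "T \<subseteq> P" for T using eM[OF that] M by (cases "e T") auto
  have fpos: "f T > 0" if "T \<subseteq> P" for T
    using a one_less_power[of a "e T"] epos[OF that] by (simp add: f_def)
  \<comment> \<open>The triviality of the alternating product, written additively at each prime
    \<open>p\<close>.\<close>
  have mult0: "(\<Sum>T\<in>Pow P. (- 1) ^ card T * int (multiplicity p (f T))) = 0" if p: "prime p" for p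
  proof (cases "p dvd a")
    case True
    have "multiplicity p (f T) = 0" if T: "T \<subseteq> P" for T
    proof (rule not_dvd_imp_multiplicity_0)
      show "\<not> p dvd f T"
      proof
        assume "p dvd f T"
        moreover have "p dvd a ^ e T" using True epos[OF T] by (auto intro: dvd_power_le dvd_trans[OF _ dvd_power])
        moreover have "a ^ e T - f T = 1" using fpos[OF T] by (simp add: f_def)
        ultimately have "p dvd 1" by (metis dvd_diff_nat)
        then show False using p by auto
      qed
    qed
    then show ?thesis by simp
  next
    case False
    define d where "d = ord p a"
    have dvd_f: "p dvd f T \<longleftrightarrow> d dvd e T" if "T \<subseteq> P" for T
    proof -
      have "[a ^ e T = 1] (mod p) \<longleftrightarrow> p dvd f T"
        using a by (simp add: f_def cong_altdef_nat)
      then show ?thesis by (simp add: ord_divides' d_def)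
    qed
    show ?thesis
    proof (cases "d dvd M")
      case False
      have "multiplicity p (f T) = 0" if T: "T \<subseteq> P" for T
        using dvd_f[OF T] False eM[OF T] by (intro not_dvd_imp_multiplicity_0) (metis dvd_mult)
      then show ?thesis by simp
    next
      case True
      have "d \<noteq> M" using contra p unfolding d_def by blast
      with True obtain r where r: "M = d * r" "r \<noteq> 1" by (auto elim: dvdE)
      \<comment> \<open>With \<open>q\<close> a prime of the cofactor of \<open>d\<close> in
        \<open>M\<close>, adding \<open>q\<close> to \<open>T\<close> does not change whether
        \<open>d\<close> divides the exponent, nor the multiplicity. So \<open>T\<close> and
        \<open>insert q T\<close> contribute opposite terms.\<close>
      obtain q where q: "prime q" "q dvd r" using prime_factor_nat[OF r(2)] by auto
      have qP: "q \<in> P" unfolding P_def using q r M by (intro prime_factorsI) (auto intro!: gr0I)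
      have pq: "\<not> p dvd q"
      proof
        assume "p dvd q"
        then have "p dvd M" using Pp(2)[OF qP] by (rule dvd_trans)
        then show False using \<open>\<not> p dvd a\<close> by (simp add: a_def)
      qed
      have dM: "0 < d" using True M by (auto intro: ccontr)
      have key: "multiplicity p (f (insert q T)) = multiplicity p (f T)" if T: "T \<subseteq> P - {q}" for T
      proof -
        have TP: "T \<subseteq> P" "insert q T \<subseteq> P" using T qP by auto
        have "\<Prod>(insert q T) = q * \<Prod>T"
          using T fin finite_subset[of T P] by (subst prod.insert) auto
        with eM[OF TP(1)] eM[OF TP(2)] have "\<Prod>T * e T = \<Prod>T * (q * e (insert q T))" by (simp add: mult_ac)
        moreover note prod_nz[OF TP(1)]
        ultimately have eT: "e T = e (insert q T) * q" by simp
        show ?thesis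
        proof (cases "d dvd e T")
          case True
          \<comment> \<open>The primes in \<open>T\<close> divide \<open>r\<close> because
            \<open>d\<close> divides \<open>e T\<close>, and \<open>q\<close> does by choice.
            Distinct primes may be multiplied, so \<open>d\<close> still divides the smaller
            exponent.\<close>
          have "\<Prod>(insert q T) dvd r"
          proof (rule prod_dvd[OF TP(2)])
            fix s assume s: "s \<in> insert q T"
            show "s dvd r"
            proof (cases "s = q")
              case False
              with s have sT: "s \<in> T" by simp
              have "d * r = \<Prod>T * e T" using eM[OF TP(1)] r by simp
              also obtain c where "e T = d * c" using True by auto
              finally have "r = \<Prod>T * c" using dM by (simp add: mult_ac)
              moreover have "s dvd \<Prod>T"
                using sT finite_subset[OF TP(1) fin] dvd_prodI[of T s "\<lambda>x. x"] by simp
              ultimately show ?thesis by simp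
            qed (simp add: q)
          qed
          then obtain c where "r = \<Prod>(insert q T) * c" by auto
          then have "\<Prod>(insert q T) * e (insert q T) = \<Prod>(insert q T) * (d * c)"
            using eM[OF TP(2)] r by (simp add: mult_ac)
          moreover note prod_nz[OF TP(2)]
          ultimately have "d dvd e (insert q T)" by simp
          then have "p dvd a ^ e (insert q T) - 1" using dvd_f[OF TP(2)] by (simp add: f_def)
          moreover have "a ^ e (insert q T) \<ge> 2"
            using fpos[OF TP(2)] by (simp add: f_def)
          ultimately show ?thesis
            using multiplicity_power_minus_one[OF p pq, of "a ^ e (insert q T)"]
            by (simp add: f_def eT power_mult)
        next
          case False
          then have "\<not> d dvd e (insert q T)" using eT by auto
          with False show ?thesis using dvd_f TP by (simp add: not_dvd_imp_multiplicity_0)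
        qed
      qed
      let ?g = "\<lambda>T. (- 1) ^ card T * int (multiplicity p (f T))"
      have split: "Pow P = Pow (P - {q}) \<union> insert q ` Pow (P - {q})"
        using Pow_insert[of q "P - {q}"] qP by (simp add: insert_absorb)
      have "(\<Sum>T\<in>Pow P. ?g T) = (\<Sum>T\<in>Pow (P - {q}). ?g T) + (\<Sum>T\<in>insert q ` Pow (P - {q}). ?g T)"
        unfolding split using fin by (intro sum.union_disjoint) auto
      also have "(\<Sum>T\<in>insert q ` Pow (P - {q}). ?g T) = (\<Sum>T\<in>Pow (P - {q}). ?g (insert q T))"
        by (subst sum.reindex) (auto simp: inj_on_def)
      also have "\<dots> = (\<Sum>T\<in>Pow (P - {q}). - ?g T)"
      proof (rule sum.cong)
        fix T assume T: "T \<in> Pow (P - {q})"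
        then have "card (insert q T) = Suc (card T)" using fin finite_subset[of T P] by (subst card_insert_disjoint) auto
        then show "?g (insert q T) = - ?g T" using key[of T] T by simp
      qed simp
      finally show ?thesis by (simp add: sum_negf)
    qed
  qed
  define A where "A = (\<Prod>T\<in>{T \<in> Pow P. even (card T)}. f T)"
  define B where "B = (\<Prod>T\<in>{T \<in> Pow P. odd (card T)}. f T)"
  have "A = B"
  proof (rule multiplicity_eq_nat)
    show "0 < A" "0 < B" using fpos fin by (auto simp: A_def B_def intro!: prod_pos)
    fix p :: nat assume p: "prime p"
    have distr: "multiplicity p (\<Prod>T\<in>S. f T) = (\<Sum>T\<in>S. multiplicity p (f T))" if S: "S \<subseteq> Pow P" for S
    proof (rule prime_elem_multiplicity_prod_distrib)
      show "finite S" using S fin by (meson finite_Pow_iff finite_subset)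
      show "0 \<notin> f ` S"
      proof
        assume "0 \<in> f ` S"
        then obtain T where "T \<in> S" "f T = 0" by auto
        then show False using S fpos[of T] by auto
      qed
    qed (use p in simp)
    have "multiplicity p A = (\<Sum>T\<in>{T \<in> Pow P. even (card T)}. multiplicity p (f T))"
      "multiplicity p B = (\<Sum>T\<in>{T \<in> Pow P. odd (card T)}. multiplicity p (f T))"
      unfolding A_def B_def by (rule distr, blast)+
    moreover have "(\<Sum>T\<in>Pow P. (- 1) ^ card T * int (multiplicity p (f T))) =
       int (\<Sum>T\<in>{T \<in> Pow P. even (card T)}. multiplicity p (f T)) -
       int (\<Sum>T\<in>{T \<in> Pow P. odd (card T)}. multiplicity p (f T))"
    proof -
      let ?g = "\<lambda>T. (- 1) ^ card T * int (multiplicity p (f T))"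
      have "(\<Sum>T\<in>Pow P. ?g T) = (\<Sum>T\<in>{T \<in> Pow P. even (card T)} \<union> {T \<in> Pow P. odd (card T)}. ?g T)"
        by (rule sum.cong) auto
      also have "\<dots> = (\<Sum>T\<in>{T \<in> Pow P. even (card T)}. ?g T) + (\<Sum>T\<in>{T \<in> Pow P. odd (card T)}. ?g T)"
        using fin by (intro sum.union_disjoint) auto
      also have "\<dots> = (\<Sum>T\<in>{T \<in> Pow P. even (card T)}. int (multiplicity p (f T))) +
          (\<Sum>T\<in>{T \<in> Pow P. odd (card T)}. - int (multiplicity p (f T)))"
        by (intro arg_cong2[of _ _ _ _ "(+)"] sum.cong) auto
      finally show ?thesis by (simp add: sum_negf)
    qed
    ultimately show "multiplicity p A = multiplicity p B" using mult0[OF p] by linarith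
  qed
  define k where "k = e P"
  define N where "N = int a ^ (2 * k)"
  have k: "k \<ge> 1" using epos[of P] by (simp add: k_def)
  \<comment> \<open>For \<open>T\<close> different from \<open>P\<close> the exponent is
    \<open>k\<close> times the product of the missing primes, hence at least \<open>2 * k\<close>,
    and its power vanishes modulo \<open>N\<close>. Only \<open>f P\<close> is not a sign modulo
    \<open>N\<close>.\<close>
  have other: "[int (f T) = - 1] (mod N)" if T: "T \<subseteq> P" "T \<noteq> P" for T
  proof -
    obtain q where q: "q \<in> P" "q \<notin> T" using T by auto
    have "\<Prod>P = \<Prod>T * \<Prod>(P - T)" using T fin by (subst prod.subset_diff[OF T(1) fin]) (simp add: mult_ac)
    with eM[OF T(1)] eM[of P] have "\<Prod>T * e T = \<Prod>T * (\<Prod>(P - T) * k)" by (simp add: k_def mult_ac)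
    moreover note prod_nz[OF T(1)]
    ultimately have eT: "e T = \<Prod>(P - T) * k" by simp
    have "q dvd \<Prod>(P - T)" using q fin dvd_prodI[of "P - T" q "\<lambda>x. x"] by simp
    moreover have "\<Prod>(P - T) \<noteq> 0" using eT epos[OF T(1)] by auto
    ultimately have "q \<le> \<Prod>(P - T)" by (auto dest: dvd_imp_le)
    then have "2 * k \<le> e T" unfolding eT using prime_ge_2_nat[OF Pp(1)[OF q(1)]] by (intro mult_right_mono) auto
    then have "N dvd int a ^ e T" unfolding N_def by (rule le_imp_power_dvd)
    moreover have "int (f T) = int a ^ e T - 1" using fpos[OF T(1)] by (simp add: f_def of_nat_diff)
    ultimately show ?thesis by (simp add: cong_iff_dvd_diff)
  qed
  have fP: "int (f P) = int a ^ k - 1" using fpos[of P] by (simp add: f_def k_def of_nat_diff)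
  have pm: "\<exists>s \<in> {1, - 1}. [int (\<Prod>T\<in>S. f T) = s] (mod N)" if "S \<subseteq> Pow P - {P}" for S
  proof -
    have "[int (\<Prod>T\<in>S. f T) = (\<Prod>T\<in>S. - 1)] (mod N)"
      unfolding of_nat_prod using that by (intro cong_prod other) auto
    then show ?thesis by (cases "even (card S)") auto
  qed
  have pmP: "\<exists>s \<in> {1, - 1}. [int (\<Prod>T\<in>S. f T) = s * (int a ^ k - 1)] (mod N)" if "S \<subseteq> Pow P" "P \<in> S" for S
  proof -
    have "finite S" using that(1) fin by (meson finite_Pow_iff finite_subset)
    then have "int (\<Prod>T\<in>S. f T) = int (\<Prod>T\<in>S - {P}. f T) * (int a ^ k - 1)"
      using that by (subst prod.remove[of _ P]) (auto simp: fP)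
    moreover have "S - {P} \<subseteq> Pow P - {P}" using that(1) by blast
    from pm[OF this] obtain s where "s \<in> {1, - 1}" "[int (\<Prod>T\<in>S - {P}. f T) = s] (mod N)" ..
    ultimately have "[int (\<Prod>T\<in>S. f T) = s * (int a ^ k - 1)] (mod N)" by (simp add: cong_scalar_right)
    with \<open>s \<in> {1, - 1}\<close> show ?thesis by (rule bexI[rotated])
  qed
  have "\<exists>s \<in> {1, - 1}. \<exists>s' \<in> {1, - 1}. [s * (int a ^ k - 1) = s'] (mod N)"
  proof (cases "even (card P)")
    case True
    obtain s where s: "s \<in> {1, - 1}" "[int A = s * (int a ^ k - 1)] (mod N)"
      unfolding A_def using pmP[of "{T \<in> Pow P. even (card T)}"] True by blast
    obtain s' where s': "s' \<in> {1, - 1}" "[int B = s'] (mod N)"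
      unfolding B_def using pm[of "{T \<in> Pow P. odd (card T)}"] True by blast
    have "[s * (int a ^ k - 1) = s'] (mod N)"
      using cong_trans[OF cong_sym[OF s(2)]] s'(2) \<open>A = B\<close> by simp
    with s(1) s'(1) show ?thesis by (intro bexI)
  next
    case False
    obtain s where s: "s \<in> {1, - 1}" "[int B = s * (int a ^ k - 1)] (mod N)"
      unfolding B_def using pmP[of "{T \<in> Pow P. odd (card T)}"] False by blast
    obtain s' where s': "s' \<in> {1, - 1}" "[int A = s'] (mod N)"
      unfolding A_def using pm[of "{T \<in> Pow P. even (card T)}"] False by blast
    have "[s * (int a ^ k - 1) = s'] (mod N)"
      using cong_trans[OF cong_sym[OF s(2)]] s'(2) \<open>A = B\<close> by simp
    with s(1) s'(1) show ?thesis by (intro bexI)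
  qed
  then obtain s s' :: int where s: "s \<in> {1, - 1}" "s' \<in> {1, - 1}" "N dvd s * (int a ^ k - 1) - s'"
    unfolding cong_iff_dvd_diff by blast
  \<comment> \<open>Multiplication by \<open>s\<close> clears the sign: what remains is
    \<open>a ^ k\<close> minus 0 or 2, a number strictly between 0 and \<open>N\<close>.\<close>
  then have "N dvd s * (s * (int a ^ k - 1) - s')" by (intro dvd_mult)
  also have "s * (s * (int a ^ k - 1) - s') = int a ^ k - (1 + s * s')"
    using s(1) by (auto simp: algebra_simps)
  finally have "N dvd int a ^ k \<or> N dvd int a ^ k - 2" using s(1,2) by auto
  moreover have ak: "int a ^ k \<ge> 4"
    using self_le_power[of "int a" k] a k by linarith
  moreover have "int a ^ k < N"
    unfolding N_def using a k by (intro power_strict_increasing) auto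
  ultimately show False
    using zdvd_not_zless[of "int a ^ k" N] zdvd_not_zless[of "int a ^ k - 2" N] by linarith
qed

section \<open>Affine recursions modulo a prime\<close>

lemma cong_affine_recursion:
  fixes s :: "nat \<Rightarrow> int"
  assumes "\<And>k. [s (Suc k) = r * s k + c] (mod p)"
  shows "[s k = r ^ k * s 0 + c * (\<Sum>i<k. r ^ i)] (mod p)"
proof (induction k)
  case (Suc k)
  have "[r * s k + c = r * (r ^ k * s 0 + c * (\<Sum>i<k. r ^ i)) + c] (mod p)"
    using Suc by (intro cong_add cong_mult) auto
  moreover have "r * (r ^ k * s 0 + c * (\<Sum>i<k. r ^ i)) + c = r ^ Suc k * s 0 + c * (\<Sum>i<Suc k. r ^ i)"
    by (simp only: sum.lessThan_Suc_shift) (simp add: algebra_simps sum_distrib_left)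
  ultimately show ?case using cong_trans[OF assms] by simp
qed simp

text \<open>The geometric sum times \<open>r - 1\<close> is \<open>r ^ m - 1\<close>. As
  \<open>p\<close> is prime and \<open>r\<close> is not 1, the sum vanishes, and with it the
  contribution of \<open>c\<close>.\<close>

lemma cong_affine_periodic:
  fixes s :: "nat \<Rightarrow> int"
  assumes s: "\<And>k. [s (Suc k) = r * s k + c] (mod p)"
    and p: "prime p" and r: "[r ^ m = 1] (mod p)" "\<not> [r = 1] (mod p)"
  shows "[s m = s 0] (mod p)"
proof -
  have "r ^ m - 1 = (r - 1) * (\<Sum>i<m. r ^ i)" by (rule power_diff_1_eq)
  then have "p dvd (\<Sum>i<m. r ^ i)"
    using r p by (auto simp: cong_iff_dvd_diff prime_dvd_mult_iff)
  then have "[c * (\<Sum>i<m. r ^ i) = 0] (mod p)" by (simp add: cong_0_iff)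
  then have "[r ^ m * s 0 + c * (\<Sum>i<m. r ^ i) = 1 * s 0 + 0] (mod p)"
    using r(1) by (intro cong_add cong_mult) auto
  then show ?thesis using cong_affine_recursion[where s = s, OF s, of m] by (auto intro: cong_trans)
qed

section \<open>Finite reflection quotients\<close>

text \<open>The reflection of the geometric representation in coordinates, reduced modulo
  \<open>p\<close>; \<open>c v u\<close> plays the role of 2 cos(pi/m).\<close>

definition geom_refl :: "'a set \<Rightarrow> int \<Rightarrow> ('a \<Rightarrow> 'a \<Rightarrow> int) \<Rightarrow> 'a \<Rightarrow> ('a \<Rightarrow> int) \<Rightarrow> ('a \<Rightarrow> int)" where
  "geom_refl V p c v y = y(v := ((\<Sum>u\<in>V - {v}. c v u * y u) - y v) mod p)"

lemma geom_refl_other: "u \<noteq> v \<Longrightarrow> geom_refl V p c v y u = y u"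
  by (simp add: geom_refl_def)

lemma geom_refl_PiE: "v \<in> V \<Longrightarrow> 0 < p \<Longrightarrow> y \<in> V \<rightarrow>\<^sub>E {0..<p} \<Longrightarrow> geom_refl V p c v y \<in> V \<rightarrow>\<^sub>E {0..<p}"
  by (auto simp: geom_refl_def PiE_def extensional_def)

lemma geom_refl_involution:
  assumes "v \<in> V" "0 < p" "y \<in> V \<rightarrow>\<^sub>E {0..<p}"
  shows "geom_refl V p c v (geom_refl V p c v y) = y"
proof -
  let ?s = "\<Sum>u\<in>V - {v}. c v u * y u"
  have y: "0 \<le> y v" "y v < p" using assms by (auto simp: PiE_def Pi_def)
  have "(\<Sum>u\<in>V - {v}. c v u * geom_refl V p c v y u) = ?s"
    by (intro sum.cong) (auto simp: geom_refl_other)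
  moreover have "(?s - (?s - y v) mod p) mod p = y v"
  proof -
    have "(?s - (?s - y v) mod p) mod p = (?s - (?s - y v)) mod p" by (rule mod_diff_right_eq)
    then show ?thesis using y by simp
  qed
  ultimately show ?thesis
    by (simp add: geom_refl_def[of V p c v "geom_refl V p c v y"]) (simp add: geom_refl_def)
qed

text \<open>On the coordinates $(u, z)$ at $v$ and $w$ the product of the two reflections is affine with
  eigenfunctionals $u - \theta z$ and $u - \theta^{-1} z$ for the eigenvalues $\theta^{\mp 2}$.\<close>

lemma geom_refl_pair_step:
  fixes p t t' :: int
  assumes V: "finite V" "v \<in> V" "w \<in> V" "v \<noteq> w" and t: "[t * t' = 1] (mod p)"
    and c: "c v w = t + t'" "c w v = t + t'"
  defines "T \<equiv> geom_refl V p c v \<circ> geom_refl V p c w"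
  defines "K \<equiv> \<lambda>a y. \<Sum>u\<in>V - {v, w}. c a u * y u"
  shows "[T y v - t * T y w = t' ^ 2 * (y v - t * y w) + (K v y + t' * K w y)] (mod p)"
    and "u \<noteq> v \<Longrightarrow> u \<noteq> w \<Longrightarrow> T y u = y u"
    and "K a (T y) = K a y"
proof -
  let ?y1 = "geom_refl V p c w y"
  have Kw: "(\<Sum>u\<in>V - {w}. c w u * y u) = (t + t') * y v + K w y"
  proof -
    have "V - {w} - {v} = V - {v, w}" by auto
    then show ?thesis using V sum.remove[of "V - {w}" v "\<lambda>u. c w u * y u"] by (simp add: K_def c(2))
  qed
  have "(\<Sum>u\<in>V - {v}. c v u * ?y1 u) = (t + t') * ?y1 w + K v ?y1"
  proof -
    have "V - {v} - {w} = V - {v, w}" by auto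
    then show ?thesis using V sum.remove[of "V - {v}" w "\<lambda>u. c v u * ?y1 u"] by (simp add: K_def c(1))
  qed
  moreover have "K v ?y1 = K v y" unfolding K_def by (intro sum.cong) (auto simp: geom_refl_other)
  ultimately have Kv: "(\<Sum>u\<in>V - {v}. c v u * ?y1 u) = (t + t') * ?y1 w + K v y" by simp
  have y1: "?y1 v = y v" using V by (simp add: geom_refl_other)
  have Tv: "T y v = ((t + t') * ?y1 w + K v y - y v) mod p"
    unfolding T_def comp_def using V Kv by (simp add: geom_refl_def[of V p c v] y1)
  have Tw: "T y w = ?y1 w" using V by (simp add: T_def geom_refl_other)
  have z: "[?y1 w = (t + t') * y v + K w y - y w] (mod p)"
    using Kw by (simp add: geom_refl_def[of V p c w])
  have "[T y v - t * T y w = ((t + t') * ?y1 w + K v y - y v) - t * ?y1 w] (mod p)"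
    unfolding Tw by (intro cong_diff) (auto simp: Tv)
  also have "((t + t') * ?y1 w + K v y - y v) - t * ?y1 w = t' * ?y1 w + K v y - y v"
    by (simp add: algebra_simps)
  also have "[\<dots> = t' * ((t + t') * y v + K w y - y w) + K v y - y v] (mod p)"
    by (intro cong_diff cong_add cong_mult z) auto
  also have "t' * ((t + t') * y v + K w y - y w) + K v y - y v =
      (t * t') * (y v) + t' ^ 2 * y v - 1 * (t' * y w) + (K v y + t' * K w y) - y v"
    by (simp add: algebra_simps power2_eq_square)
  also have "[\<dots> = 1 * y v + t' ^ 2 * y v - (t * t') * (t' * y w) + (K v y + t' * K w y) - y v] (mod p)"
    using t by (intro cong_diff cong_add cong_mult) (auto intro: cong_sym)
  also have "1 * y v + t' ^ 2 * y v - (t * t') * (t' * y w) + (K v y + t' * K w y) - y v =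
      t' ^ 2 * (y v - t * y w) + (K v y + t' * K w y)"
    by (simp add: algebra_simps power2_eq_square)
  finally show "[T y v - t * T y w = t' ^ 2 * (y v - t * y w) + (K v y + t' * K w y)] (mod p)" .
  show T: "T y u = y u" if "u \<noteq> v" "u \<noteq> w" for u using that by (simp add: T_def geom_refl_other)
  show "K a (T y) = K a y" unfolding K_def by (intro sum.cong) (auto simp: T)
qed

text \<open>The two reflections change no other coordinate, so the inhomogeneous term is the same at
  every step, and it vanishes together with those coordinates.\<close>

lemma geom_refl_pair_iterate:
  fixes p t t' :: int
  assumes V: "finite V" "v \<in> V" "w \<in> V" "v \<noteq> w" and t: "[t * t' = 1] (mod p)"
    and c: "c v w = t + t'" "c w v = t + t'"
  defines "T \<equiv> geom_refl V p c v \<circ> geom_refl V p c w"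
  shows "\<exists>\<kappa>. (\<forall>k. [(T ^^ Suc k) y v - t * (T ^^ Suc k) y w = t' ^ 2 * ((T ^^ k) y v - t * (T ^^ k) y w) + \<kappa>] (mod p)) \<and>
      ((\<forall>u\<in>V - {v, w}. y u = 0) \<longrightarrow> \<kappa> = 0)"
proof -
  let ?K = "\<lambda>a y. \<Sum>u\<in>V - {v, w}. c a u * y u"
  note step = geom_refl_pair_step[where c = c, OF V t c, folded T_def]
  have K: "?K a ((T ^^ k) y) = ?K a y" for a k
    by (induction k) (simp_all add: step(3))
  have "[(T ^^ Suc k) y v - t * (T ^^ Suc k) y w = t' ^ 2 * ((T ^^ k) y v - t * (T ^^ k) y w) + (?K v y + t' * ?K w y)] (mod p)" for k
    using step(1)[of "(T ^^ k) y"] by (simp add: K)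
  then show ?thesis by (intro exI[of _ "?K v y + t' * ?K w y"]) simp
qed

text \<open>Both eigenfunctionals return after \<open>m\<close> steps, as their eigenvalues are
  \<open>m\<close>-th roots of unity other than 1. They determine the coordinates at
  \<open>v\<close> and \<open>w\<close> because \<open>t\<close> and \<open>t'\<close> differ modulo
  \<open>p\<close>.\<close>

lemma geom_refl_pair_power:
  fixes p t t' :: int
  assumes V: "finite V" "v \<in> V" "w \<in> V" "v \<noteq> w" and t: "[t * t' = 1] (mod p)"
    and c: "c v w = t + t'" "c w v = t + t'" and p: "prime p"
    and m: "\<And>k. [t ^ (2 * k) = 1] (mod p) \<longleftrightarrow> m dvd k" and m2: "m \<ge> 2"
    and y: "y \<in> V \<rightarrow>\<^sub>E {0..<p}"
  defines "T \<equiv> geom_refl V p c v \<circ> geom_refl V p c w"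
  shows "(T ^^ m) y = y"
proof -
  have p0: "0 < p" using p by (simp add: prime_gt_0_int)
  have TP: "(T ^^ k) y \<in> V \<rightarrow>\<^sub>E {0..<p}" for k
  proof (induction k)
    case (Suc k)
    from geom_refl_PiE[OF V(2) p0 geom_refl_PiE[OF V(3) p0 this]] show ?case by (simp add: T_def)
  qed (use y in simp)
  have other: "(T ^^ k) y u = y u" if "u \<noteq> v" "u \<noteq> w" for u k
    by (induction k) (simp_all add: T_def geom_refl_other that)
  have tt: "[t ^ j * t' ^ j = 1] (mod p)" for j
    using cong_pow[OF t, of j] by (simp add: power_mult_distrib)
  have m': "[t' ^ (2 * k) = 1] (mod p) \<longleftrightarrow> m dvd k" for k
  proof -
    have "[t' ^ (2 * k) = 1] (mod p) \<longleftrightarrow> [t ^ (2 * k) = 1] (mod p)"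
    proof
      assume "[t' ^ (2 * k) = 1] (mod p)"
      then have "[t ^ (2 * k) * t' ^ (2 * k) = t ^ (2 * k) * 1] (mod p)" by (intro cong_mult) auto
      then show "[t ^ (2 * k) = 1] (mod p)" using tt[of "2 * k"] by (simp add: cong_def)
    next
      assume "[t ^ (2 * k) = 1] (mod p)"
      then have "[t ^ (2 * k) * t' ^ (2 * k) = 1 * t' ^ (2 * k)] (mod p)" by (intro cong_mult) auto
      then show "[t' ^ (2 * k) = 1] (mod p)" using tt[of "2 * k"] by (simp add: cong_def)
    qed
    then show ?thesis by (simp add: m)
  qed
  have r: "[(t ^ 2) ^ m = 1] (mod p)" "\<not> [t ^ 2 = 1] (mod p)"
    "[(t' ^ 2) ^ m = 1] (mod p)" "\<not> [t' ^ 2 = 1] (mod p)"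
    using m[of m] m[of 1] m'[of m] m'[of 1] m2 by (auto simp: power_mult)
  let ?z = "(T ^^ m) y"
  have t': "[t' * t = 1] (mod p)" using t by (simp add: mult.commute)
  obtain \<kappa> where "\<And>k. [(T ^^ Suc k) y v - t * (T ^^ Suc k) y w = t' ^ 2 * ((T ^^ k) y v - t * (T ^^ k) y w) + \<kappa>] (mod p)"
    using geom_refl_pair_iterate[where c = c and y = y, OF V t c, folded T_def] by blast
  from cong_affine_periodic[where s = "\<lambda>k. (T ^^ k) y v - t * (T ^^ k) y w", OF this p r(3,4)]
  have 1: "[?z v - t * ?z w = y v - t * y w] (mod p)" by simp
  have c': "c v w = t' + t" "c w v = t' + t" using c by simp_all
  obtain \<kappa>' where "\<And>k. [(T ^^ Suc k) y v - t' * (T ^^ Suc k) y w = t ^ 2 * ((T ^^ k) y v - t' * (T ^^ k) y w) + \<kappa>'] (mod p)"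
    using geom_refl_pair_iterate[where c = c and y = y, OF V t' c', folded T_def] by blast
  from cong_affine_periodic[where s = "\<lambda>k. (T ^^ k) y v - t' * (T ^^ k) y w", OF this p r(1,2)]
  have 2: "[?z v - t' * ?z w = y v - t' * y w] (mod p)" by simp
  have "p dvd ((?z v - t' * ?z w) - (y v - t' * y w)) - ((?z v - t * ?z w) - (y v - t * y w))"
    by (rule dvd_diff[OF 2[unfolded cong_iff_dvd_diff] 1[unfolded cong_iff_dvd_diff]])
  also have "((?z v - t' * ?z w) - (y v - t' * y w)) - ((?z v - t * ?z w) - (y v - t * y w)) = (t - t') * (?z w - y w)"
    by (simp add: algebra_simps)
  finally have "p dvd (t - t') * (?z w - y w)" .
  moreover have "\<not> p dvd t - t'"
  proof
    assume "p dvd t - t'"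
    then have "[t = t'] (mod p)" by (simp add: cong_iff_dvd_diff)
    then have "[t * t = t * t'] (mod p)" by (intro cong_mult) auto
    then have "[t ^ 2 = 1] (mod p)" using t by (simp add: power2_eq_square cong_def)
    then show False using r(2) by simp
  qed
  ultimately have w: "[?z w = y w] (mod p)" using p by (simp add: prime_dvd_mult_iff cong_iff_dvd_diff)
  have v: "[?z v = y v] (mod p)"
  proof -
    have "[(?z v - t * ?z w) + t * ?z w = (y v - t * y w) + t * y w] (mod p)"
      by (intro cong_add cong_mult 1 w) auto
    then show ?thesis by simp
  qed
  have eq: "?z u = y u" if "u \<in> V" "[?z u = y u] (mod p)" for u
  proof -
    have "?z u \<in> {0..<p}" "y u \<in> {0..<p}" using TP[of m] y that(1) by (auto dest: PiE_mem simp del: PiE_iff)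
    then show ?thesis using that(2) by (auto simp: cong_def)
  qed
  show ?thesis
  proof
    fix u show "?z u = y u"
      using eq[OF V(2) v] eq[OF V(3) w] other[of u m] by (cases "u = v"; cases "u = w") auto
  qed
qed

text \<open>At the basis vector of \<open>v\<close> the recursion is homogeneous: the functional has
  value 1 there and is multiplied by \<open>t ^ 2\<close> at each step, so a return after
  \<open>k\<close> steps forces \<open>t ^ (2 * k)\<close> to be 1.\<close>

lemma geom_refl_pair_order:
  fixes p t t' :: int
  assumes V: "finite V" "v \<in> V" "w \<in> V" "v \<noteq> w" and t: "[t * t' = 1] (mod p)"
    and c: "c v w = t + t'" "c w v = t + t'"
    and m: "\<And>k. [t ^ (2 * k) = 1] (mod p) \<longleftrightarrow> m dvd k"
    and y: "\<And>u. u \<in> V \<Longrightarrow> y u = (if u = v then 1 else 0)"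
  defines "T \<equiv> geom_refl V p c v \<circ> geom_refl V p c w"
  assumes Tk: "(T ^^ k) y = y"
  shows "m dvd k"
proof -
  have t': "[t' * t = 1] (mod p)" using t by (simp add: mult.commute)
  have c': "c v w = t' + t" "c w v = t' + t" using c by simp_all
  have "\<forall>u\<in>V - {v, w}. y u = 0" using y by auto
  then have "\<And>k. [(T ^^ Suc k) y v - t' * (T ^^ Suc k) y w = t ^ 2 * ((T ^^ k) y v - t' * (T ^^ k) y w) + 0] (mod p)"
    using geom_refl_pair_iterate[where c = c and y = y, OF V t' c', folded T_def] by metis
  from cong_affine_recursion[where s = "\<lambda>k. (T ^^ k) y v - t' * (T ^^ k) y w", OF this, of k]
  have "[1 = (t ^ 2) ^ k] (mod p)" using Tk y V by simp
  then show ?thesis using m[of k] by (simp add: power_mult cong_sym)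
qed

lemma BijGroup_pow_funpow:
  assumes f: "f \<in> Bij S" and y: "y \<in> S" and g: "\<And>y. y \<in> S \<Longrightarrow> f y = g y" "\<And>y. y \<in> S \<Longrightarrow> g y \<in> S"
  shows "(f [^]\<^bsub>BijGroup S\<^esub> k) y = (g ^^ k) y"
proof -
  interpret group "BijGroup S" by (rule group_BijGroup)
  have car: "carrier (BijGroup S) = Bij S" by (simp add: BijGroup_def)
  have mult: "f \<otimes>\<^bsub>BijGroup S\<^esub> g = compose S f g" if "f \<in> Bij S" "g \<in> Bij S" for f g
    using that by (simp add: BijGroup_def)
  have fc: "f \<in> carrier (BijGroup S)" using f by (simp add: car)
  show ?thesis using y
  proof (induction k arbitrary: y)
    case (Suc k)
    have "f [^]\<^bsub>BijGroup S\<^esub> k \<in> Bij S" using nat_pow_closed[OF fc, of k] by (simp add: car)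
    then have "f [^]\<^bsub>BijGroup S\<^esub> Suc k = compose S (f [^]\<^bsub>BijGroup S\<^esub> k) f"
      unfolding nat_pow_Suc using f by (rule mult)
    then have "(f [^]\<^bsub>BijGroup S\<^esub> Suc k) y = (f [^]\<^bsub>BijGroup S\<^esub> k) (g y)"
      using Suc.prems g(1) by (simp add: compose_def)
    then show ?case using Suc g by (simp add: funpow_swap1)
  qed (simp add: BijGroup_def)
qed

text \<open>Uses the geometric representation over a prime field with enough roots of unity.\<close>

lemma finite_reflection_quotient:
  fixes V :: "'a set"
  assumes G: "coxeter_graph V E m"
  shows "\<exists>(Q :: (('a \<Rightarrow> int) \<Rightarrow> ('a \<Rightarrow> int)) monoid) x. group Q \<and> finite (carrier Q) \<and> x \<in> cox_homs V E m Q \<and> inj_on x V \<and>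
    (\<forall>v\<in>V. \<forall>w\<in>V. {v, w} \<in> E \<longrightarrow> (\<forall>k::nat. (x v \<otimes>\<^bsub>Q\<^esub> x w) [^]\<^bsub>Q\<^esub> k = \<one>\<^bsub>Q\<^esub> \<longrightarrow> m {v, w} dvd k))"
proof -
  have finV: "finite V" and m2: "\<And>e. e \<in> E \<Longrightarrow> m e \<ge> 2"
    and edge: "\<And>v w. {v, w} \<in> E \<Longrightarrow> v \<noteq> w"
    using G by (auto simp: coxeter_graph_def doubleton_eq_iff)
  have "E \<subseteq> Pow V" using G by (auto simp: coxeter_graph_def)
  then have finE: "finite E" using finV by (meson finite_Pow_iff finite_subset)
  \<comment> \<open>The factor 2 is the half angle: \<open>t e\<close> must have order
    \<open>2 * m e\<close> for its square, the eigenvalue of the product of two reflections, to have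
    order \<open>m e\<close>.\<close>
  define M where "M = 2 * (\<Prod>e\<in>E. m e)"
  have mM: "2 * m e dvd M" if "e \<in> E" for e
    using that finE unfolding M_def by (intro mult_dvd_mono dvd_prodI) auto
  have "(\<Prod>e\<in>E. m e) \<noteq> 0" using finE m2 by fastforce
  then have M2: "M \<ge> 2" by (simp add: M_def)
  obtain p a :: nat where p: "prime p" and a: "ord p a = M" using exists_prime_ord[OF M2] by blast
  \<comment> \<open>Modulo 2 every unit has order 1. An odd \<open>p\<close> is what later separates
    the eigenvalue -1 of a reflection from 1.\<close>
  have p2: "p \<noteq> 2"
  proof
    assume "p = 2"
    moreover have "coprime p a" using a M2 by (metis not_numeral_le_zero ord_eq_0)
    ultimately have "odd a" by simp
    then have "[a ^ 1 = 1] (mod p)" using \<open>p = 2\<close> by (simp add: cong_def odd_iff_mod_2_eq_one)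
    then have "ord p a dvd 1" by (simp only: ord_divides)
    then show False using a M2 by simp
  qed
  then have p3: "p > 2" using prime_ge_2_nat[OF p] by simp
  define t where "t e = int a ^ (M div (2 * m e))" for e
  \<comment> \<open>The inverse of \<open>t e\<close>, written as a power with a natural exponent
    because \<open>a\<close> has order \<open>M\<close>.\<close>
  define t' where "t' e = int a ^ (M - M div (2 * m e))" for e
  have tt: "[t e * t' e = 1] (mod int p)" for e
  proof -
    have "t e * t' e = int (a ^ M)" unfolding t_def t'_def by (simp flip: power_add)
    moreover have "[a ^ M = 1] (mod p)" using a by (simp add: ord_divides')
    ultimately show ?thesis by (metis cong_int_iff of_nat_1)
  qed
  have t_order: "[t e ^ (2 * k) = 1] (mod int p) \<longleftrightarrow> m e dvd k" if e: "e \<in> E" for e k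
  proof -
    obtain r where r: "M = 2 * m e * r" using mM[OF e] by auto
    have pos: "m e > 0" "r > 0" using m2[OF e] r M2 by (auto intro: gr0I)
    have "t e ^ (2 * k) = int (a ^ (r * (2 * k)))" using r pos by (simp add: t_def power_mult)
    then have "[t e ^ (2 * k) = 1] (mod int p) \<longleftrightarrow> [a ^ (r * (2 * k)) = 1] (mod p)"
      by (metis cong_int_iff of_nat_1)
    also have "\<dots> \<longleftrightarrow> M dvd r * (2 * k)" using a by (simp add: ord_divides')
    also have "\<dots> \<longleftrightarrow> (2 * r) * m e dvd (2 * r) * k" using r by (simp add: mult_ac)
    also have "\<dots> \<longleftrightarrow> m e dvd k" using pos by (subst nat_mult_dvd_cancel_disj) auto
    finally show ?thesis .
  qed
  define c where "c v w = (if {v, w} \<in> E then t {v, w} + t' {v, w} else 0)" for v w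
  define S where "S = V \<rightarrow>\<^sub>E {0..<int p}"
  define R where "R = geom_refl V (int p) c"
  define x where "x = (\<lambda>v\<in>V. restrict (R v) S)"
  let ?Q = "BijGroup S"
  interpret Q: group ?Q by (rule group_BijGroup)
  have p0: "0 < int p" using p3 by simp
  have pp: "prime (int p)" using p by simp
  have RS: "R v y \<in> S" if "v \<in> V" "y \<in> S" for v y
    using geom_refl_PiE[OF that(1) p0] that(2) by (simp add: S_def R_def)
  have RR: "R v (R v y) = y" if "v \<in> V" "y \<in> S" for v y
    using geom_refl_involution[OF that(1) p0] that(2) by (simp add: S_def R_def)
  have finS: "finite S" unfolding S_def using finV by (intro finite_PiE) auto
  have xB: "x v \<in> Bij S" if v: "v \<in> V" for v
  proof -
    have "bij_betw (R v) S S" by (rule bij_betwI[of _ _ _ "R v"]) (auto simp: RS RR v)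
    then show ?thesis using v by (simp add: x_def Bij_def bij_betw_def inj_on_def)
  qed
  have mult: "f \<otimes>\<^bsub>?Q\<^esub> g = compose S f g" if "f \<in> Bij S" "g \<in> Bij S" for f g
    using that by (simp add: BijGroup_def)
  have one: "\<one>\<^bsub>?Q\<^esub> = (\<lambda>y\<in>S. y)" by (simp add: BijGroup_def)
  have car: "carrier ?Q = Bij S" by (simp add: BijGroup_def)
  have "finite (S \<rightarrow>\<^sub>E S)" using finS by (intro finite_PiE) auto
  then have finQ: "finite (carrier ?Q)"
    by (rule rev_finite_subset) (auto simp: car Bij_def bij_betw_def PiE_def Pi_def extensional_def)
  have x2: "x v \<otimes>\<^bsub>?Q\<^esub> x v = \<one>\<^bsub>?Q\<^esub>" if "v \<in> V" for v
    unfolding mult[OF xB[OF that] xB[OF that]] one compose_def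
    using that RS RR by (intro restrict_ext) (simp add: x_def)
  have pow: "((x v \<otimes>\<^bsub>?Q\<^esub> x w) [^]\<^bsub>?Q\<^esub> k) y = ((R v \<circ> R w) ^^ k) y" if "v \<in> V" "w \<in> V" "y \<in> S" for v w k y
  proof (rule BijGroup_pow_funpow)
    show "x v \<otimes>\<^bsub>?Q\<^esub> x w \<in> Bij S" using that xB Q.m_closed[of "x v" "x w"] by (simp add: car)
    show "(x v \<otimes>\<^bsub>?Q\<^esub> x w) y = (R v \<circ> R w) y" if "y \<in> S" for y
      unfolding mult[OF xB[OF \<open>v \<in> V\<close>] xB[OF \<open>w \<in> V\<close>]]
      using that RS \<open>v \<in> V\<close> \<open>w \<in> V\<close> by (simp add: compose_def x_def)
  qed (use that RS in auto)
  have pow_closed: "(x v \<otimes>\<^bsub>?Q\<^esub> x w) [^]\<^bsub>?Q\<^esub> k \<in> Bij S" if "v \<in> V" "w \<in> V" for v w and k :: nat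
    using Q.nat_pow_closed[of "x v \<otimes>\<^bsub>?Q\<^esub> x w" k] Q.m_closed[of "x v" "x w"] xB that by (simp add: car)
  have csym: "c v w = t {v, w} + t' {v, w}" "c w v = t {v, w} + t' {v, w}" if "{v, w} \<in> E" for v w
    using that by (simp_all add: c_def insert_commute)
  have rel: "(x v \<otimes>\<^bsub>?Q\<^esub> x w) [^]\<^bsub>?Q\<^esub> m {v, w} = \<one>\<^bsub>?Q\<^esub>" if vw: "v \<in> V" "w \<in> V" "{v, w} \<in> E" for v w
  proof
    fix y show "((x v \<otimes>\<^bsub>?Q\<^esub> x w) [^]\<^bsub>?Q\<^esub> m {v, w}) y = \<one>\<^bsub>?Q\<^esub> y"
    proof (cases "y \<in> S")
      case True
      have "((R v \<circ> R w) ^^ m {v, w}) y = y"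
        unfolding R_def using True[unfolded S_def]
        by (rule geom_refl_pair_power[where c = c, OF finV vw(1,2) edge[OF vw(3)] tt csym[OF vw(3)] pp t_order[OF vw(3)] m2[OF vw(3)]])
      then show ?thesis using True by (simp add: pow[OF vw(1,2) True] one)
    next
      case False
      then show ?thesis using pow_closed[OF vw(1,2)] by (auto simp: one Bij_def extensional_def)
    qed
  qed
  define b where "b v = (\<lambda>u\<in>V. if u = v then 1 else 0 :: int)" for v
  have bS: "b v \<in> S" for v using p3 by (auto simp: b_def S_def)
  have order: "m {v, w} dvd k" if vw: "v \<in> V" "w \<in> V" "{v, w} \<in> E" and "(x v \<otimes>\<^bsub>?Q\<^esub> x w) [^]\<^bsub>?Q\<^esub> k = \<one>\<^bsub>?Q\<^esub>" for v w k
  proof -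
    have "((R v \<circ> R w) ^^ k) (b v) = b v" using that pow[OF vw(1,2) bS, of k v] bS[of v] by (simp add: one)
    then show ?thesis
      using geom_refl_pair_order[where c = c, OF finV vw(1,2) edge[OF vw(3)] tt csym[OF vw(3)] t_order[OF vw(3)], of "b v" k]
      by (simp add: R_def b_def)
  qed
  have inj: "inj_on x V"
  proof (rule inj_onI, rule ccontr)
    \<comment> \<open>The reflection at \<open>v\<close> negates the \<open>v\<close>-coordinate of
      the basis vector at \<open>v\<close>, the reflection at \<open>w\<close> fixes it.\<close>
    fix v w assume vw: "v \<in> V" "w \<in> V" "x v = x w" "v \<noteq> w"
    have "x v (b v) v = x w (b v) v" using vw by simp
    then have "R v (b v) v = R w (b v) v" using vw bS by (simp add: x_def)
    moreover have "R w (b v) v = 1" using vw by (simp add: R_def geom_refl_other b_def)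
    moreover have "R v (b v) v = (- 1) mod int p"
    proof -
      have "(\<Sum>u\<in>V - {v}. c v u * b v u) = 0" by (intro sum.neutral) (auto simp: b_def)
      then show ?thesis using vw by (simp add: R_def geom_refl_def b_def)
    qed
    ultimately have "(- 1) mod int p = 1 mod int p" using p3 by simp
    then have "int p dvd - 1 - 1" by (simp only: mod_eq_dvd_iff)
    then have "int p dvd 2" by simp
    then show False using p3 by (auto dest: zdvd_imp_le)
  qed
  have "x \<in> cox_homs V E m ?Q" using x2 rel xB by (auto simp: cox_homs_def car x_def)
  then show ?thesis using Q.is_group finQ inj order by blast
qed

section \<open>Relabelling, the odd twist and the contraction of classes\<close>

lemma cox_homsI:
  assumes "\<And>v. v \<in> V \<Longrightarrow> x v \<in> carrier Q" "\<And>v. v \<notin> V \<Longrightarrow> x v = undefined"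
    "\<And>v. v \<in> V \<Longrightarrow> x v \<otimes>\<^bsub>Q\<^esub> x v = \<one>\<^bsub>Q\<^esub>"
    "\<And>v w. v \<in> V \<Longrightarrow> w \<in> V \<Longrightarrow> {v, w} \<in> E \<Longrightarrow> (x v \<otimes>\<^bsub>Q\<^esub> x w) [^]\<^bsub>Q\<^esub> m {v, w} = \<one>\<^bsub>Q\<^esub>"
  shows "x \<in> cox_homs V E m Q"
  using assms by (auto simp: cox_homs_def)

lemma cox_homsD:
  assumes "x \<in> cox_homs V E m Q"
  shows "\<And>v. v \<in> V \<Longrightarrow> x v \<in> carrier Q" "\<And>v. v \<notin> V \<Longrightarrow> x v = undefined"
    "\<And>v. v \<in> V \<Longrightarrow> x v \<otimes>\<^bsub>Q\<^esub> x v = \<one>\<^bsub>Q\<^esub>"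
    "\<And>v w. v \<in> V \<Longrightarrow> w \<in> V \<Longrightarrow> {v, w} \<in> E \<Longrightarrow> (x v \<otimes>\<^bsub>Q\<^esub> x w) [^]\<^bsub>Q\<^esub> m {v, w} = \<one>\<^bsub>Q\<^esub>"
  using assms by (auto simp: cox_homs_def)

lemma coxeter_group_iso_of_bij:
  assumes b: "bij_betw b V U"
    and E: "\<And>v w. v \<in> V \<Longrightarrow> w \<in> V \<Longrightarrow> {v, w} \<in> E \<longleftrightarrow> {b v, b w} \<in> F"
    and m: "\<And>v w. v \<in> V \<Longrightarrow> w \<in> V \<Longrightarrow> {v, w} \<in> E \<Longrightarrow> m {v, w} = n {b v, b w}"
  shows "coxeter_group V E m \<cong> coxeter_group U F n"
proof -
  let ?W = "coxeter_group V E m" and ?W' = "coxeter_group U F n"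
  let ?c = "inv_into V b"
  have bU: "b v \<in> U" if "v \<in> V" for v using b that by (auto simp: bij_betw_def)
  have cV: "?c u \<in> V" if "u \<in> U" for u using b that by (metis bij_betw_def inv_into_into)
  have bc: "b (?c u) = u" if "u \<in> U" for u using b that by (simp add: bij_betw_inv_into_right)
  have cb: "?c (b v) = v" if "v \<in> V" for v using b that by (simp add: bij_betw_inv_into_left)
  note g = cox_homsD[OF cox_gen_in_cox_homs]
  have x: "(\<lambda>v\<in>V. cox_gen U F n (b v)) \<in> cox_homs V E m ?W'"
    using g[where E = F and m = n and V = U] by (intro cox_homsI) (simp_all add: bU E m)
  have y: "(\<lambda>u\<in>U. cox_gen V E m (?c u)) \<in> cox_homs U F n ?W"
  proof (intro cox_homsI)
    fix u u' assume u: "u \<in> U" "u' \<in> U" "{u, u'} \<in> F"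
    then have "{?c u, ?c u'} \<in> E" using E[of "?c u" "?c u'"] by (simp add: cV bc)
    with g(4)[OF cV[OF u(1)] cV[OF u(2)] this, of m] m[OF cV[OF u(1)] cV[OF u(2)] this] u
    show "((\<lambda>u\<in>U. cox_gen V E m (?c u)) u \<otimes>\<^bsub>?W\<^esub> (\<lambda>u\<in>U. cox_gen V E m (?c u)) u') [^]\<^bsub>?W\<^esub> n {u, u'} = \<one>\<^bsub>?W\<^esub>"
      by (simp add: bc)
  qed (use g[where E = E and m = m and V = V] cV in simp_all)
  show ?thesis
    by (rule coxeter_group_isoI[OF x y]) (simp_all add: cox.cox_lift_gen[OF x] cox.cox_lift_gen[OF y] bU cV bc cb)
qed

text \<open>With r = ab, conjugation by the j-th power of r multiplies b by the 2j-th power. Since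
  2j = n + 1 and r has order dividing n, the result is rb = a: in an odd dihedral group all
  reflections are conjugate.\<close>

lemma (in group) conj_odd_dihedral:
  assumes a: "a \<in> carrier G" "a \<otimes> a = \<one>" and b: "b \<in> carrier G" "b \<otimes> b = \<one>"
    and n: "(a \<otimes> b) [^] n = \<one>" and j: "2 * j = Suc n"
  defines "g \<equiv> (a \<otimes> b) [^] j"
  shows "g \<otimes> b \<otimes> inv g = a"
proof -
  let ?r = "a \<otimes> b"
  have r: "?r \<in> carrier G" using a b by simp
  have gc: "g \<in> carrier G" using r by (simp add: g_def)
  have 1: "?r [^] j \<otimes> b \<otimes> ?r [^] j = b" for j :: nat
  proof (induction j)
    case (Suc j)
    let ?s = "?r [^] j"
    have s: "?s \<in> carrier G" using r by simp
    have "?r [^] Suc j \<otimes> b \<otimes> ?r [^] Suc j = (?r \<otimes> ?s) \<otimes> b \<otimes> (?s \<otimes> ?r)"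
      using nat_pow_Suc2[OF r, of j] by simp
    also have "\<dots> = ?r \<otimes> (?s \<otimes> b \<otimes> ?s) \<otimes> ?r"
      using r s b(1) by (simp only: m_assoc m_closed)
    also have "\<dots> = a \<otimes> (b \<otimes> b) \<otimes> (a \<otimes> b)" using a(1) b(1) Suc by (simp add: m_assoc)
    also have "\<dots> = (a \<otimes> a) \<otimes> b" using a(1) b by (simp add: m_assoc)
    finally show ?case using a b by simp
  qed (use b in simp)
  have "g \<otimes> b \<otimes> g = b" using 1[of j] by (simp add: g_def)
  then have gb: "g \<otimes> b = b \<otimes> inv g"
    using gc b(1) by (metis inv_solve_right' m_closed)
  have "g \<otimes> b \<otimes> inv g = g \<otimes> (b \<otimes> inv g)" using gc b(1) by (simp add: m_assoc)
  also have "\<dots> = g \<otimes> (g \<otimes> b)" by (simp only: gb)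
  also have "\<dots> = (g \<otimes> g) \<otimes> b" using gc b(1) by (simp add: m_assoc)
  also have "g \<otimes> g = ?r [^] Suc n"
    unfolding g_def nat_pow_mult[OF r] by (simp only: mult_2[symmetric] j)
  also have "\<dots> = ?r" using n r by simp
  also have "?r \<otimes> b = a" using a b by (simp add: m_assoc)
  finally show "g \<otimes> b \<otimes> inv g = a" .
qed

lemma (in group) conj_pow:
  assumes "g \<in> carrier G" "c \<in> carrier G"
  shows "(g \<otimes> c \<otimes> inv g) [^] (k::nat) = g \<otimes> c [^] k \<otimes> inv g"
proof (induction k)
  case (Suc k)
  have "(g \<otimes> c [^] k \<otimes> inv g) \<otimes> (g \<otimes> c \<otimes> inv g) = g \<otimes> (c [^] k \<otimes> (inv g \<otimes> g) \<otimes> c) \<otimes> inv g"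
    using assms by (simp only: m_assoc m_closed inv_closed nat_pow_closed)
  then show ?case using Suc assms by simp
qed (use assms in simp)

lemma (in group) conj_mult:
  assumes "g \<in> carrier G" "c \<in> carrier G" "d \<in> carrier G"
  shows "(g \<otimes> c \<otimes> inv g) \<otimes> (g \<otimes> d \<otimes> inv g) = g \<otimes> (c \<otimes> d) \<otimes> inv g"
proof -
  have "(g \<otimes> c \<otimes> inv g) \<otimes> (g \<otimes> d \<otimes> inv g) = g \<otimes> (c \<otimes> (inv g \<otimes> g) \<otimes> d) \<otimes> inv g"
    using assms by (simp only: m_assoc m_closed inv_closed)
  then show ?thesis using assms by simp
qed

lemma (in group) inv_mult_pow:
  assumes "u \<in> carrier G" "v \<in> carrier G" "u \<otimes> u = \<one>" "v \<otimes> v = \<one>"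
  shows "inv ((u \<otimes> v) [^] (j::nat)) = (v \<otimes> u) [^] j"
proof -
  have "inv (u \<otimes> v) = v \<otimes> u" using assms by (simp add: inv_mult_group inv_char)
  then show ?thesis using assms nat_pow_inv[of "u \<otimes> v" j] by simp
qed

lemma (in group) conj_cancel:
  assumes "u \<in> carrier G" "v \<in> carrier G"
  shows "inv u \<otimes> (u \<otimes> v \<otimes> inv u) \<otimes> u = v"
proof -
  have "inv u \<otimes> (u \<otimes> v \<otimes> inv u) \<otimes> u = (inv u \<otimes> u) \<otimes> v \<otimes> (inv u \<otimes> u)"
    using assms by (simp only: m_assoc m_closed inv_closed)
  then show ?thesis using assms by simp
qed

text \<open>The diagram twist: for an odd label the end of a path can be conjugated to the other end of
  the edge it is attached to.\<close>

lemma (in group) twist_cox_homs: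
  assumes x: "x \<in> cox_homs V E (\<lambda>_. n) G" and V: "b \<in> V" "c \<in> V" "d \<in> V" "b \<noteq> d" "c \<noteq> d"
    and E: "{b, c} \<in> E" "{c, d} \<in> E" "\<And>u. {u, d} \<in> F \<Longrightarrow> u = b"
      "\<And>u v. u \<noteq> d \<Longrightarrow> v \<noteq> d \<Longrightarrow> {u, v} \<in> F \<Longrightarrow> {u, v} \<in> E"
    and j: "2 * j = Suc n"
  defines "g \<equiv> (x b \<otimes> x c) [^] j"
  shows "x (d := g \<otimes> x d \<otimes> inv g) \<in> cox_homs V F (\<lambda>_. n) G"
proof -
  note h = cox_homsD[OF x]
  let ?y = "x (d := g \<otimes> x d \<otimes> inv g)"
  have xc: "x b \<in> carrier G" "x c \<in> carrier G" "x d \<in> carrier G" using h(1) V by auto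
  have gc: "g \<in> carrier G" using xc by (simp add: g_def)
  have "(x b \<otimes> x c) [^] n = \<one>" using h(4)[of b c] E V by simp
  then have gb: "g \<otimes> x c \<otimes> inv g = x b"
    using conj_odd_dihedral[of "x b" "x c" n j] h(3)[of b] h(3)[of c] V xc j by (simp add: g_def)
  have bd: "(?y b \<otimes> ?y d) [^] n = \<one>"
  proof -
    have "?y b \<otimes> ?y d = g \<otimes> (x c \<otimes> x d) \<otimes> inv g"
      using V gb conj_mult[OF gc xc(2,3)] by auto
    moreover have "(x c \<otimes> x d) [^] n = \<one>" using h(4)[of c d] E V by simp
    ultimately show ?thesis using conj_pow[OF gc, of "x c \<otimes> x d" n] xc gc by simp
  qed
  have y2: "?y v \<otimes> ?y v = \<one>" if "v \<in> V" for v
    using h(3)[OF that] conj_mult[OF gc xc(3,3)] h(3)[of d] V gc by auto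
  have yc: "?y v \<in> carrier G" if "v \<in> V" for v using h(1)[OF that] gc xc by auto
  have db: "(?y d \<otimes> ?y b) [^] n = \<one>"
    using inv_mult_pow[OF yc[OF V(1)] yc[OF V(3)] y2[OF V(1)] y2[OF V(3)], of n] bd by simp
  show ?thesis
  proof (rule cox_homsI)
    fix u v assume uv: "u \<in> V" "v \<in> V" "{u, v} \<in> F"
    consider "u = d" "v = d" | "u \<noteq> d" "v = d" | "u = d" "v \<noteq> d" | "u \<noteq> d" "v \<noteq> d" by blast
    then show "(?y u \<otimes> ?y v) [^] n = \<one>"
    proof cases
      case 1 then show ?thesis using y2[OF V(3)] by simp
    next
      case 2 then show ?thesis using E(3)[of u] uv bd by simp
    next
      case 3
      then have "v = b" using E(3)[of v] uv by (simp add: insert_commute)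
      with 3 db show ?thesis by simp
    next
      case 4 then show ?thesis using E(4)[of u v] h(4)[of u v] uv by simp
    qed
  qed (use h(2) y2 yc V in auto)
qed

lemma twist_iso:
  assumes V: "b \<in> V" "c \<in> V" "d \<in> V" "b \<noteq> d" "c \<noteq> d" and n: "odd n"
    and E: "{b, c} \<in> E" "{c, d} \<in> E" "\<And>u. {u, d} \<in> E \<Longrightarrow> u = c"
    and F: "{b, c} \<in> F" "{b, d} \<in> F" "\<And>u. {u, d} \<in> F \<Longrightarrow> u = b"
    and EF: "\<And>u v. u \<noteq> d \<Longrightarrow> v \<noteq> d \<Longrightarrow> {u, v} \<in> E \<longleftrightarrow> {u, v} \<in> F"
  shows "coxeter_group V E (\<lambda>_. n) \<cong> coxeter_group V F (\<lambda>_. n)"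
proof -
  obtain j where j: "2 * j = Suc n" using n by (metis even_Suc dvd_def)
  let ?W = "coxeter_group V E (\<lambda>_. n)" and ?W' = "coxeter_group V F (\<lambda>_. n)"
  let ?s = "cox_gen V E (\<lambda>_. n)" and ?s' = "cox_gen V F (\<lambda>_. n)"
  define g where "g = (?s b \<otimes>\<^bsub>?W\<^esub> ?s c) [^]\<^bsub>?W\<^esub> j"
  \<comment> \<open>The factors are in the opposite order to those of \<open>g\<close>, so each
    lifted homomorphism sends the conjugator of one side to the inverse of the other and the two
    twists cancel.\<close>
  define h where "h = (?s' c \<otimes>\<^bsub>?W'\<^esub> ?s' b) [^]\<^bsub>?W'\<^esub> j"
  define y where "y = ?s (d := g \<otimes>\<^bsub>?W\<^esub> ?s d \<otimes>\<^bsub>?W\<^esub> inv\<^bsub>?W\<^esub> g)"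
  define x where "x = ?s' (d := h \<otimes>\<^bsub>?W'\<^esub> ?s' d \<otimes>\<^bsub>?W'\<^esub> inv\<^bsub>?W'\<^esub> h)"
  have y: "y \<in> cox_homs V F (\<lambda>_. n) ?W"
    unfolding y_def g_def by (rule cox.twist_cox_homs[OF cox_gen_in_cox_homs V E(1,2) F(3) _ j]) (use EF in auto)
  have F': "{c, b} \<in> F" "\<And>u v. u \<noteq> d \<Longrightarrow> v \<noteq> d \<Longrightarrow> {u, v} \<in> E \<Longrightarrow> {u, v} \<in> F"
    using F(1) EF by (auto simp: insert_commute)
  have x: "x \<in> cox_homs V E (\<lambda>_. n) ?W'"
    unfolding x_def h_def
    by (rule cox.twist_cox_homs[OF cox_gen_in_cox_homs V(2,1,3,5,4) F'(1) F(2) E(3) F'(2) j])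
  note hs = cox_homsD[OF cox_gen_in_cox_homs[of V E "\<lambda>_. n"]] and hs' = cox_homsD[OF cox_gen_in_cox_homs[of V F "\<lambda>_. n"]]
  have gc: "g \<in> carrier ?W" using hs(1) V by (simp add: g_def)
  have hc: "h \<in> carrier ?W'" using hs'(1) V by (simp add: h_def)
  define p where "p = cox_lift ?W' x"
  define q where "q = cox_lift ?W y"
  interpret X: group_hom ?W ?W' p
    unfolding group_hom_def group_hom_axioms_def p_def using cox.cox_lift_hom[OF x] cox.is_group by blast
  interpret Y: group_hom ?W' ?W q
    unfolding group_hom_def group_hom_axioms_def q_def using cox.cox_lift_hom[OF y] cox.is_group by blast
  have Xgen: "p (?s v) = x v" if "v \<in> V" for v using cox.cox_lift_gen[OF x that] by (simp add: p_def)
  have Ygen: "q (?s' v) = y v" if "v \<in> V" for v using cox.cox_lift_gen[OF y that] by (simp add: q_def)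
  have Yh: "q h = inv\<^bsub>?W\<^esub> g"
  proof -
    have "q h = (?s c \<otimes>\<^bsub>?W\<^esub> ?s b) [^]\<^bsub>?W\<^esub> j"
      unfolding h_def using hs'(1) V by (simp add: Y.hom_nat_pow Ygen) (simp add: y_def)
    also have "\<dots> = inv\<^bsub>?W\<^esub> g" unfolding g_def
      using cox.inv_mult_pow hs(1,3) V by metis
    finally show ?thesis .
  qed
  have Xg: "p g = inv\<^bsub>?W'\<^esub> h"
  proof -
    have "p g = (?s' b \<otimes>\<^bsub>?W'\<^esub> ?s' c) [^]\<^bsub>?W'\<^esub> j"
      unfolding g_def using hs(1) V by (simp add: X.hom_nat_pow Xgen) (simp add: x_def)
    also have "\<dots> = inv\<^bsub>?W'\<^esub> h" unfolding h_def
      using cox.inv_mult_pow hs'(1,3) V by metis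
    finally show ?thesis .
  qed
  have "q (x v) = ?s v" if v: "v \<in> V" for v
  proof (cases "v = d")
    case True
    have "q (x d) = inv\<^bsub>?W\<^esub> g \<otimes>\<^bsub>?W\<^esub> (g \<otimes>\<^bsub>?W\<^esub> ?s d \<otimes>\<^bsub>?W\<^esub> inv\<^bsub>?W\<^esub> g) \<otimes>\<^bsub>?W\<^esub> g"
      using hc hs'(1)[OF V(3)] gc V(3) by (simp add: x_def Yh Ygen) (simp add: y_def)
    with True show ?thesis using cox.conj_cancel[OF gc hs(1)[OF V(3)]] by simp
  next
    case False
    then have "q (x v) = y v" using Ygen[OF v] by (simp add: x_def)
    then show ?thesis using False by (simp add: y_def)
  qed
  moreover have "p (y v) = ?s' v" if v: "v \<in> V" for v
  proof (cases "v = d")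
    case True
    have "p (y d) = inv\<^bsub>?W'\<^esub> h \<otimes>\<^bsub>?W'\<^esub> (h \<otimes>\<^bsub>?W'\<^esub> ?s' d \<otimes>\<^bsub>?W'\<^esub> inv\<^bsub>?W'\<^esub> h) \<otimes>\<^bsub>?W'\<^esub> h"
      using gc hs(1)[OF V(3)] hc V(3) by (simp add: y_def Xg Xgen) (simp add: x_def)
    with True show ?thesis using cox.conj_cancel[OF hc hs'(1)[OF V(3)]] by simp
  next
    case False
    then have "p (y v) = x v" using Xgen[OF v] by (simp add: y_def)
    then show ?thesis using False by (simp add: x_def)
  qed
  ultimately show ?thesis by (intro coxeter_group_isoI[OF x y]) (simp_all add: p_def q_def)
qed

text \<open>Composition with the projection embeds the homomorphisms from the contracted group into those
  of the original one. By equal cardinality every homomorphism arises in this way, in particular the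
  one to a finite reflection quotient, which is injective on generators and detects all labels.\<close>

lemma contraction_rigidity:
  fixes V' :: "'b set" and pr :: "'b \<Rightarrow> 'c"
  assumes G': "coxeter_graph V' E' m'"
  defines "F \<equiv> {{pr v, pr w} |v w. v \<in> V' \<and> w \<in> V' \<and> {v, w} \<in> E' \<and> pr v \<noteq> pr w}"
  assumes lab: "\<And>v w. v \<in> V' \<Longrightarrow> w \<in> V' \<Longrightarrow> {v, w} \<in> E' \<Longrightarrow> pr v \<noteq> pr w \<Longrightarrow> n dvd m' {v, w}"
    and card_eq: "\<And>Q :: (('b \<Rightarrow> int) \<Rightarrow> ('b \<Rightarrow> int)) monoid. group Q \<Longrightarrow> finite (carrier Q) \<Longrightarrow>
      card (cox_homs (pr ` V') F (\<lambda>_. n) Q) = card (cox_homs V' E' m' Q)"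
  shows "coxeter_group V' E' m' \<cong> coxeter_group (pr ` V') F (\<lambda>_. n)"
proof -
  let ?U = "pr ` V'"
  have finV: "finite V'" using G' by (simp add: coxeter_graph_def)
  have edge: "v \<noteq> w" if "{v, w} \<in> E'" for v w using G' that by (auto simp: coxeter_graph_def doubleton_eq_iff)
  \<comment> \<open>The equality of counts is assumed for groups over exactly this type, the one in
    which the reflection quotient is built.\<close>
  obtain Q :: "(('b \<Rightarrow> int) \<Rightarrow> ('b \<Rightarrow> int)) monoid" and x where Q: "group Q" "finite (carrier Q)"
    and x: "x \<in> cox_homs V' E' m' Q" "inj_on x V'"
    and ord: "\<And>v w k. v \<in> V' \<Longrightarrow> w \<in> V' \<Longrightarrow> {v, w} \<in> E' \<Longrightarrow> (x v \<otimes>\<^bsub>Q\<^esub> x w) [^]\<^bsub>Q\<^esub> (k::nat) = \<one>\<^bsub>Q\<^esub> \<Longrightarrow> m' {v, w} dvd k"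
    using finite_reflection_quotient[OF G'] by metis
  interpret Q: group Q by fact
  let ?f = "\<lambda>y. \<lambda>v\<in>V'. y (pr v)"
  have maps: "?f y \<in> cox_homs V' E' m' Q" if y: "y \<in> cox_homs ?U F (\<lambda>_. n) Q" for y
  proof (rule cox_homsI)
    fix v w assume vw: "v \<in> V'" "w \<in> V'" "{v, w} \<in> E'"
    show "(?f y v \<otimes>\<^bsub>Q\<^esub> ?f y w) [^]\<^bsub>Q\<^esub> m' {v, w} = \<one>\<^bsub>Q\<^esub>"
    proof (cases "pr v = pr w")
      case True
      then show ?thesis using cox_homsD(3)[OF y, of "pr w"] vw by simp
    next
      case False
      then have "{pr v, pr w} \<in> F" using vw by (auto simp: F_def)
      then have "(y (pr v) \<otimes>\<^bsub>Q\<^esub> y (pr w)) [^]\<^bsub>Q\<^esub> n = \<one>\<^bsub>Q\<^esub>" using cox_homsD(4)[OF y] vw by simp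
      moreover obtain l where "m' {v, w} = n * l" using lab[OF vw False] by auto
      moreover have "y (pr v) \<otimes>\<^bsub>Q\<^esub> y (pr w) \<in> carrier Q" using cox_homsD(1)[OF y] vw by simp
      ultimately show ?thesis using vw Q.nat_pow_pow[of "y (pr v) \<otimes>\<^bsub>Q\<^esub> y (pr w)" n l] by simp
    qed
  qed (use cox_homsD[OF y] in simp_all)
  have inj: "inj_on ?f (cox_homs ?U F (\<lambda>_. n) Q)"
  proof (rule inj_onI)
    fix y z assume yz: "y \<in> cox_homs ?U F (\<lambda>_. n) Q" "z \<in> cox_homs ?U F (\<lambda>_. n) Q" "?f y = ?f z"
    show "y = z"
    proof
      fix u show "y u = z u"
      proof (cases "u \<in> ?U")
        case True
        then obtain v where "v \<in> V'" "u = pr v" by auto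
        then show ?thesis using fun_cong[OF yz(3), of v] by simp
      qed (use cox_homsD(2)[OF yz(1)] cox_homsD(2)[OF yz(2)] in simp)
    qed
  qed
  have "?f ` cox_homs ?U F (\<lambda>_. n) Q = cox_homs V' E' m' Q"
  proof (rule card_subset_eq)
    show "finite (cox_homs V' E' m' Q)" using finV Q by (intro cox_homs_mono_finite)
    show "card (?f ` cox_homs ?U F (\<lambda>_. n) Q) = card (cox_homs V' E' m' Q)"
      using card_image[OF inj] card_eq[OF Q] by simp
  qed (use maps in auto)
  then obtain y where y: "y \<in> cox_homs ?U F (\<lambda>_. n) Q" "x = ?f y" using x(1) by auto
  have inj_pr: "inj_on pr V'"
  proof (rule inj_onI)
    fix v w assume vw: "v \<in> V'" "w \<in> V'" "pr v = pr w"
    then have "x v = x w" by (simp add: y(2))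
    then show "v = w" using x(2) vw by (auto dest: inj_onD)
  qed
  show ?thesis
  proof (rule coxeter_group_iso_of_bij)
    show "bij_betw pr V' ?U" using inj_pr by (simp add: bij_betw_def)
    fix v w assume vw: "v \<in> V'" "w \<in> V'"
    have "{v, w} \<in> E'" if F: "{pr v, pr w} \<in> F"
    proof -
      obtain v' w' where "v' \<in> V'" "w' \<in> V'" "{v', w'} \<in> E'" "{pr v, pr w} = {pr v', pr w'}"
        using F by (auto simp: F_def)
      then show ?thesis using inj_pr vw by (auto simp: doubleton_eq_iff inj_on_eq_iff insert_commute)
    qed
    moreover have F: "{pr v, pr w} \<in> F" if E: "{v, w} \<in> E'"
    proof -
      have "pr v \<noteq> pr w" using edge[OF E] inj_pr vw by (simp add: inj_on_eq_iff)
      then show ?thesis unfolding F_def using vw E by blast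
    qed
    ultimately show "{v, w} \<in> E' \<longleftrightarrow> {pr v, pr w} \<in> F" by blast
    assume E: "{v, w} \<in> E'"
    have "(x v \<otimes>\<^bsub>Q\<^esub> x w) [^]\<^bsub>Q\<^esub> n = \<one>\<^bsub>Q\<^esub>" using cox_homsD(4)[OF y(1) _ _ F[OF E]] vw by (simp add: y(2))
    then have "m' {v, w} dvd n" using ord[OF vw E] by simp
    moreover have "n dvd m' {v, w}" using lab[OF vw E] edge[OF E] inj_pr vw by (simp add: inj_on_eq_iff)
    ultimately show "m' {v, w} = n" by (rule dvd_antisym)
  qed
qed

section \<open>Dihedral groups and wreath products\<close>

text \<open>The pair $(e, t)$ stands for the map $i \mapsto e i + t$ on the integers modulo $N$.\<close>

definition dih :: "int \<Rightarrow> (int \<times> int) monoid" where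
  "dih N = \<lparr>carrier = {1, -1} \<times> {0..<N},
     monoid.mult = (\<lambda>(e, t) (e', t'). (e * e', (t + e * t') mod N)), one = (1, 0)\<rparr>"

lemma dih_simps:
  "carrier (dih N) = {1, -1} \<times> {0..<N}"
  "(e, t) \<otimes>\<^bsub>dih N\<^esub> (e', t') = (e * e', (t + e * t') mod N)"
  "\<one>\<^bsub>dih N\<^esub> = (1, 0)"
  by (simp_all add: dih_def)

lemma group_dih: assumes "N > 0" shows "group (dih N)"
proof (rule groupI)
  fix x y z assume "x \<in> carrier (dih N)" "y \<in> carrier (dih N)" "z \<in> carrier (dih N)"
  obtain e t e' t' e'' t'' where [simp]: "x = (e, t)" "y = (e', t')" "z = (e'', t'')" by (cases x; cases y; cases z)
  have "((t + e * t') mod N + e * e' * t'') mod N = (t + e * t' + e * e' * t'') mod N" by (simp add: mod_simps)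
  moreover have "(t + e * ((t' + e' * t'') mod N)) mod N = (t + e * (t' + e' * t'')) mod N"
    by (metis mod_add_right_eq mod_mult_right_eq)
  ultimately show "x \<otimes>\<^bsub>dih N\<^esub> y \<otimes>\<^bsub>dih N\<^esub> z = x \<otimes>\<^bsub>dih N\<^esub> (y \<otimes>\<^bsub>dih N\<^esub> z)"
    by (simp add: dih_simps algebra_simps)
next
  fix x assume x: "x \<in> carrier (dih N)"
  obtain e t where [simp]: "x = (e, t)" by (cases x)
  have "(- e * t mod N + e * t) mod N = 0" by (simp add: mod_simps)
  then show "\<exists>y\<in>carrier (dih N). y \<otimes>\<^bsub>dih N\<^esub> x = \<one>\<^bsub>dih N\<^esub>"
    using x assms by (intro bexI[of _ "(e, (- e * t) mod N)"]) (auto simp: dih_simps)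
qed (use assms in \<open>auto simp: dih_simps\<close>)

lemma finite_dih: "finite (carrier (dih N))"
  by (simp add: dih_simps)

lemma dih_rot_pow:
  assumes "N > 0" shows "(1, t mod N) [^]\<^bsub>dih N\<^esub> (k::nat) = (1, (int k * t) mod N)"
proof (induction k)
  case (Suc k)
  have "((int k * t) mod N + t mod N) mod N = (int (Suc k) * t) mod N"
    by (simp add: mod_simps algebra_simps)
  then show ?case using Suc by (simp add: dih_simps)
qed (use assms in \<open>simp add: dih_simps\<close>)

lemma dih_refl_mult: "(-1, t) \<otimes>\<^bsub>dih N\<^esub> (-1, s) = (1, (t - s) mod N)"
  by (simp add: dih_simps)

lemma dih_refl_pow_iff:
  assumes "N > 0"
  shows "((-1, t) \<otimes>\<^bsub>dih N\<^esub> (-1, s)) [^]\<^bsub>dih N\<^esub> (k::nat) = \<one>\<^bsub>dih N\<^esub> \<longleftrightarrow> N dvd int k * (t - s)"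
  using assms by (simp add: dih_refl_mult dih_rot_pow) (simp add: dih_simps dvd_eq_mod_eq_0)

lemma dih_refl_pow_even:
  assumes "N > 0" "t \<in> {0..<N}" "even k"
  shows "(-1, t) [^]\<^bsub>dih N\<^esub> (k::nat) = \<one>\<^bsub>dih N\<^esub>"
proof -
  interpret group "dih N" using group_dih[OF assms(1)] .
  have c: "(-1, t) \<in> carrier (dih N)" using assms by (simp add: dih_simps)
  obtain l where "k = 2 * l" using assms(3) by auto
  moreover have "(-1, t) [^]\<^bsub>dih N\<^esub> (2::nat) = \<one>\<^bsub>dih N\<^esub>"
    using c by (simp add: numeral_2_eq_2 dih_simps)
  ultimately show ?thesis using nat_pow_pow[OF c, of 2 l] by simp
qed

lemma dih_fst_mult: "fst (x \<otimes>\<^bsub>dih N\<^esub> y) = fst x * fst y"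
  by (cases x; cases y) (simp add: dih_simps)

lemma residue_dvd_diff_iff:
  "t \<in> {0..<N} \<Longrightarrow> s \<in> {0..<N} \<Longrightarrow> N dvd t - s \<longleftrightarrow> t = (s :: int)"
  by (simp flip: mod_eq_dvd_iff)

lemma dih_sign_pow:
  "fst (x [^]\<^bsub>dih N\<^esub> (k::nat)) = fst x ^ k"
  by (induction k) (simp_all add: dih_fst_mult dih_simps(3))

text \<open>A cyclic group of odd order has no element of order two, so the only involution that is
  not a reflection is the identity.\<close>

lemma dih_involution_cases:
  assumes "x \<in> carrier (dih N)" "x \<otimes>\<^bsub>dih N\<^esub> x = \<one>\<^bsub>dih N\<^esub>" "odd N"
  shows "x = \<one>\<^bsub>dih N\<^esub> \<or> fst x = -1"
proof -
  obtain e t where [simp]: "x = (e, t)" by (cases x)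
  have "t = 0" if "e = 1"
  proof -
    have "N dvd 2 * t" using assms(2) that by (simp add: dih_simps dvd_eq_mod_eq_0)
    then have "N dvd t" using assms(3) by (simp add: coprime_dvd_mult_right_iff)
    then show ?thesis using assms(1) by (auto simp: dih_simps dvd_eq_mod_eq_0)
  qed
  then show ?thesis using assms(1) by (auto simp: dih_simps)
qed

definition dih_sign :: "int \<times> int \<Rightarrow> int \<times> int" where
  "dih_sign x = (fst x, 0)"

lemma dih_sign_hom: "dih_sign \<in> hom (dih N) (dih 1)"
  by (auto simp: hom_def dih_simps dih_sign_def)

text \<open>The linear character of an even dihedral group that ignores the sign and alternates
  along translations. Like \<open>dih_sign\<close> it takes values in \<open>dih 1\<close>, the
  group of order two, so fibres of both lie over the same sign assignments.\<close>

definition dih_parity :: "int \<times> int \<Rightarrow> int \<times> int" where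
  "dih_parity x = (if even (snd x) then 1 else -1, 0)"

lemma dih_parity_hom: "even N \<Longrightarrow> dih_parity \<in> hom (dih N) (dih 1)"
  by (auto simp: hom_def dih_simps dih_parity_def dvd_mod_iff)

section \<open>Wreath products over dihedral groups and their involutions\<close>

definition pfun :: "int \<Rightarrow> int \<Rightarrow> (int \<Rightarrow> int) set" where
  "pfun q N = {a. \<forall>i. 0 \<le> a i \<and> a i < N \<and> a (i + q) = a i}"

lemma pfunD: "a \<in> pfun q N \<Longrightarrow> 0 \<le> a i \<and> a i < N" "a \<in> pfun q N \<Longrightarrow> a (i + q) = a i"
  by (auto simp: pfun_def)

lemma pfun_add_mult: "a \<in> pfun q N \<Longrightarrow> a (i + k * q) = a i"
proof (induction k rule: int_induct[where k = 0])
  case (step1 j)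
  then show ?case using pfunD(2)[of a q N "i + j * q"] by (simp add: algebra_simps)
next
  case (step2 j)
  then show ?case using pfunD(2)[of a q N "i + (j - 1) * q"] by (simp add: algebra_simps)
qed simp

lemma pfun_cong:
  assumes "a \<in> pfun q N" "q dvd i - j"
  shows "a i = a j"
proof -
  obtain k where "i - j = q * k" using assms(2) by auto
  then have "i = j + k * q" by (simp add: algebra_simps)
  then show ?thesis using pfun_add_mult[OF assms(1)] by simp
qed

lemma pfun_mod: "a \<in> pfun q N \<Longrightarrow> a (i mod q) = a i"
  by (rule pfun_cong[where a = a and q = q and N = N]) (auto simp: mod_eq_dvd_iff[symmetric])

lemma finite_pfun: assumes "q > 0" shows "finite (pfun q N)"
proof (rule finite_imageD)
  show "finite ((\<lambda>a. restrict a {0..<q}) ` pfun q N)"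
    by (rule finite_subset[of _ "{0..<q} \<rightarrow>\<^sub>E {0..<N}"]) (auto simp: pfun_def intro!: finite_PiE)
  show "inj_on (\<lambda>a. restrict a {0..<q}) (pfun q N)"
  proof (rule inj_onI)
    fix a b assume ab: "a \<in> pfun q N" "b \<in> pfun q N" "restrict a {0..<q} = restrict b {0..<q}"
    show "a = b"
    proof
      fix i
      have "a (i mod q) = b (i mod q)" using fun_cong[OF ab(3), of "i mod q"] assms by simp
      then show "a i = b i" using ab by (simp add: pfun_mod)
    qed
  qed
qed

text \<open>The wreath product of the integers modulo $N$ with the dihedral group acting on the integers
  modulo $q$; elements of the base group are represented as $q$-periodic functions.\<close>

definition wr :: "int \<Rightarrow> int \<Rightarrow> ((int \<times> int) \<times> (int \<Rightarrow> int)) monoid" where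
  "wr q N = \<lparr>carrier = carrier (dih q) \<times> pfun q N,
     monoid.mult = (\<lambda>(g, a) (h, b). (g \<otimes>\<^bsub>dih q\<^esub> h, \<lambda>i. (b i + a (fst h * i + snd h)) mod N)),
     one = (\<one>\<^bsub>dih q\<^esub>, \<lambda>_. 0)\<rparr>"

lemma wr_simps:
  "carrier (wr q N) = carrier (dih q) \<times> pfun q N"
  "(g, a) \<otimes>\<^bsub>wr q N\<^esub> (h, b) = (g \<otimes>\<^bsub>dih q\<^esub> h, \<lambda>i. (b i + a (fst h * i + snd h)) mod N)"
  "\<one>\<^bsub>wr q N\<^esub> = (\<one>\<^bsub>dih q\<^esub>, \<lambda>_. 0)"
  by (simp_all add: wr_def)

lemma pfun_act:
  assumes "N > 0" "a \<in> pfun q N" "b \<in> pfun q N"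
  shows "(\<lambda>i. (b i + a (e * i + t)) mod N) \<in> pfun q N"
proof -
  have "a (e * (i + q) + t) = a (e * i + t)" for i
    by (rule pfun_cong[OF assms(2)]) (simp add: algebra_simps)
  then show ?thesis using assms by (simp add: pfun_def)
qed

lemma group_wr: assumes "q > 0" "N > 0" shows "group (wr q N)"
proof (rule groupI)
  interpret D: group "dih q" using group_dih[OF assms(1)] .
  fix x y assume xy: "x \<in> carrier (wr q N)" "y \<in> carrier (wr q N)"
  then show "x \<otimes>\<^bsub>wr q N\<^esub> y \<in> carrier (wr q N)"
    using pfun_act[OF assms(2)] by (auto simp: wr_simps)
  fix z assume z: "z \<in> carrier (wr q N)"
  obtain g a h b e t c where [simp]: "x = (g, a)" "y = (h, b)" "z = ((e, t), c)"
    by (metis surj_pair)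
  have pa: "a \<in> pfun q N" "b \<in> pfun q N" using xy by (auto simp: wr_simps)
  obtain e' t' where [simp]: "h = (e', t')" by (cases h)
  have "a (fst (h \<otimes>\<^bsub>dih q\<^esub> (e, t)) * i + snd (h \<otimes>\<^bsub>dih q\<^esub> (e, t))) = a (e' * (e * i + t) + t')" for i
  proof (rule pfun_cong[OF pa(1)])
    have "q dvd (t' + e' * t) mod q - (t' + e' * t)" by (simp add: mod_eq_dvd_iff[symmetric])
    then show "q dvd fst (h \<otimes>\<^bsub>dih q\<^esub> (e, t)) * i + snd (h \<otimes>\<^bsub>dih q\<^esub> (e, t)) - (e' * (e * i + t) + t')"
      by (simp add: dih_simps algebra_simps)
  qed
  moreover have "(c i + (b (e * i + t) + u) mod N) mod N = ((c i + b (e * i + t)) mod N + u) mod N" for i u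
    by (simp add: mod_simps algebra_simps)
  ultimately show "x \<otimes>\<^bsub>wr q N\<^esub> y \<otimes>\<^bsub>wr q N\<^esub> z = x \<otimes>\<^bsub>wr q N\<^esub> (y \<otimes>\<^bsub>wr q N\<^esub> z)"
    using xy z by (simp add: wr_simps D.m_assoc)
next
  interpret D: group "dih q" using group_dih[OF assms(1)] .
  show "\<one>\<^bsub>wr q N\<^esub> \<in> carrier (wr q N)" using assms by (simp add: wr_simps pfun_def)
  fix x assume x: "x \<in> carrier (wr q N)"
  then obtain g a where [simp]: "x = (g, a)" and g: "g \<in> carrier (dih q)" and a: "a \<in> pfun q N"
    by (auto simp: wr_simps)
  show "\<one>\<^bsub>wr q N\<^esub> \<otimes>\<^bsub>wr q N\<^esub> x = x"
    using g pfunD(1)[OF a] by (simp add: wr_simps)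
  obtain e t where g_eq: "g = (e, t)" by (cases g)
  obtain e' t' where inv: "inv\<^bsub>dih q\<^esub> g = (e', t')" by (cases "inv\<^bsub>dih q\<^esub> g")
  let ?y = "(inv\<^bsub>dih q\<^esub> g, \<lambda>i. (- a (e' * i + t')) mod N)"
  have yc: "?y \<in> carrier (wr q N)"
  proof -
    have "a (e' * (i + q) + t') = a (e' * i + t')" for i by (rule pfun_cong[OF a]) (simp add: algebra_simps)
    then show ?thesis using g assms by (simp add: wr_simps pfun_def)
  qed
  have "a (e' * (e * i + t) + t') = a i" for i
  proof (rule pfun_cong[OF a])
    have "(e', t') \<otimes>\<^bsub>dih q\<^esub> (e, t) = \<one>\<^bsub>dih q\<^esub>" using D.l_inv[OF g, unfolded inv] by (simp only: g_eq)
    then have e: "e' * e = 1" "q dvd t' + e' * t" by (simp_all add: dih_simps dvd_eq_mod_eq_0)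
    have "e' * (e * i + t) + t' - i = (e' * e - 1) * i + (t' + e' * t)" by (simp add: algebra_simps)
    also have "\<dots> = t' + e' * t" using e(1) by simp
    finally show "q dvd e' * (e * i + t) + t' - i" using e(2) by (simp only:)
  qed
  then have "?y \<otimes>\<^bsub>wr q N\<^esub> x = \<one>\<^bsub>wr q N\<^esub>" using g by (simp add: wr_simps g_eq mod_simps)
  with yc show "\<exists>y\<in>carrier (wr q N). y \<otimes>\<^bsub>wr q N\<^esub> x = \<one>\<^bsub>wr q N\<^esub>" by blast
qed

lemma finite_wr: "q > 0 \<Longrightarrow> finite (carrier (wr q N))"
  by (simp add: wr_simps finite_dih finite_pfun)

lemma wr_fst_hom: "fst \<in> hom (wr q N) (dih q)"
  by (auto simp: hom_def wr_simps)

text \<open>The base components that turn the reflection \<open>(-1, t)\<close> into an involution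
  of the wreath product: functions that are odd under the reflection of the index.\<close>

definition antisym_fun :: "int \<Rightarrow> int \<Rightarrow> int \<Rightarrow> (int \<Rightarrow> int) set" where
  "antisym_fun q N t = {a \<in> pfun q N. \<forall>i. N dvd a (t - i) + a i}"

lemma wr_involution_iff:
  assumes "q > 0" "N > 0" "t \<in> {0..<q}"
  shows "((-1, t), a) \<in> carrier (wr q N) \<and> ((-1, t), a) \<otimes>\<^bsub>wr q N\<^esub> ((-1, t), a) = \<one>\<^bsub>wr q N\<^esub> \<longleftrightarrow> a \<in> antisym_fun q N t"
  using assms by (auto simp: wr_simps dih_simps antisym_fun_def fun_eq_iff dvd_eq_mod_eq_0 add.commute)

text \<open>By antisymmetry \<open>a (s - i)\<close> is \<open>- a (i + d)\<close> modulo
  \<open>N\<close>, with d = t - s. One product thus has base component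
  \<open>b i - a (i + d)\<close>, and powers add up its translates by d.\<close>

lemma wr_refl_pow:
  assumes q: "q > 0" "N > 0" and t: "t \<in> {0..<q}" "s \<in> {0..<q}"
    and a: "a \<in> antisym_fun q N t" and b: "b \<in> antisym_fun q N s"
  shows "(((-1, t), a) \<otimes>\<^bsub>wr q N\<^esub> ((-1, s), b)) [^]\<^bsub>wr q N\<^esub> (k::nat) =
    (((-1, t) \<otimes>\<^bsub>dih q\<^esub> (-1, s)) [^]\<^bsub>dih q\<^esub> k,
      \<lambda>i. (\<Sum>j<k. b (i + int j * (t - s)) - a (i + int (Suc j) * (t - s))) mod N)"
proof (induction k)
  case (Suc k)
  let ?d = "t - s"
  let ?r = "((-1, t), a) \<otimes>\<^bsub>wr q N\<^esub> ((-1, s), b)"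
  let ?S = "\<lambda>k i. (\<Sum>j<k. b (i + int j * ?d) - a (i + int (Suc j) * ?d))"
  have pb: "b \<in> pfun q N" and pa: "a \<in> pfun q N" using a b by (auto simp: antisym_fun_def)
  have r: "?r = ((1, ?d mod q), \<lambda>i. (b i + a (s - i)) mod N)" by (simp add: wr_simps dih_simps)
  have c: "[b i + a (s - i) = b i - a (i + ?d)] (mod N)" for i
  proof -
    have e: "t - (i + ?d) = s - i" by simp
    have "N dvd a (t - (i + ?d)) + a (i + ?d)" using a unfolding antisym_fun_def by blast
    then have "N dvd a (s - i) + a (i + ?d)" unfolding e .
    moreover have "b i + a (s - i) - (b i - a (i + ?d)) = a (s - i) + a (i + ?d)" by simp
    ultimately show ?thesis unfolding cong_iff_dvd_diff by (simp only:)
  qed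
  have shift: "?S k (i + ?d mod q) = ?S k (i + ?d)" for i
  proof (rule sum.cong)
    fix j
    have "q dvd ?d mod q - ?d" by (simp add: mod_eq_dvd_iff[symmetric])
    then show "b (i + ?d mod q + int j * ?d) - a (i + ?d mod q + int (Suc j) * ?d) =
        b (i + ?d + int j * ?d) - a (i + ?d + int (Suc j) * ?d)"
      using pfun_cong[OF pb, of "i + ?d mod q + int j * ?d" "i + ?d + int j * ?d"]
        pfun_cong[OF pa, of "i + ?d mod q + int (Suc j) * ?d" "i + ?d + int (Suc j) * ?d"] by simp
  qed simp
  have "((b i + a (s - i)) mod N + ?S k (i + ?d mod q) mod N) mod N = ?S (Suc k) i mod N" for i
  proof -
    have "((b i + a (s - i)) mod N + ?S k (i + ?d mod q) mod N) mod N = (b i + a (s - i) + ?S k (i + ?d)) mod N"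
      by (simp only: shift mod_add_eq)
    also have "\<dots> = (b i - a (i + ?d) + ?S k (i + ?d)) mod N"
      using cong_add[OF c[of i] cong_refl[of "?S k (i + ?d)"]] by (simp only: cong_def)
    also have "b i - a (i + ?d) + ?S k (i + ?d) = ?S (Suc k) i"
      by (simp only: sum.lessThan_Suc_shift) (simp add: algebra_simps)
    finally show ?thesis .
  qed
  then have *: "(\<lambda>i. ((b i + a (s - i)) mod N + ?S k (i + ?d mod q) mod N) mod N) = (\<lambda>i. ?S (Suc k) i mod N)"
    by (rule ext)
  have "?r [^]\<^bsub>wr q N\<^esub> Suc k = ?r [^]\<^bsub>wr q N\<^esub> k \<otimes>\<^bsub>wr q N\<^esub> ?r" by simp
  also have "\<dots> = (((-1, t) \<otimes>\<^bsub>dih q\<^esub> (-1, s)) [^]\<^bsub>dih q\<^esub> k \<otimes>\<^bsub>dih q\<^esub> (1, ?d mod q),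
     \<lambda>i. ((b i + a (s - i)) mod N + ?S k (i + ?d mod q) mod N) mod N)"
    unfolding Suc.IH unfolding r by (simp add: wr_simps)
  also have "\<dots> = (((-1, t) \<otimes>\<^bsub>dih q\<^esub> (-1, s)) [^]\<^bsub>dih q\<^esub> Suc k, \<lambda>i. ?S (Suc k) i mod N)"
    unfolding * by (simp add: dih_refl_mult)
  finally show ?case .
qed (simp add: wr_simps)

text \<open>Reflecting a full period shows that twice its sum vanishes, and \<open>N\<close> is odd.
  Steps of \<open>d\<close> permute the residues modulo the prime \<open>q\<close>, so
  \<open>k\<close> steps run through whole periods.\<close>

lemma antisym_period_sum:
  assumes q: "prime q" and N: "odd N" and a: "a \<in> antisym_fun q N t"
    and d: "\<not> q dvd d" and k: "q dvd int k"
  shows "N dvd (\<Sum>j<k. a (i + int j * d))"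
proof -
  have q0: "q > 0" using q by (simp add: prime_gt_0_int)
  have pa: "a \<in> pfun q N" using a by (simp add: antisym_fun_def)
  define B where "B = (\<Sum>u\<in>{0..<q}. a u)"
  have "(\<Sum>u\<in>{0..<q}. a (t - u)) = B"
  proof -
    have "(\<Sum>u\<in>{0..<q}. a (t - u)) = (\<Sum>u\<in>{0..<q}. a ((t - u) mod q))" by (simp add: pfun_mod[OF pa])
    also have "\<dots> = B" unfolding B_def
    proof (rule sum.reindex_bij_witness[of _ "\<lambda>u. (t - u) mod q" "\<lambda>u. (t - u) mod q"])
      fix u assume "u \<in> {0..<q}"
      moreover have "(t - (t - u) mod q) mod q = (t - (t - u)) mod q" by (rule mod_diff_right_eq)
      ultimately show "(t - (t - u) mod q) mod q = u" by simp
      then show "(t - (t - u) mod q) mod q = u" .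
    qed (use q0 in auto)
    finally show ?thesis .
  qed
  then have "2 * B = (\<Sum>u\<in>{0..<q}. a (t - u) + a u)" by (simp add: sum.distrib B_def)
  moreover have "N dvd (\<Sum>u\<in>{0..<q}. a (t - u) + a u)"
    using a by (intro dvd_sum) (simp add: antisym_fun_def)
  ultimately have "N dvd 2 * B" by (simp only:)
  then have NB: "N dvd B" using N by (simp add: coprime_dvd_mult_right_iff)
  have block: "(\<Sum>j<nat q. a (i + int j * d)) = B" for i
  proof -
    have "bij_betw (\<lambda>j. (i + int j * d) mod q) {..<nat q} {0..<q}"
    proof (rule bij_betw_imageI)
      show inj: "inj_on (\<lambda>j. (i + int j * d) mod q) {..<nat q}"
      proof (rule inj_onI)
        fix j j' assume j: "j \<in> {..<nat q}" "j' \<in> {..<nat q}" "(i + int j * d) mod q = (i + int j' * d) mod q"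
        then have "q dvd (int j - int j') * d" by (simp add: mod_eq_dvd_iff algebra_simps)
        then have "q dvd int j - int j'" using q d by (simp add: prime_dvd_mult_iff)
        moreover have "\<bar>int j - int j'\<bar> < q" using j by auto
        ultimately have "int j - int j' = 0" using dvd_imp_le_int[of "int j - int j'" q] q0 by auto
        then show "j = j'" by simp
      qed
      show "(\<lambda>j. (i + int j * d) mod q) ` {..<nat q} = {0..<q}"
        by (rule card_subset_eq) (use q0 card_image[OF inj] in auto)
    qed
    then have "(\<Sum>j<nat q. a ((i + int j * d) mod q)) = B" unfolding B_def by (rule sum.reindex_bij_betw)
    then show ?thesis by (simp add: pfun_mod[OF pa])
  qed
  obtain l where l: "int k = q * l" using k by auto
  have "l \<ge> 0" using l q0 by (metis of_nat_0_le_iff zero_le_mult_iff not_le)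
  with l q0 have "k = nat q * nat l" by (metis nat_int nat_mult_distrib order_less_imp_le)
  moreover have "(\<Sum>j<nat q * l. a (i + int j * d)) = int l * B" for l i
  proof (induction l)
    case (Suc l)
    have "(\<Sum>j<nat q * Suc l. a (i + int j * d)) =
      (\<Sum>j<nat q * l. a (i + int j * d)) + (\<Sum>j<nat q. a (i + int (nat q * l + j) * d))"
      using sum.nat_group[of "\<lambda>j. a (i + int j * d)" "nat q" "Suc l"] sum.nat_group[of "\<lambda>j. a (i + int j * d)" "nat q" l]
      sum.shift_bounds_nat_ivl[of "\<lambda>j. a (i + int j * d)" 0 "nat q * l" "nat q"]
      by (simp add: lessThan_atLeast0 mult.commute add.commute)
    also have "(\<Sum>j<nat q. a (i + int (nat q * l + j) * d)) = (\<Sum>j<nat q. a (i + int (nat q * l) * d + int j * d))"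
      by (simp add: algebra_simps)
    finally show ?case using Suc block[of "i + int (nat q * l) * d"] by (simp add: algebra_simps)
  qed simp
  ultimately show ?thesis using NB by simp
qed

text \<open>The reason for using the wreath product: reflections at different positions impose
  nothing on the base components, those at the same position force agreement up to
  \<open>k\<close>-torsion.\<close>

lemma wr_refl_pow_iff:
  assumes q: "prime q" and N: "odd N" "N > 0" and t: "t \<in> {0..<q}" "s \<in> {0..<q}"
    and a: "a \<in> antisym_fun q N t" and b: "b \<in> antisym_fun q N s"
  shows "(((-1, t), a) \<otimes>\<^bsub>wr q N\<^esub> ((-1, s), b)) [^]\<^bsub>wr q N\<^esub> (k::nat) = \<one>\<^bsub>wr q N\<^esub> \<longleftrightarrow>
    q dvd int k * (t - s) \<and> (t = s \<longrightarrow> (\<forall>i. N dvd int k * (a i - b i)))"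
proof -
  have q0: "q > 0" using q by (simp add: prime_gt_0_int)
  let ?S = "\<lambda>i. (\<Sum>j<k. b (i + int j * (t - s)) - a (i + int (Suc j) * (t - s)))"
  have "(((-1, t), a) \<otimes>\<^bsub>wr q N\<^esub> ((-1, s), b)) [^]\<^bsub>wr q N\<^esub> k = \<one>\<^bsub>wr q N\<^esub> \<longleftrightarrow>
    q dvd int k * (t - s) \<and> (\<forall>i. N dvd ?S i)"
    unfolding wr_refl_pow[OF q0 N(2) t a b] using dih_refl_pow_iff[OF q0, of t s k]
    by (auto simp: wr_simps fun_eq_iff dvd_eq_mod_eq_0)
  also have "\<dots> \<longleftrightarrow> q dvd int k * (t - s) \<and> (t = s \<longrightarrow> (\<forall>i. N dvd int k * (a i - b i)))"
  proof (cases "t = s")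
    case True
    have "?S i = - (int k * (a i - b i))" for i by (simp add: True algebra_simps)
    then show ?thesis using True by simp
  next
    case False
    have d: "\<not> q dvd t - s"
      using False t by (simp add: residue_dvd_diff_iff)
    have "N dvd ?S i" if k: "q dvd int k" for i
    proof -
      have "?S i = (\<Sum>j<k. b (i + int j * (t - s))) - (\<Sum>j<k. a ((i + (t - s)) + int j * (t - s)))"
        by (simp add: sum_subtractf algebra_simps)
      then show ?thesis using antisym_period_sum[OF q N(1) b d k, of i] antisym_period_sum[OF q N(1) a d k, of "i + (t - s)"]
        by (simp add: dvd_diff)
    qed
    then show ?thesis using False d q by (auto simp: prime_dvd_mult_iff)
  qed
  finally show ?thesis .
qed

lemma coxeter_graph_edgeD:
  assumes "coxeter_graph V E m" "{v, w} \<in> E"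
  shows "v \<in> V" "w \<in> V" "v \<noteq> w" "m {v, w} \<ge> 2"
  using assms by (auto simp: coxeter_graph_def doubleton_eq_iff)

section \<open>Odd labels\<close>

text \<open>Used as the projection to classes. A class is named by its own vertex set, so quotient
  graphs live on the type of vertex sets.\<close>

definition comp_of :: "'a set set \<Rightarrow> 'a \<Rightarrow> 'a set" where
  "comp_of E v = {w. (\<lambda>x y. {x, y} \<in> E)\<^sup>*\<^sup>* v w}"

lemma comp_of_eq_iff: "comp_of E v = comp_of E w \<longleftrightarrow> (\<lambda>x y. {x, y} \<in> E)\<^sup>*\<^sup>* v w"
proof -
  have "symp (\<lambda>x y. {x, y} \<in> E)" by (auto simp: symp_def insert_commute)
  then have sym: "(\<lambda>x y. {x, y} \<in> E)\<^sup>*\<^sup>* a b \<Longrightarrow> (\<lambda>x y. {x, y} \<in> E)\<^sup>*\<^sup>* b a" for a b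
    by (meson sympD symp_rtranclp)
  show ?thesis
  proof
    assume "comp_of E v = comp_of E w"
    moreover have "w \<in> comp_of E w" by (simp add: comp_of_def)
    ultimately show "(\<lambda>x y. {x, y} \<in> E)\<^sup>*\<^sup>* v w" by (simp add: comp_of_def set_eq_iff)
  next
    assume "(\<lambda>x y. {x, y} \<in> E)\<^sup>*\<^sup>* v w"
    then show "comp_of E v = comp_of E w"
      using sym by (auto simp: comp_of_def intro: rtranclp_trans)
  qed
qed

lemma comp_of_edge: "{v, w} \<in> E \<Longrightarrow> comp_of E v = comp_of E w"
  by (simp add: comp_of_eq_iff r_into_rtranclp)

lemma const_on_comp:
  assumes "\<And>v w. {v, w} \<in> E \<Longrightarrow> f v = f w" "comp_of E v = comp_of E w"
  shows "f v = f w"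
proof -
  have "(\<lambda>x y. {x, y} \<in> E)\<^sup>*\<^sup>* v w" using assms(2) by (simp add: comp_of_eq_iff)
  then show ?thesis by induction (auto dest: assms(1))
qed

text \<open>Turns assignments forced to agree along edges into free assignments on components;
  counting the former then reveals the number of components.\<close>

lemma bij_betw_comp_functions:
  assumes "\<forall>v w. {v, w} \<in> E \<longrightarrow> v \<in> V \<and> w \<in> V"
  shows "bij_betw (\<lambda>y. \<lambda>v\<in>V. y (comp_of E v)) (PiE (comp_of E ` V) (\<lambda>_. S))
    {f \<in> V \<rightarrow>\<^sub>E S. \<forall>v w. {v, w} \<in> E \<longrightarrow> f v = f w}"
proof (rule bij_betw_imageI)
  show "inj_on (\<lambda>y. \<lambda>v\<in>V. y (comp_of E v)) (PiE (comp_of E ` V) (\<lambda>_. S))"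
  proof (rule inj_onI)
    fix y z assume yz: "y \<in> PiE (comp_of E ` V) (\<lambda>_. S)" "z \<in> PiE (comp_of E ` V) (\<lambda>_. S)"
      "(\<lambda>v\<in>V. y (comp_of E v)) = (\<lambda>v\<in>V. z (comp_of E v))"
    show "y = z"
    proof (rule PiE_ext[OF yz(1,2)])
      fix u assume "u \<in> comp_of E ` V"
      then obtain v where "v \<in> V" "u = comp_of E v" by auto
      then show "y u = z u" using fun_cong[OF yz(3), of v] by simp
    qed
  qed
  show "(\<lambda>y. \<lambda>v\<in>V. y (comp_of E v)) ` (PiE (comp_of E ` V) (\<lambda>_. S)) = {f \<in> V \<rightarrow>\<^sub>E S. \<forall>v w. {v, w} \<in> E \<longrightarrow> f v = f w}"
  proof (intro equalityI subsetI)
    fix f assume f: "f \<in> {f \<in> V \<rightarrow>\<^sub>E S. \<forall>v w. {v, w} \<in> E \<longrightarrow> f v = f w}"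
    let ?y = "\<lambda>u\<in>comp_of E ` V. f (SOME v. v \<in> V \<and> comp_of E v = u)"
    have rep: "(SOME v'. v' \<in> V \<and> comp_of E v' = comp_of E v) \<in> V \<and>
        comp_of E (SOME v'. v' \<in> V \<and> comp_of E v' = comp_of E v) = comp_of E v" if "v \<in> V" for v
      using someI[of "\<lambda>v'. v' \<in> V \<and> comp_of E v' = comp_of E v" v] that by simp
    have val: "?y (comp_of E v) = f v" if v: "v \<in> V" for v
    proof -
      have "f v = f w" if "{v, w} \<in> E" for v w using f that by blast
      then have "f (SOME v'. v' \<in> V \<and> comp_of E v' = comp_of E v) = f v"
        by (rule const_on_comp[OF _ rep[OF v, THEN conjunct2]])
      then show ?thesis using v by simp
    qed
    have "(\<lambda>v\<in>V. ?y (comp_of E v)) = restrict f V" by (intro restrict_ext val)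
    also have "\<dots> = f" using f by (auto simp: PiE_restrict)
    finally have "f = (\<lambda>v\<in>V. ?y (comp_of E v))" ..
    moreover have "?y \<in> PiE (comp_of E ` V) (\<lambda>_. S)" using f rep by fastforce
    ultimately show "f \<in> (\<lambda>y. \<lambda>v\<in>V. y (comp_of E v)) ` (PiE (comp_of E ` V) (\<lambda>_. S))" by (rule image_eqI)
  next
    fix f assume "f \<in> (\<lambda>y. \<lambda>v\<in>V. y (comp_of E v)) ` (PiE (comp_of E ` V) (\<lambda>_. S))"
    then obtain y where y: "y \<in> PiE (comp_of E ` V) (\<lambda>_. S)" "f = (\<lambda>v\<in>V. y (comp_of E v))" by auto
    have "f v = f w" if "{v, w} \<in> E" for v w
      using assms[rule_format, OF that] comp_of_edge[OF that] by (simp add: y(2))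
    moreover have "f \<in> V \<rightarrow>\<^sub>E S" unfolding y(2) using PiE_mem[OF y(1)] by auto
    ultimately show "f \<in> {f \<in> V \<rightarrow>\<^sub>E S. \<forall>v w. {v, w} \<in> E \<longrightarrow> f v = f w}" by blast
  qed
qed

section \<open>Homomorphisms to dihedral groups of odd degree\<close>

definition refl_assign :: "'a set \<Rightarrow> ('a \<Rightarrow> int) \<Rightarrow> 'a \<Rightarrow> int \<times> int" where
  "refl_assign V t = (\<lambda>v\<in>V. (-1, t v))"

definition refl_homs :: "'a set \<Rightarrow> 'a set set \<Rightarrow> ('a set \<Rightarrow> nat) \<Rightarrow> int \<Rightarrow> ('a \<Rightarrow> int \<times> int) set" where
  "refl_homs V E m N = {x \<in> cox_homs V E m (dih N). \<forall>v\<in>V. fst (x v) = -1}"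

definition refl_params :: "'a set \<Rightarrow> 'a set set \<Rightarrow> ('a set \<Rightarrow> nat) \<Rightarrow> int \<Rightarrow> ('a \<Rightarrow> int) set" where
  "refl_params V E m N = {t \<in> V \<rightarrow>\<^sub>E {0..<N}. \<forall>v\<in>V. \<forall>w\<in>V. {v, w} \<in> E \<longrightarrow> N dvd int (m {v, w}) * (t v - t w)}"

lemma refl_assign_in_homs_iff:
  assumes "N > 0" "t \<in> V \<rightarrow>\<^sub>E {0..<N}"
  shows "refl_assign V t \<in> cox_homs V E m (dih N) \<longleftrightarrow> t \<in> refl_params V E m N"
proof -
  have t: "t v \<in> {0..<N}" if "v \<in> V" for v using assms(2) that by (rule PiE_mem)
  have "(refl_assign V t v \<otimes>\<^bsub>dih N\<^esub> refl_assign V t w) [^]\<^bsub>dih N\<^esub> m {v, w} = \<one>\<^bsub>dih N\<^esub> \<longleftrightarrow>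
    N dvd int (m {v, w}) * (t v - t w)" if "v \<in> V" "w \<in> V" for v w
    using that dih_refl_pow_iff[OF assms(1), of "t v" "t w" "m {v, w}"] by (simp add: refl_assign_def)
  moreover have "refl_assign V t \<in> V \<rightarrow>\<^sub>E carrier (dih N)" using t by (auto simp: refl_assign_def dih_simps(1))
  moreover have "refl_assign V t v \<otimes>\<^bsub>dih N\<^esub> refl_assign V t v = \<one>\<^bsub>dih N\<^esub>" if "v \<in> V" for v
    using that assms by (simp add: refl_assign_def dih_refl_mult) (simp add: dih_simps)
  ultimately show ?thesis using assms(2) by (auto simp: cox_homs_def refl_params_def)
qed

lemma bij_betw_refl_homs:
  assumes "N > 0"
  shows "bij_betw (refl_assign V) (refl_params V E m N) (refl_homs V E m N)"
proof (rule bij_betw_imageI)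
  show "inj_on (refl_assign V) (refl_params V E m N)"
  proof (rule inj_onI)
    fix s t assume st: "s \<in> refl_params V E m N" "t \<in> refl_params V E m N" "refl_assign V s = refl_assign V t"
    then have "s \<in> V \<rightarrow>\<^sub>E {0..<N}" "t \<in> V \<rightarrow>\<^sub>E {0..<N}" by (auto simp: refl_params_def)
    then show "s = t"
    proof (rule PiE_ext)
      fix v assume "v \<in> V"
      then show "s v = t v" using fun_cong[OF st(3), of v] by (simp add: refl_assign_def)
    qed
  qed
  show "refl_assign V ` refl_params V E m N = refl_homs V E m N"
  proof (intro equalityI subsetI)
    fix x assume x: "x \<in> refl_homs V E m N"
    then have xh: "x \<in> cox_homs V E m (dih N)" and fx: "fst (x v) = -1" if "v \<in> V" for v
      using that by (auto simp: refl_homs_def)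
    have xh: "x \<in> cox_homs V E m (dih N)" using x by (auto simp: refl_homs_def)
    let ?t = "\<lambda>v\<in>V. snd (x v)"
    have eq: "x = refl_assign V ?t"
    proof
      fix v show "x v = refl_assign V ?t v"
        using fx[of v] cox_homsD(2)[OF xh, of v] by (cases "v \<in> V"; cases "x v") (auto simp: refl_assign_def)
    qed
    moreover have t: "?t \<in> V \<rightarrow>\<^sub>E {0..<N}"
    proof
      fix v assume "v \<in> V"
      then have "x v \<in> carrier (dih N)" using cox_homsD(1)[OF xh] by simp
      then show "?t v \<in> {0..<N}" using \<open>v \<in> V\<close> by (auto simp: dih_simps(1))
    qed simp
    ultimately have "?t \<in> refl_params V E m N" using refl_assign_in_homs_iff[OF assms t, of E m] xh by simp
    with eq show "x \<in> refl_assign V ` refl_params V E m N" by (rule image_eqI)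
  next
    fix x assume "x \<in> refl_assign V ` refl_params V E m N"
    then obtain t where t: "t \<in> refl_params V E m N" "x = refl_assign V t" by auto
    then have "t \<in> V \<rightarrow>\<^sub>E {0..<N}" by (simp add: refl_params_def)
    then show "x \<in> refl_homs V E m N" using refl_assign_in_homs_iff[OF assms, of t V E m] t
      by (simp add: refl_homs_def) (simp add: refl_assign_def)
  qed
qed

definition trivial_assign :: "'a set \<Rightarrow> 'a \<Rightarrow> int \<times> int" where
  "trivial_assign V = (\<lambda>v\<in>V. (1, 0))"

lemma trivial_assign_in_homs:
  assumes "N > 0" shows "trivial_assign V \<in> cox_homs V E m (dih N)"
proof -
  interpret group "dih N" using group_dih[OF assms] .
  have "(1, 0) = \<one>\<^bsub>dih N\<^esub>" by (simp add: dih_simps)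
  then show ?thesis by (intro cox_homsI) (simp_all add: trivial_assign_def)
qed

text \<open>The trivial assignment and the one sending every generator to the sign -1 always exist
  and differ when \<open>V\<close> is nonempty; a count of two leaves no mixed signs.\<close>

lemma card_sign_homs_eq_2:
  assumes "finite V" "card (cox_homs V E m (dih 1)) = 2"
  shows "V \<noteq> {}" and "x \<in> cox_homs V E m (dih 1) \<Longrightarrow> v \<in> V \<Longrightarrow> w \<in> V \<Longrightarrow> x v = x w"
proof -
  have p: "(\<lambda>v\<in>V. 0) \<in> V \<rightarrow>\<^sub>E {0..<1::int}" by auto
  have r: "refl_assign V (\<lambda>v\<in>V. 0) \<in> cox_homs V E m (dih 1)"
    using refl_assign_in_homs_iff[OF _ p, of E m] p by (simp add: refl_params_def)
  have t: "trivial_assign V \<in> cox_homs V E m (dih 1)" by (rule trivial_assign_in_homs) simp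
  show ne: "V \<noteq> {}"
  proof
    assume "V = {}"
    then have "cox_homs V E m (dih 1) \<subseteq> {\<lambda>_. undefined}" by (auto simp: cox_homs_def)
    then have "card (cox_homs V E m (dih 1)) \<le> card {\<lambda>_ :: 'a. undefined :: int \<times> int}" by (intro card_mono) auto
    then show False using assms(2) by simp
  qed
  then obtain u where "u \<in> V" by auto
  then have "trivial_assign V u \<noteq> refl_assign V (\<lambda>v\<in>V. 0) u" by (simp add: trivial_assign_def refl_assign_def)
  then have "trivial_assign V \<noteq> refl_assign V (\<lambda>v\<in>V. 0)" by metis
  then have "card {trivial_assign V, refl_assign V (\<lambda>v\<in>V. 0)} = 2" by auto
  then have eq: "{trivial_assign V, refl_assign V (\<lambda>v\<in>V. 0)} = cox_homs V E m (dih 1)"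
    using r t assms finite_dih by (intro card_subset_eq cox_homs_mono_finite) auto
  show "x v = x w" if "x \<in> cox_homs V E m (dih 1)" "v \<in> V" "w \<in> V"
  proof -
    have "x = trivial_assign V \<or> x = refl_assign V (\<lambda>v\<in>V. 0)" using that(1) eq by blast
    then show ?thesis using that(2,3) by (auto simp: trivial_assign_def refl_assign_def)
  qed
qed

text \<open>Signs cannot be mixed. If all are trivial, the images are rotations of order at most two
  in an odd dihedral group, hence trivial; otherwise all images are reflections.\<close>

lemma cox_homs_dih_odd:
  assumes "finite V" "card (cox_homs V E m (dih 1)) = 2" "odd N" "N > 0"
  shows "cox_homs V E m (dih N) = insert (trivial_assign V) (refl_homs V E m N)"
    and "trivial_assign V \<notin> refl_homs V E m N"
proof -
  show "trivial_assign V \<notin> refl_homs V E m N"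
    using card_sign_homs_eq_2(1)[OF assms(1,2)] by (auto simp: refl_homs_def trivial_assign_def)
  have "x = trivial_assign V \<or> x \<in> refl_homs V E m N" if x: "x \<in> cox_homs V E m (dih N)" for x
  proof (cases "\<exists>v\<in>V. fst (x v) = -1")
    case True
    then obtain v where v: "v \<in> V" "fst (x v) = -1" by auto
    have s: "restrict (dih_sign \<circ> x) V \<in> cox_homs V E m (dih 1)"
      using x dih_sign_hom group_dih[OF assms(4)] group_dih[of 1] by (intro cox_homs_comp) auto
    have "fst (x w) = -1" if "w \<in> V" for w
      using card_sign_homs_eq_2(2)[OF assms(1,2) s v(1) that] v that by (simp add: dih_sign_def)
    then show ?thesis using x by (simp add: refl_homs_def)
  next
    case False
    have "x v = trivial_assign V v" for v
      using False cox_homsD[OF x] dih_involution_cases[OF _ _ assms(3), of "x v"]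
      by (cases "v \<in> V") (auto simp: trivial_assign_def dih_simps(3))
    then show ?thesis by auto
  qed
  then show "cox_homs V E m (dih N) = insert (trivial_assign V) (refl_homs V E m N)"
    using trivial_assign_in_homs[OF assms(4), of V E m] by (auto simp: refl_homs_def)
qed

text \<open>Naturality of the transfer, applied to the trivial endomorphism of
  \<open>dih N\<close>.\<close>

lemma cox_transfer_trivial:
  assumes w: "pc_iso_witness V' E' m' V E m \<phi>" and N: "N > 0"
  shows "cox_transfer V' E' m' V E m \<phi> (dih N) (trivial_assign V) = trivial_assign V'"
proof -
  have h: "(\<lambda>_. \<one>\<^bsub>dih N\<^esub>) \<in> hom (dih N) (dih N)" using N by (auto simp: hom_def dih_simps)
  have \<phi>: "\<phi> \<in> hom (profinite_completion (coxeter_group V' E' m')) (profinite_completion (coxeter_group V E m))"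
    using w by (simp add: pc_iso_witness_def iso_def)
  from cox_transfer_natural[OF \<phi> group_dih[OF N] finite_dih group_dih[OF N] finite_dih h trivial_assign_in_homs[OF N]]
  show ?thesis by (simp add: trivial_assign_def comp_def dih_simps(3) restrict_def cong: if_cong)
qed

lemma cox_transfer_refl_homs:
  assumes w: "pc_iso_witness V' E' m' V E m \<phi>" and N: "odd N" "N > 0"
    and fin: "finite V" "finite V'" and c: "card (cox_homs V E m (dih 1)) = 2" "card (cox_homs V' E' m' (dih 1)) = 2"
  shows "bij_betw (cox_transfer V' E' m' V E m \<phi> (dih N)) (refl_homs V E m N) (refl_homs V' E' m' N)"
proof -
  let ?T = "cox_transfer V' E' m' V E m \<phi> (dih N)"
  note bij = cox_transfer_bij[OF w group_dih[OF N(2)] finite_dih]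
  have "bij_betw ?T (cox_homs V E m (dih N) - {trivial_assign V}) (cox_homs V' E' m' (dih N) - {?T (trivial_assign V)})"
    by (rule bij_betw_DiffI[OF bij]) (use trivial_assign_in_homs[OF N(2), of V E m] bij in \<open>auto simp: bij_betw_def\<close>)
  then show ?thesis
    using cox_homs_dih_odd[OF fin(1) c(1) N] cox_homs_dih_odd[OF fin(2) c(2) N]
    by (simp add: cox_transfer_trivial[OF w N(2)])
qed

section \<open>Fibres of the wreath product as colouring data\<close>

definition wr_family :: "'a set \<Rightarrow> 'a set set \<Rightarrow> ('a set \<Rightarrow> nat) \<Rightarrow> int \<Rightarrow> int \<Rightarrow> ('a \<Rightarrow> int) \<Rightarrow> ('a \<Rightarrow> int \<Rightarrow> int) set" where
  "wr_family V E m q N t = {a \<in> PiE V (\<lambda>v. antisym_fun q N (t v)).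
     \<forall>v\<in>V. \<forall>w\<in>V. {v, w} \<in> E \<longrightarrow> t v = t w \<longrightarrow> (\<forall>i. N dvd int (m {v, w}) * (a v i - a w i))}"

text \<open>The positions \<open>t\<close> already satisfy the dihedral relations, so by
  \<open>wr_refl_pow_iff\<close> only edges with equal positions at both ends constrain the base
  components.\<close>

lemma card_wr_fibre:
  assumes q: "prime q" and N: "odd N" "N > 0" and t: "t \<in> refl_params V E m q"
  shows "card {x \<in> cox_homs V E m (wr q N). restrict (fst \<circ> x) V = refl_assign V t} = card (wr_family V E m q N t)"
proof -
  have q0: "q > 0" using q by (simp add: prime_gt_0_int)
  let ?X = "{x \<in> cox_homs V E m (wr q N). restrict (fst \<circ> x) V = refl_assign V t}"
  have tp: "t \<in> V \<rightarrow>\<^sub>E {0..<q}" and td: "\<And>v w. v \<in> V \<Longrightarrow> w \<in> V \<Longrightarrow> {v, w} \<in> E \<Longrightarrow> q dvd int (m {v, w}) * (t v - t w)"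
    using t by (auto simp: refl_params_def)
  have tv: "t v \<in> {0..<q}" if "v \<in> V" for v using tp that by (rule PiE_mem)
  let ?f = "\<lambda>a. \<lambda>v\<in>V. ((-1 :: int, t v), a v)"
  have "bij_betw ?f (wr_family V E m q N t) ?X"
  proof (rule bij_betw_imageI)
    show "inj_on ?f (wr_family V E m q N t)"
    proof (rule inj_onI)
      fix a b assume ab: "a \<in> wr_family V E m q N t" "b \<in> wr_family V E m q N t" "?f a = ?f b"
      then have "a \<in> PiE V (\<lambda>v. antisym_fun q N (t v))" "b \<in> PiE V (\<lambda>v. antisym_fun q N (t v))"
        by (auto simp: wr_family_def)
      then show "a = b"
      proof (rule PiE_ext)
        fix v assume "v \<in> V"
        then show "a v = b v" using fun_cong[OF ab(3), of v] by simp
      qed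
    qed
    show "?f ` wr_family V E m q N t = ?X"
    proof (intro equalityI subsetI)
      fix x assume "x \<in> ?f ` wr_family V E m q N t"
      then obtain a where a: "a \<in> wr_family V E m q N t" "x = ?f a" by auto
      have av: "a v \<in> antisym_fun q N (t v)" if "v \<in> V" for v using a(1) that by (auto simp: wr_family_def)
      have "x \<in> cox_homs V E m (wr q N)"
      proof (rule cox_homsI)
        fix v assume v: "v \<in> V"
        show "x v \<in> carrier (wr q N)" "x v \<otimes>\<^bsub>wr q N\<^esub> x v = \<one>\<^bsub>wr q N\<^esub>"
          using wr_involution_iff[OF q0 N(2) tv[OF v], of "a v"] av[OF v] v a(2) by simp_all
      next
        fix v w assume vw: "v \<in> V" "w \<in> V" "{v, w} \<in> E"
        then show "(x v \<otimes>\<^bsub>wr q N\<^esub> x w) [^]\<^bsub>wr q N\<^esub> m {v, w} = \<one>\<^bsub>wr q N\<^esub>"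
          using wr_refl_pow_iff[OF q N tv[OF vw(1)] tv[OF vw(2)] av[OF vw(1)] av[OF vw(2)], of "m {v, w}"]
            td[OF vw] a by (simp add: wr_family_def)
      qed (use a(2) in simp)
      moreover have "restrict (fst \<circ> x) V = refl_assign V t" using a(2) by (auto simp: refl_assign_def)
      ultimately show "x \<in> ?X" by simp
    next
      fix x assume x: "x \<in> ?X"
      then have xh: "x \<in> cox_homs V E m (wr q N)" by simp
      let ?a = "\<lambda>v\<in>V. snd (x v)"
      have fx: "x v = ((-1, t v), ?a v)" if "v \<in> V" for v
      proof -
        have "restrict (fst \<circ> x) V v = refl_assign V t v" using x by simp
        then show ?thesis using that by (cases "x v") (simp add: refl_assign_def)
      qed
      have av: "?a v \<in> antisym_fun q N (t v)" if "v \<in> V" for v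
        using wr_involution_iff[OF q0 N(2) tv[OF that], of "?a v"] cox_homsD(1,3)[OF xh that] fx[OF that] by simp
      have mem: "?a \<in> wr_family V E m q N t"
        unfolding wr_family_def
      proof (intro CollectI conjI ballI impI allI)
        show "?a \<in> PiE V (\<lambda>v. antisym_fun q N (t v))" using av by auto
        fix v w i assume vw: "v \<in> V" "w \<in> V" "{v, w} \<in> E" "t v = t w"
        have "(((-1, t v), ?a v) \<otimes>\<^bsub>wr q N\<^esub> ((-1, t w), ?a w)) [^]\<^bsub>wr q N\<^esub> m {v, w} = \<one>\<^bsub>wr q N\<^esub>"
          using cox_homsD(4)[OF xh vw(1-3)] by (simp only: fx[OF vw(1)] fx[OF vw(2)])
        then show "N dvd int (m {v, w}) * (?a v i - ?a w i)"
          using wr_refl_pow_iff[OF q N tv[OF vw(1)] tv[OF vw(2)] av[OF vw(1)] av[OF vw(2)], of "m {v, w}"] vw(4) by blast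
      qed
      have "x = ?f ?a"
      proof
        fix v show "x v = ?f ?a v" using fx[of v] cox_homsD(2)[OF xh, of v] by (cases "v \<in> V") auto
      qed
      then show "x \<in> ?f ` wr_family V E m q N t" by (rule image_eqI[where f = ?f, OF _ mem])
    qed
  qed
  then show ?thesis by (rule bij_betw_same_card[symmetric])
qed

lemma finite_antisym_fun: "q > 0 \<Longrightarrow> finite (antisym_fun q N t)"
  using finite_pfun[of q N] by (rule rev_finite_subset) (auto simp: antisym_fun_def)

lemma finite_wr_family: "finite V \<Longrightarrow> q > 0 \<Longrightarrow> finite (wr_family V E m q N t)"
  unfolding wr_family_def by (rule finite_subset[of _ "PiE V (\<lambda>v. antisym_fun q N (t v))"])
    (auto intro!: finite_PiE finite_antisym_fun)

text \<open>Translating the argument by \<open>s\<close> moves the centre of antisymmetry, which is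
  half of \<open>t\<close>, by \<open>s\<close>.\<close>

lemma antisym_fun_shift:
  assumes "a \<in> antisym_fun q N t" "q dvd t' - (t + 2 * s)"
  shows "(\<lambda>i. a (i - s)) \<in> antisym_fun q N t'"
proof -
  have pa: "a \<in> pfun q N" using assms(1) by (simp add: antisym_fun_def)
  have "N dvd a (t' - i - s) + a (i - s)" for i
  proof -
    have "a (t' - i - s) = a (t - (i - s))"
      by (rule pfun_cong[OF pa]) (use assms(2) in \<open>simp add: algebra_simps\<close>)
    then show ?thesis using assms(1) by (simp add: antisym_fun_def)
  qed
  moreover have "a (i + q - s) = a (i - s)" for i by (rule pfun_cong[OF pa]) simp
  ultimately show ?thesis using pa by (simp add: antisym_fun_def pfun_def)
qed

lemma card_antisym_fun:
  assumes "odd q" "q > 0"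
  shows "card (antisym_fun q N t) = card (antisym_fun q N 0)"
proof -
  obtain k where k: "q = 2 * k + 1" using assms(1) by (auto elim: oddE)
  \<comment> \<open>Half of \<open>t\<close> modulo \<open>q\<close>, since twice
    \<open>k + 1\<close> is \<open>q + 1\<close>.\<close>
  let ?s = "t * (k + 1)"
  have "t - (0 + 2 * ?s) = q * (- t)" "0 - (t + 2 * (- ?s)) = q * t"
    using k by (simp_all add: algebra_simps)
  then have e: "q dvd t - (0 + 2 * ?s)" "q dvd 0 - (t + 2 * (- ?s))" by (metis dvd_triv_left)+
  have "bij_betw (\<lambda>a i. a (i - ?s)) (antisym_fun q N 0) (antisym_fun q N t)"
    by (rule bij_betwI[of _ _ _ "\<lambda>a i. a (i - (- ?s))"]) (use antisym_fun_shift[OF _ e(1)] antisym_fun_shift[OF _ e(2)] in auto)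
  then show ?thesis by (rule bij_betw_same_card[symmetric])
qed

text \<open>A test function that is odd about 0: value 1 at 1 and its negative modulo
  \<open>N\<close> at -1.\<close>

definition antisym_delta :: "int \<Rightarrow> int \<Rightarrow> int \<Rightarrow> int" where
  "antisym_delta q N i = (if q dvd i - 1 then 1 else if q dvd i + 1 then N - 1 else 0)"

lemma antisym_delta_in:
  assumes "q > 2" "N > 1"
  shows "antisym_delta q N \<in> antisym_fun q N 0" "antisym_delta q N 1 = 1"
proof -
  have per: "q dvd i + q - 1 \<longleftrightarrow> q dvd i - 1" "q dvd i + q + 1 \<longleftrightarrow> q dvd i + 1" for i
    by (metis add_diff_eq add.commute dvd_add_triv_left_iff) (metis add.assoc add.commute dvd_add_triv_left_iff)
  have "0 - i - 1 = - (i + 1)" "0 - i + 1 = - (i - 1)" for i :: int by simp_all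
  then have neg: "q dvd 0 - i - 1 \<longleftrightarrow> q dvd i + 1" "q dvd 0 - i + 1 \<longleftrightarrow> q dvd i - 1" for i
    by (simp_all only: dvd_minus_iff)
  have excl: "\<not> (q dvd i - 1 \<and> q dvd i + 1)" for i
  proof
    assume "q dvd i - 1 \<and> q dvd i + 1"
    then have "q dvd (i + 1) - (i - 1)" by (metis dvd_diff)
    moreover have "(i + 1) - (i - 1) = 2" by simp
    ultimately have "q dvd 2" by (simp only:)
    then show False using assms(1) zdvd_imp_le[of q 2] by simp
  qed
  have "N dvd antisym_delta q N (0 - i) + antisym_delta q N i" for i
    unfolding antisym_delta_def neg using excl[of i] by auto
  then show "antisym_delta q N \<in> antisym_fun q N 0"
    using assms by (auto simp: antisym_fun_def pfun_def antisym_delta_def per)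
  show "antisym_delta q N 1 = 1" by (simp add: antisym_delta_def)
qed

definition colour_family :: "'a set \<Rightarrow> 'a set set \<Rightarrow> int \<Rightarrow> int \<Rightarrow> ('a \<Rightarrow> int) \<Rightarrow> ('a \<Rightarrow> int \<Rightarrow> int) set" where
  "colour_family U F q N t = {a \<in> PiE U (\<lambda>u. antisym_fun q N (t u)). \<forall>u\<in>U. \<forall>v\<in>U. {u, v} \<in> F \<longrightarrow> t u = t v \<longrightarrow> a u = a v}"

text \<open>A monochromatic edge excludes the assignment with a bump at one end and zero elsewhere.
  The family therefore fills the whole product exactly over proper colourings.\<close>

lemma card_colour_family:
  assumes U: "finite U" and q: "odd q" "q > 2" and N: "N > 1" and F: "\<forall>u v. {u, v} \<in> F \<longrightarrow> u \<noteq> v"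
  shows "card (colour_family U F q N t) = card (antisym_fun q N 0) ^ card U \<longleftrightarrow>
    (\<forall>u\<in>U. \<forall>v\<in>U. {u, v} \<in> F \<longrightarrow> t u \<noteq> t v)"
proof -
  have q0: "q > 0" using q by simp
  let ?A = "\<lambda>u. antisym_fun q N (t u)"
  have cP: "card (PiE U ?A) = card (antisym_fun q N 0) ^ card U"
  proof -
    have "card (PiE U ?A) = (\<Prod>u\<in>U. card (antisym_fun q N (t u)))" using U by (rule card_PiE)
    also have "\<dots> = (\<Prod>u\<in>U. card (antisym_fun q N 0))" by (intro prod.cong refl card_antisym_fun[OF q(1) q0])
    finally show ?thesis by simp
  qed
  have fin: "finite (PiE U ?A)" using U q0 by (intro finite_PiE finite_antisym_fun)
  have sub: "colour_family U F q N t \<subseteq> PiE U ?A" by (auto simp: colour_family_def)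
  have zero: "(\<lambda>_. 0) \<in> antisym_fun q N s" for s using N by (simp add: antisym_fun_def pfun_def)
  show ?thesis
  proof
    assume "card (colour_family U F q N t) = card (antisym_fun q N 0) ^ card U"
    then have eq: "colour_family U F q N t = PiE U ?A"
      using card_subset_eq[OF fin sub] cP by simp
    show "\<forall>u\<in>U. \<forall>v\<in>U. {u, v} \<in> F \<longrightarrow> t u \<noteq> t v"
    proof (intro ballI impI notI)
      fix u v assume uv: "u \<in> U" "v \<in> U" "{u, v} \<in> F" "t u = t v"
      obtain k where k: "q = 2 * k + 1" using q(1) by (auto elim: oddE)
      let ?s = "t u * (k + 1)"
      have "t u - (0 + 2 * ?s) = q * (- t u)" using k by (simp add: algebra_simps)
      then have "q dvd t u - (0 + 2 * ?s)" by (metis dvd_triv_left)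
      from antisym_fun_shift[OF antisym_delta_in(1)[OF q(2) N] this]
      have b0: "(\<lambda>i. antisym_delta q N (i - ?s)) \<in> antisym_fun q N (t u)" .
      define b where "b = (\<lambda>i. antisym_delta q N (i - ?s))"
      have b: "b \<in> antisym_fun q N (t u)" "b (1 + ?s) = 1"
        using b0 antisym_delta_in(2)[OF q(2) N] by (simp_all add: b_def)
      define f where "f = (\<lambda>x\<in>U. if x = u then b else (\<lambda>_. 0))"
      have "f \<in> PiE U ?A" using b zero by (auto simp: f_def)
      then have "f \<in> colour_family U F q N t" by (simp only: eq)
      then have "f u = f v" using uv unfolding colour_family_def by blast
      then have "b = (\<lambda>_. 0)" using uv F[rule_format, OF uv(3)] by (simp add: f_def)
      then show False using b(2) by simp
    qed
  next
    assume "\<forall>u\<in>U. \<forall>v\<in>U. {u, v} \<in> F \<longrightarrow> t u \<noteq> t v"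
    then have "colour_family U F q N t = PiE U ?A" by (auto simp: colour_family_def)
    then show "card (colour_family U F q N t) = card (antisym_fun q N 0) ^ card U" by (simp add: cP)
  qed
qed

text \<open>The bijection \<open>g\<close> comes from the dihedral quotient alone and so is the same
  for all moduli \<open>N\<close>; different moduli can be tested over corresponding
  positions.\<close>

lemma wr_family_transfer:
  assumes w: "pc_iso_witness V' E' m' V E m \<phi>" and q: "prime q" "odd q"
    and fin: "finite V" "finite V'" and c: "card (cox_homs V E m (dih 1)) = 2" "card (cox_homs V' E' m' (dih 1)) = 2"
  shows "\<exists>g. bij_betw g (refl_params V E m q) (refl_params V' E' m' q) \<and>
    (\<forall>t \<in> refl_params V E m q. \<forall>N. odd N \<longrightarrow> N > 0 \<longrightarrow>
       card (wr_family V' E' m' q N (g t)) = card (wr_family V E m q N t))"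
proof -
  have q0: "q > 0" using q(1) by (simp add: prime_gt_0_int)
  let ?T = "cox_transfer V' E' m' V E m \<phi> (dih q)"
  let ?R' = "refl_assign V'" and ?P' = "refl_params V' E' m' q"
  let ?g = "\<lambda>t. inv_into ?P' ?R' (?T (refl_assign V t))"
  note b1 = bij_betw_refl_homs[OF q0, of V E m] and b2 = bij_betw_refl_homs[OF q0, of V' E' m']
  note bT = cox_transfer_refl_homs[OF w q(2) q0 fin c]
  have "bij_betw (inv_into ?P' ?R' \<circ> (?T \<circ> refl_assign V)) (refl_params V E m q) ?P'"
    by (rule bij_betw_trans[OF bij_betw_trans[OF b1 bT] bij_betw_inv_into[OF b2]])
  then have bij: "bij_betw ?g (refl_params V E m q) ?P'" by (simp add: comp_def)
  have "card (wr_family V' E' m' q N (?g t)) = card (wr_family V E m q N t)"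
    if t: "t \<in> refl_params V E m q" and N: "odd N" "N > 0" for t N
  proof -
    have gt: "?g t \<in> ?P'" using bij t by (auto simp: bij_betw_def)
    have Rt: "refl_assign V t \<in> refl_homs V E m q" using b1 t by (auto simp: bij_betw_def)
    then have "?T (refl_assign V t) \<in> refl_homs V' E' m' q" using bT by (auto simp: bij_betw_def)
    then have Rg: "?R' (?g t) = ?T (refl_assign V t)" using b2 by (simp add: bij_betw_inv_into_right)
    have y: "refl_assign V t \<in> cox_homs V E m (dih q)" using Rt by (simp add: refl_homs_def)
    have "card (wr_family V' E' m' q N (?g t)) = card {x \<in> cox_homs V' E' m' (wr q N). restrict (fst \<circ> x) V' = ?R' (?g t)}"
      by (rule card_wr_fibre[OF q(1) N gt, symmetric])
    also have "\<dots> = card {x \<in> cox_homs V' E' m' (wr q N). restrict (fst \<circ> x) V' = ?T (refl_assign V t)}"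
      by (simp only: Rg)
    also have "\<dots> = card {x \<in> cox_homs V E m (wr q N). restrict (fst \<circ> x) V = refl_assign V t}"
      by (rule cox_transfer_fibre[OF w group_wr[OF q0 N(2)] finite_wr[OF q0] group_dih[OF q0] finite_dih wr_fst_hom y])
    also have "\<dots> = card (wr_family V E m q N t)" by (rule card_wr_fibre[OF q(1) N t])
    finally show ?thesis .
  qed
  with bij show ?thesis by (intro exI[of _ ?g]) simp
qed

section \<open>Labels and colourings of the quotient graph\<close>

definition proper_colourings :: "'a set \<Rightarrow> 'a set set \<Rightarrow> int \<Rightarrow> ('a \<Rightarrow> int) set" where
  "proper_colourings V E q = {t \<in> V \<rightarrow>\<^sub>E {0..<q}. \<forall>v\<in>V. \<forall>w\<in>V. {v, w} \<in> E \<longrightarrow> t v \<noteq> t w}"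

definition quotient_edges :: "'a set \<Rightarrow> 'a set set \<Rightarrow> ('a \<Rightarrow> 'c) \<Rightarrow> 'c set set" where
  "quotient_edges V E pr = {{pr v, pr w} |v w. v \<in> V \<and> w \<in> V \<and> {v, w} \<in> E \<and> pr v \<noteq> pr w}"

lemma quotient_edges_iff:
  assumes "\<forall>v w. {v, w} \<in> E \<longrightarrow> v \<in> V \<and> w \<in> V"
  shows "{a, b} \<in> quotient_edges V E pr \<longleftrightarrow> (\<exists>v w. {v, w} \<in> E \<and> pr v = a \<and> pr w = b \<and> a \<noteq> b)"
proof
  assume "{a, b} \<in> quotient_edges V E pr"
  then obtain v w where vw: "{v, w} \<in> E" "pr v \<noteq> pr w" "{a, b} = {pr v, pr w}" by (auto simp: quotient_edges_def)
  then show "\<exists>v w. {v, w} \<in> E \<and> pr v = a \<and> pr w = b \<and> a \<noteq> b"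
    by (auto simp: doubleton_eq_iff) (metis insert_commute)+
next
  assume "\<exists>v w. {v, w} \<in> E \<and> pr v = a \<and> pr w = b \<and> a \<noteq> b"
  then show "{a, b} \<in> quotient_edges V E pr" using assms unfolding quotient_edges_def by blast
qed

text \<open>Comparing the colourings 0 and twice the indicator of a class C, the fibres over which
  have the same size, shows that the cross edges impose no condition.\<close>

lemma cross_label_divisible:
  fixes pr :: "'b \<Rightarrow> 'c"
  assumes G': "coxeter_graph V' E' m'" and q: "prime q" "odd q" and n: "odd n" "n > 1"
    and edge: "\<forall>v w. {v, w} \<in> E' \<longrightarrow> pr v = pr w \<or> q dvd int (m' {v, w})"
    and eq: "\<forall>t \<in> refl_params V' E' m' q. card (wr_family V' E' m' q n t) = K"
    and vw: "{v, w} \<in> E'" "pr v \<noteq> pr w"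
  shows "n dvd int (m' {v, w})"
proof -
  have q0: "q > 2" using q prime_ge_2_int[OF q(1)] by (cases "q = 2") auto
  have n0: "n > 0" using n by simp
  have V: "v \<in> V'" "w \<in> V'" using coxeter_graph_edgeD[OF G' vw(1)] by auto
  have finV: "finite V'" using G' by (simp add: coxeter_graph_def)
  define C where "C = {x. pr x = pr v}"
  have vC: "v \<in> C" "w \<notin> C" using vw by (auto simp: C_def)
  \<comment> \<open>The value 2 is the effect on the position of shifting the argument by 1; it is a
    residue different from 0 because \<open>q > 2\<close>.\<close>
  define t where "t = (\<lambda>x\<in>V'. if x \<in> C then 2 else 0 :: int)"
  let ?o = "\<lambda>x\<in>V'. 0 :: int"
  let ?S0 = "wr_family V' E' m' q n ?o" and ?S1 = "wr_family V' E' m' q n t"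
  have C_edge: "x \<in> C \<longleftrightarrow> y \<in> C" if "{x, y} \<in> E'" "\<not> q dvd int (m' {x, y})" for x y
    using edge[rule_format, OF that(1)] that(2) by (auto simp: C_def)
  have "?o \<in> refl_params V' E' m' q" using q0 by (auto simp: refl_params_def)
  moreover have "t \<in> refl_params V' E' m' q"
    unfolding refl_params_def
  proof (intro CollectI conjI ballI impI)
    show "t \<in> V' \<rightarrow>\<^sub>E {0..<q}" using q0 by (auto simp: t_def)
    fix x y assume xy: "x \<in> V'" "y \<in> V'" "{x, y} \<in> E'"
    show "q dvd int (m' {x, y}) * (t x - t y)"
    proof (cases "q dvd int (m' {x, y})")
      case False
      then have "t x = t y" using C_edge[OF xy(3)] xy by (simp add: t_def)
      then show ?thesis by simp
    qed simp
  qed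
  ultimately have cards: "card ?S0 = card ?S1" by (simp add: eq)
  have fin: "finite ?S0" "finite ?S1" using finV q0 by (auto intro: finite_wr_family)
  let ?f = "\<lambda>a. \<lambda>x\<in>V'. if x \<in> C then (\<lambda>i. a x (i - 1)) else a x"
  have A: "a x \<in> antisym_fun q n 0" if "a \<in> ?S0" "x \<in> V'" for a x
    using that by (auto simp: wr_family_def PiE_def Pi_def)
  have shift: "(\<lambda>i. b (i - 1)) \<in> antisym_fun q n 2" if "b \<in> antisym_fun q n 0" for b
    using antisym_fun_shift[OF that, of 2 1] by simp
  have f01: "?f a \<in> ?S1" if a: "a \<in> ?S0" for a
    unfolding wr_family_def
  proof (intro CollectI conjI ballI impI allI)
    show "?f a \<in> PiE V' (\<lambda>v. antisym_fun q n (t v))" using A[OF a] shift by (auto simp: t_def)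
    fix x y i assume xy: "x \<in> V'" "y \<in> V'" "{x, y} \<in> E'" "t x = t y"
    have *: "n dvd int (m' {x, y}) * (a x j - a y j)" for j
      using a xy by (auto simp: wr_family_def)
    have "x \<in> C \<longleftrightarrow> y \<in> C" using xy by (auto simp: t_def split: if_splits)
    then show "n dvd int (m' {x, y}) * (?f a x i - ?f a y i)" using xy *[of i] *[of "i - 1"] by auto
  qed
  have inj: "inj_on ?f ?S0"
  proof (rule inj_onI)
    fix a b assume ab: "a \<in> ?S0" "b \<in> ?S0" "?f a = ?f b"
    then have "a \<in> PiE V' (\<lambda>v. antisym_fun q n (?o v))" "b \<in> PiE V' (\<lambda>v. antisym_fun q n (?o v))"
      by (auto simp: wr_family_def)
    then show "a = b"
    proof (rule PiE_ext)
      fix x assume x: "x \<in> V'"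
      show "a x = b x"
      proof
        fix i
        show "a x i = b x i"
          using fun_cong[OF fun_cong[OF ab(3), of x], of "if x \<in> C then i + 1 else i"] x by (auto split: if_splits)
      qed
    qed
  qed
  have onto: "?f ` ?S0 = ?S1"
    using fin f01 card_image[OF inj] cards by (intro card_subset_eq) auto
  let ?d = "antisym_delta q n"
  note d = antisym_delta_in[OF q0 n(2)]
  have zero: "(\<lambda>_. 0) \<in> antisym_fun q n 0" using n0 by (simp add: antisym_fun_def pfun_def)
  \<comment> \<open>A bump on \<open>C\<close> and zero outside is admissible over \<open>t\<close>,
    where no cross edge is monochromatic. Its preimage lies over 0, where the edge from
    \<open>v\<close> to \<open>w\<close> is monochromatic and the base components differ by 1 at the
    index 1.\<close>
  define b where "b = (\<lambda>x\<in>V'. if x \<in> C then (\<lambda>i. ?d (i - 1)) else (\<lambda>_. 0))"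
  have "b \<in> ?S1"
    unfolding wr_family_def
  proof (intro CollectI conjI ballI impI allI)
    show "b \<in> PiE V' (\<lambda>v. antisym_fun q n (t v))" using shift[OF d(1)] zero by (auto simp: b_def t_def)
    fix x y i assume xy: "x \<in> V'" "y \<in> V'" "{x, y} \<in> E'" "t x = t y"
    then have "x \<in> C \<longleftrightarrow> y \<in> C" by (auto simp: t_def split: if_splits)
    then show "n dvd int (m' {x, y}) * (b x i - b y i)" using xy by (auto simp: b_def)
  qed
  then have "b \<in> ?f ` ?S0" by (simp only: onto)
  then obtain a where a: "b = ?f a" "a \<in> ?S0" by (rule imageE)
  have "b v 2 = 1" "b w 1 = 0" using V vC d(2) by (simp_all add: b_def)
  then have "a v 1 = 1" "a w 1 = 0" using V vC by (simp_all add: a(1))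
  moreover have "n dvd int (m' {v, w}) * (a v 1 - a w 1)" using a(2) V vw(1) by (auto simp: wr_family_def)
  ultimately show ?thesis by simp
qed

lemma dvd_mult_diff_eq_iff:
  assumes "prime (l::int)" "\<not> l dvd k" "x \<in> {0..<l}" "y \<in> {0..<l}"
  shows "l dvd k * (x - y) \<longleftrightarrow> x = y"
  using assms by (simp add: prime_dvd_mult_iff residue_dvd_diff_iff)

lemma antisym_fun_range: "a \<in> antisym_fun q N t \<Longrightarrow> a i \<in> {0..<N}"
  by (simp add: antisym_fun_def pfun_def)

text \<open>A prime modulus that divides no label lets every label be cancelled, leaving plain
  equality along monochromatic edges.\<close>

lemma wr_family_prime:
  assumes l: "prime l" and m: "\<forall>e\<in>E. \<not> l dvd int (m e)"
  shows "wr_family V E m q l t = colour_family V E q l t"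
proof -
  have "(\<forall>i. l dvd int (m {v, w}) * (a v i - a w i)) \<longleftrightarrow> a v = a w"
    if "a \<in> PiE V (\<lambda>v. antisym_fun q l (t v))" "v \<in> V" "w \<in> V" "{v, w} \<in> E" for a v w
  proof -
    have "a v \<in> antisym_fun q l (t v)" "a w \<in> antisym_fun q l (t w)" using that by (auto simp: PiE_def Pi_def)
    then have "l dvd int (m {v, w}) * (a v i - a w i) \<longleftrightarrow> a v i = a w i" for i
      using m[rule_format, OF that(4)] by (intro dvd_mult_diff_eq_iff[OF l]) (auto dest: antisym_fun_range)
    then show ?thesis by (auto simp: fun_eq_iff)
  qed
  then show ?thesis unfolding wr_family_def colour_family_def by blast
qed

text \<open>Edges in \<open>E0\<close> join vertices of one class, hence of one colour, so every
  member of the family is constant on classes and descends to the quotient.\<close>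

lemma bij_betw_colour_family:
  fixes E0 :: "'a set set"
  assumes E: "\<forall>v w. {v, w} \<in> E \<longrightarrow> v \<in> V \<and> w \<in> V" and E0: "E0 \<subseteq> E" and c: "c \<in> comp_of E0 ` V \<rightarrow>\<^sub>E S"
  defines "pr \<equiv> comp_of E0"
  shows "bij_betw (\<lambda>y. \<lambda>v\<in>V. y (pr v)) (colour_family (pr ` V) (quotient_edges V E pr) q N c)
     (colour_family V E q N (\<lambda>v\<in>V. c (pr v)))"
proof -
  have E0V: "\<forall>v w. {v, w} \<in> E0 \<longrightarrow> v \<in> V \<and> w \<in> V" using E E0 by blast
  note bij = bij_betw_comp_functions[of E0 V UNIV, OF E0V, folded pr_def]
  let ?f = "\<lambda>y. \<lambda>v\<in>V. y (pr v)"
  let ?X = "colour_family (pr ` V) (quotient_edges V E pr) q N c" and ?Y = "colour_family V E q N (\<lambda>v\<in>V. c (pr v))"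
  have ext: "y \<in> PiE (pr ` V) (\<lambda>_. UNIV)" if "y \<in> ?X" for y
    using that by (auto simp: colour_family_def PiE_def)
  show ?thesis
  proof (rule bij_betw_imageI)
    show "inj_on ?f ?X"
      using bij ext unfolding bij_betw_def by (auto intro: inj_on_subset)
    show "?f ` ?X = ?Y"
    proof (intro equalityI subsetI)
      fix a assume "a \<in> ?f ` ?X"
      then obtain y where y: "y \<in> ?X" "a = ?f y" by auto
      have yP: "y (pr v) \<in> antisym_fun q N (c (pr v))" if "v \<in> V" for v
        using y(1) that by (auto simp: colour_family_def PiE_def Pi_def)
      have ye: "y u = y u'" if "u \<in> pr ` V" "u' \<in> pr ` V" "{u, u'} \<in> quotient_edges V E pr" "c u = c u'" for u u'
        using y(1) that unfolding colour_family_def by blast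
      have "a v = a w" if vw: "v \<in> V" "w \<in> V" "{v, w} \<in> E" "(\<lambda>v\<in>V. c (pr v)) v = (\<lambda>v\<in>V. c (pr v)) w" for v w
      proof (cases "pr v = pr w")
        case False
        then have "{pr v, pr w} \<in> quotient_edges V E pr" using vw unfolding quotient_edges_def by blast
        then show ?thesis using ye[of "pr v" "pr w"] vw by (simp add: y(2))
      qed (use vw in \<open>simp add: y(2)\<close>)
      then show "a \<in> ?Y" using yP unfolding colour_family_def by (auto simp: y(2))
    next
      fix a assume a: "a \<in> ?Y"
      have ae: "a v = a w" if "v \<in> V" "w \<in> V" "{v, w} \<in> E" "c (pr v) = c (pr w)" for v w
        using a that unfolding colour_family_def by simp
      have aP: "a v \<in> antisym_fun q N (c (pr v))" if "v \<in> V" for v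
        using a that by (auto simp: colour_family_def PiE_def Pi_def)
      have const: "\<forall>v w. {v, w} \<in> E0 \<longrightarrow> a v = a w"
      proof (intro allI impI)
        fix v w assume vw: "{v, w} \<in> E0"
        then have "pr v = pr w" unfolding pr_def by (rule comp_of_edge)
        then show "a v = a w" using ae[of v w] vw E0 E0V by auto
      qed
      have "a \<in> {f \<in> V \<rightarrow>\<^sub>E UNIV. \<forall>v w. {v, w} \<in> E0 \<longrightarrow> f v = f w}"
        using a const by (auto simp: colour_family_def PiE_def)
      then have "a \<in> ?f ` PiE (pr ` V) (\<lambda>_. UNIV)" by (simp only: bij_betw_imp_surj_on[OF bij])
      then obtain y where y: "a = ?f y" "y \<in> PiE (pr ` V) (\<lambda>_. UNIV)" by (rule imageE)
      have yv: "y (pr v) = a v" if "v \<in> V" for v using that by (simp add: y(1))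
      have "y \<in> ?X"
        unfolding colour_family_def
      proof (intro CollectI conjI ballI impI)
        show "y \<in> PiE (pr ` V) (\<lambda>u. antisym_fun q N (c u))"
          using y(2) aP yv by (auto simp: PiE_def Pi_def)
        fix u u' assume "{u, u'} \<in> quotient_edges V E pr" "c u = c u'"
        then obtain v w where vw: "{v, w} \<in> E" "pr v = u" "pr w = u'"
          using quotient_edges_iff[OF E, of u u' pr] by auto
        then have "v \<in> V" "w \<in> V" using E by auto
        then show "y u = y u'" using ae[of v w] vw yv \<open>c u = c u'\<close> by auto
      qed
      with y(1) show "a \<in> ?f ` ?X" by (rule image_eqI)
    qed
  qed
qed

section \<open>Sign homomorphisms and connectedness\<close>

lemma card_sign_homs_odd_connected:
  assumes "finite V" "V \<noteq> {}" "graph_connected V E" and m: "\<And>e. e \<in> E \<Longrightarrow> odd (m e)"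
    and E: "\<And>v w. {v, w} \<in> E \<Longrightarrow> v \<in> V \<and> w \<in> V"
  shows "card (cox_homs V E m (dih 1)) = 2"
proof -
  obtain u where u: "u \<in> V" using assms(2) by auto
  have p: "(\<lambda>v\<in>V. 0) \<in> V \<rightarrow>\<^sub>E {0..<1::int}" by auto
  have r: "refl_assign V (\<lambda>v\<in>V. 0) \<in> cox_homs V E m (dih 1)"
    using refl_assign_in_homs_iff[OF _ p, of E m] p by (simp add: refl_params_def)
  have t: "trivial_assign V \<in> cox_homs V E m (dih 1)" by (rule trivial_assign_in_homs) simp
  have "x = trivial_assign V \<or> x = refl_assign V (\<lambda>v\<in>V. 0)" if x: "x \<in> cox_homs V E m (dih 1)" for x
  proof -
    have c: "x v \<in> {(1, 0), (-1, 0)}" if "v \<in> V" for v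
      using cox_homsD(1)[OF x that] by (cases "x v") (auto simp: dih_simps(1))
    have "x v = x w" if vw: "{v, w} \<in> E" for v w
    proof -
      have V: "v \<in> V" "w \<in> V" using E[OF vw] by auto
      have "(x v \<otimes>\<^bsub>dih 1\<^esub> x w) [^]\<^bsub>dih 1\<^esub> m {v, w} = \<one>\<^bsub>dih 1\<^esub>" using cox_homsD(4)[OF x V vw] .
      then have "(fst (x v) * fst (x w)) ^ m {v, w} = 1"
        by (metis dih_sign_pow dih_fst_mult dih_simps(3) fst_conv)
      then show ?thesis using c[OF V(1)] c[OF V(2)] m[OF vw] by auto
    qed
    then have const: "x v = x u" if "v \<in> V" for v
    proof -
      have "(\<lambda>x y. {x, y} \<in> E)\<^sup>*\<^sup>* u v" using assms(3) u that by (simp add: graph_connected_def)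
      then have "x u = x v" by induction (use \<open>\<And>v w. {v, w} \<in> E \<Longrightarrow> x v = x w\<close> in auto)
      then show ?thesis ..
    qed
    from c[OF u] consider "x u = (1, 0)" | "x u = (-1, 0)" by auto
    then show ?thesis
    proof cases
      case 1
      then have "x = trivial_assign V" using const cox_homsD(2)[OF x] by (auto simp: trivial_assign_def fun_eq_iff)
      then show ?thesis ..
    next
      case 2
      then have "x = refl_assign V (\<lambda>v\<in>V. 0)" using const cox_homsD(2)[OF x] by (auto simp: refl_assign_def fun_eq_iff)
      then show ?thesis ..
    qed
  qed
  then have "cox_homs V E m (dih 1) = {trivial_assign V, refl_assign V (\<lambda>v\<in>V. 0)}" using r t by auto
  moreover have "trivial_assign V u \<noteq> refl_assign V (\<lambda>v\<in>V. 0) u" using u by (simp add: trivial_assign_def refl_assign_def)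
  then have "trivial_assign V \<noteq> refl_assign V (\<lambda>v\<in>V. 0)" by metis
  ultimately show ?thesis by simp
qed

text \<open>Giving sign 1 to one component of the quotient and -1 to the rest would respect all
  relations and mix the signs, which a count of two forbids.\<close>

lemma quotient_connected:
  assumes V: "finite V'" and c: "card (cox_homs V' E' m' (dih 1)) = 2"
  shows "graph_connected (pr ` V') (quotient_edges V' E' pr)"
proof (rule ccontr)
  let ?F = "quotient_edges V' E' pr"
  assume "\<not> graph_connected (pr ` V') ?F"
  then obtain v w where vw: "v \<in> V'" "w \<in> V'" "\<not> (\<lambda>x y. {x, y} \<in> ?F)\<^sup>*\<^sup>* (pr v) (pr w)"
    by (auto simp: graph_connected_def)
  let ?C = "comp_of ?F (pr v)"
  let ?x = "\<lambda>x\<in>V'. if pr x \<in> ?C then (1, 0) else (-1, 0) :: int \<times> int"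
  have same: "pr x \<in> ?C \<longleftrightarrow> pr y \<in> ?C" if "x \<in> V'" "y \<in> V'" "{x, y} \<in> E'" for x y
  proof (cases "pr x = pr y")
    case False
    then have "{pr x, pr y} \<in> ?F" using that unfolding quotient_edges_def by blast
    then have "comp_of ?F (pr x) = comp_of ?F (pr y)" by (rule comp_of_edge)
    then have "comp_of ?F (pr v) = comp_of ?F (pr x) \<longleftrightarrow> comp_of ?F (pr v) = comp_of ?F (pr y)" by simp
    then show ?thesis unfolding comp_of_eq_iff by (simp add: comp_of_def)
  qed simp
  interpret D: group "dih 1" by (rule group_dih) simp
  have "(1, 0) \<otimes>\<^bsub>dih 1\<^esub> (1, 0) = \<one>\<^bsub>dih 1\<^esub>" "(-1, 0) \<otimes>\<^bsub>dih 1\<^esub> (-1, 0) = \<one>\<^bsub>dih 1\<^esub>" by (simp_all add: dih_simps)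
  then have "?x \<in> cox_homs V' E' m' (dih 1)"
    using same by (intro cox_homsI) (auto simp: dih_simps(1))
  from card_sign_homs_eq_2(2)[OF V c this vw(1,2)]
  have "pr v \<in> ?C \<longleftrightarrow> pr w \<in> ?C" using vw by (auto split: if_splits)
  then show False using vw(3) by (simp add: comp_of_def)
qed

text \<open>For the first group every choice of positions modulo a prime \<open>q\<close> dividing
  \<open>n\<close> is admissible and every fibre for the modulus \<open>n\<close> is full. The first
  fact fixes the number of classes; the second makes all fibres for the second group equally large,
  which is the input to \<open>cross_label_divisible\<close>.\<close>

lemma odd_label_classes:
  fixes V' :: "'b set"
  assumes G: "coxeter_graph V E m" "graph_connected V E" "card V = 4" and n: "n \<ge> 2" "odd n" and mn: "\<And>e. e \<in> E \<Longrightarrow> m e = n"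
    and G': "coxeter_graph V' E' m'" and w: "pc_iso_witness V' E' m' V E m \<phi>"
  shows "\<exists>(pr :: 'b \<Rightarrow> 'b set) q. q \<ge> 3 \<and> card (pr ` V') = 4 \<and>
      (\<forall>v w. {v, w} \<in> E' \<longrightarrow> pr v \<noteq> pr w \<longrightarrow> n dvd m' {v, w}) \<and>
      graph_connected (pr ` V') (quotient_edges V' E' pr) \<and>
      card (proper_colourings (pr ` V') (quotient_edges V' E' pr) q) = card (proper_colourings V E q)"
proof -
  have fin: "finite V" "finite V'" using G(1) G' by (simp_all add: coxeter_graph_def)
  have EV: "v \<in> V \<and> w \<in> V" if "{v, w} \<in> E" for v w using coxeter_graph_edgeD[OF G(1) that] by blast
  have EV': "v \<in> V' \<and> w \<in> V'" if "{v, w} \<in> E'" for v w using coxeter_graph_edgeD[OF G' that] by blast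
  have c: "card (cox_homs V E m (dih 1)) = 2"
    using G(3) mn n(2) by (intro card_sign_homs_odd_connected fin G(2) EV) auto
  have c': "card (cox_homs V' E' m' (dih 1)) = 2"
    using bij_betw_same_card[OF cox_transfer_bij[OF w group_dih finite_dih, of 1]] c by simp
  obtain p :: nat where p: "prime p" "p dvd n" using prime_factor_nat[of n] n(1) by auto
  have "odd p" using p n(2) by (auto dest: dvd_trans)
  define q where "q = int p"
  have q: "prime q" "odd q" "q dvd int n" using p \<open>odd p\<close> by (simp_all add: q_def)
  have q2: "q > 2" using q prime_ge_2_int[OF q(1)] by (cases "q = 2") auto
  \<comment> \<open>The edges whose relation forces equal reflections modulo \<open>q\<close>; on
    all others the relation holds for any two reflections.\<close>
  define E0 where "E0 = {e \<in> E'. \<not> q dvd int (m' e)}"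
  define pr where "pr = comp_of E0"
  let ?F = "quotient_edges V' E' pr"
  obtain g where g: "bij_betw g (refl_params V E m q) (refl_params V' E' m' q)"
    "\<And>t N. t \<in> refl_params V E m q \<Longrightarrow> odd N \<Longrightarrow> N > 0 \<Longrightarrow>
       card (wr_family V' E' m' q N (g t)) = card (wr_family V E m q N t)"
    using wr_family_transfer[OF w q(1,2) fin c c'] by blast
  have P: "refl_params V E m q = V \<rightarrow>\<^sub>E {0..<q}"
    using mn q(3) by (auto simp: refl_params_def)
  have EV'': "\<forall>v w. {v, w} \<in> E' \<longrightarrow> v \<in> V' \<and> w \<in> V'" using EV' by blast
  have edge: "\<forall>v w. {v, w} \<in> E' \<longrightarrow> pr v = pr w \<or> q dvd int (m' {v, w})"
    using comp_of_edge[of _ _ E0] by (auto simp: pr_def E0_def)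
  have P': "refl_params V' E' m' q = {f \<in> V' \<rightarrow>\<^sub>E {0..<q}. \<forall>v w. {v, w} \<in> E0 \<longrightarrow> f v = f w}"
  proof -
    have "q dvd int (m' {v, w}) * (f v - f w) \<longleftrightarrow> ({v, w} \<in> E0 \<longrightarrow> f v = f w)"
      if "f \<in> V' \<rightarrow>\<^sub>E {0..<q}" "v \<in> V'" "w \<in> V'" "{v, w} \<in> E'" for f v w
      using dvd_mult_diff_eq_iff[OF q(1), of "int (m' {v, w})" "f v" "f w"] that PiE_mem[OF that(1)]
      by (cases "q dvd int (m' {v, w})") (auto simp: E0_def)
    moreover have "{v, w} \<in> E' \<and> v \<in> V' \<and> w \<in> V'" if "{v, w} \<in> E0" for v w using that EV' by (auto simp: E0_def)
    ultimately show ?thesis unfolding refl_params_def by blast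
  qed
  have E0V: "\<forall>v w. {v, w} \<in> E0 \<longrightarrow> v \<in> V' \<and> w \<in> V'" using EV' by (auto simp: E0_def)
  note bP' = bij_betw_comp_functions[of E0 V' "{0..<q}", OF E0V, folded P' pr_def]
  have finU: "finite (pr ` V')" using fin by simp
  have "card (refl_params V' E' m' q) = card (PiE (pr ` V') (\<lambda>_. {0..<q}))"
    using bij_betw_same_card[OF bP'] by simp
  moreover have "card (PiE (pr ` V') (\<lambda>_. {0..<q})) = p ^ card (pr ` V')"
    using finU by (simp add: card_PiE q_def)
  moreover have "card (refl_params V E m q) = p ^ 4" using fin G(3) by (simp add: P card_PiE) (simp add: q_def)
  ultimately have "p ^ card (pr ` V') = p ^ 4" using bij_betw_same_card[OF g(1)] by simp
  then have card4: "card (pr ` V') = 4" using prime_gt_1_nat[OF p(1)] power_inject_exp[of p] by blast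
  have nn: "odd (int n)" "int n > 1" using n by auto
  have fam: "wr_family V E m q (int n) t = PiE V (\<lambda>v. antisym_fun q (int n) (t v))" for t
    using mn by (auto simp: wr_family_def)
  have label: "n dvd m' {v, w}" if vw: "{v, w} \<in> E'" "pr v \<noteq> pr w" for v w
  proof -
    have "\<forall>t \<in> refl_params V' E' m' q. card (wr_family V' E' m' q (int n) t) = card (antisym_fun q (int n) 0) ^ 4"
    proof
      fix t assume "t \<in> refl_params V' E' m' q"
      then obtain s where s: "s \<in> refl_params V E m q" "t = g s" using g(1) by (auto simp: bij_betw_def)
      have "card (wr_family V E m q (int n) s) = (\<Prod>v\<in>V. card (antisym_fun q (int n) (s v)))"
        unfolding fam using fin(1) by (rule card_PiE)
      also have "\<dots> = (\<Prod>v\<in>V. card (antisym_fun q (int n) 0))"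
        using q2 q(2) by (intro prod.cong refl card_antisym_fun) auto
      finally show "card (wr_family V' E' m' q (int n) t) = card (antisym_fun q (int n) 0) ^ 4"
        using g(2)[OF s(1) nn(1)] nn(2) s(2) G(3) by simp
    qed
    from cross_label_divisible[OF G' q(1,2) nn edge this vw] show ?thesis by simp
  qed
  have finE': "finite E'"
    using fin(2) EV' G' by (intro finite_subset[of E' "Pow V'"]) (auto simp: coxeter_graph_def)
  \<comment> \<open>Larger than all labels of both graphs, so that \<open>l\<close> divides none of
    them and a monochromatic edge always costs part of the fibre.\<close>
  obtain l0 :: nat where l0: "prime l0" "l0 > n + sum m' E' + 2" using bigger_prime by blast
  define l where "l = int l0"
  have l: "prime l" "odd l" "l > 1" using l0 prime_odd_nat[OF l0(1)] by (simp_all add: l_def)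
  have lm': "\<forall>e\<in>E'. \<not> l dvd int (m' e)"
  proof
    fix e assume that: "e \<in> E'"
    have "m' e \<le> sum m' E'" using that finE' by (intro member_le_sum) auto
    moreover have "m' e \<ge> 2" using that G' by (simp add: coxeter_graph_def)
    ultimately show "\<not> l dvd int (m' e)" using l0(2) by (auto simp: l_def dest: dvd_imp_le)
  qed
  have lm: "\<forall>e\<in>E. \<not> l dvd int (m e)"
    using mn l0(2) n(1) by (auto simp: l_def dest: dvd_imp_le)
  have neqE: "\<forall>u v. {u, v} \<in> E \<longrightarrow> u \<noteq> v" using coxeter_graph_edgeD(3)[OF G(1)] by blast
  have neqF: "\<forall>u v. {u, v} \<in> ?F \<longrightarrow> u \<noteq> v" by (auto simp: quotient_edges_def doubleton_eq_iff)
  \<comment> \<open>The size of a full fibre, the same on both sides: four vertices here, four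
    classes there.\<close>
  let ?K = "card (antisym_fun q l 0) ^ 4"
  have oddq: "odd q" "q > 2" using q q2 by auto
  have A: "card (wr_family V E m q l t) = ?K \<longleftrightarrow> t \<in> proper_colourings V E q" if "t \<in> refl_params V E m q" for t
    using card_colour_family[OF fin(1) oddq l(3) neqE, of t] that
    unfolding wr_family_prime[OF l(1) lm] by (simp add: G(3) P proper_colourings_def)
  have A': "card (wr_family V' E' m' q l (\<lambda>v\<in>V'. y (pr v))) = ?K \<longleftrightarrow> y \<in> proper_colourings (pr ` V') ?F q"
    if y: "y \<in> pr ` V' \<rightarrow>\<^sub>E {0..<q}" for y
  proof -
    have "card (wr_family V' E' m' q l (\<lambda>v\<in>V'. y (pr v))) = card (colour_family (pr ` V') ?F q l y)"
      unfolding wr_family_prime[OF l(1) lm'] pr_def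
      by (rule bij_betw_same_card[symmetric, OF bij_betw_colour_family[OF EV'']]) (use y in \<open>auto simp: E0_def pr_def\<close>)
    then show ?thesis
      using card_colour_family[OF finU oddq l(3) neqF, of y] y by (simp add: card4 proper_colourings_def)
  qed
  have "card (proper_colourings V E q) = card {t \<in> refl_params V E m q. card (wr_family V E m q l t) = ?K}"
    using A by (intro arg_cong[of _ _ card]) (auto simp: P proper_colourings_def)
  also have "\<dots> = card {t \<in> refl_params V' E' m' q. card (wr_family V' E' m' q l t) = ?K}"
  proof (rule bij_betw_same_card[of g])
    show "bij_betw g {t \<in> refl_params V E m q. card (wr_family V E m q l t) = ?K}
        {t \<in> refl_params V' E' m' q. card (wr_family V' E' m' q l t) = ?K}"
      by (rule bij_betw_Collect[OF g(1)]) (use g(2)[OF _ l(2)] l(3) in simp)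
  qed
  also have "\<dots> = card (proper_colourings (pr ` V') ?F q)"
  proof (rule bij_betw_same_card[symmetric, of "\<lambda>y. \<lambda>v\<in>V'. y (pr v)"])
    show "bij_betw (\<lambda>y. \<lambda>v\<in>V'. y (pr v)) (proper_colourings (pr ` V') ?F q)
        {t \<in> refl_params V' E' m' q. card (wr_family V' E' m' q l t) = ?K}"
    proof -
      have "bij_betw (\<lambda>y. \<lambda>v\<in>V'. y (pr v)) {y \<in> pr ` V' \<rightarrow>\<^sub>E {0..<q}. y \<in> proper_colourings (pr ` V') ?F q}
        {t \<in> refl_params V' E' m' q. card (wr_family V' E' m' q l t) = ?K}"
        by (rule bij_betw_Collect[OF bP']) (use A' in auto)
      moreover have "{y \<in> pr ` V' \<rightarrow>\<^sub>E {0..<q}. y \<in> proper_colourings (pr ` V') ?F q} = proper_colourings (pr ` V') ?F q"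
        by (auto simp: proper_colourings_def)
      ultimately show ?thesis by simp
    qed
  qed
  finally have cols: "card (proper_colourings (pr ` V') ?F q) = card (proper_colourings V E q)" ..
  show ?thesis
    using q2 card4 label quotient_connected[OF fin(2) c', of pr] cols by (intro exI[of _ pr] exI[of _ q]) auto
qed

section \<open>Graphs on four vertices\<close>

text \<open>The flags run around the cycle through \<open>a\<close>, \<open>b\<close>,
  \<open>c\<close>, \<open>d\<close> and end with the diagonals \<open>a c\<close> and
  \<open>b d\<close>.\<close>

definition graph4 :: "'a set \<Rightarrow> 'a set set \<Rightarrow> bool \<Rightarrow> bool \<Rightarrow> bool \<Rightarrow> bool \<Rightarrow> bool \<Rightarrow> bool \<Rightarrow> bool" where
  "graph4 V E x1 x2 x3 x4 x5 x6 \<longleftrightarrow> (\<exists>a b c d. V = {a, b, c, d} \<and> distinct [a, b, c, d] \<and>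
     ({a, b} \<in> E) = x1 \<and> ({b, c} \<in> E) = x2 \<and> ({c, d} \<in> E) = x3 \<and>
     ({a, d} \<in> E) = x4 \<and> ({a, c} \<in> E) = x5 \<and> ({b, d} \<in> E) = x6)"

text \<open>A transposition; together with the four-cycle of \<open>graph4_rotate\<close> it
  generates all relabellings.\<close>

lemma graph4_swap: "graph4 V E x1 x2 x3 x4 x5 x6 \<Longrightarrow> graph4 V E x1 x5 x3 x6 x2 x4"
proof -
  assume "graph4 V E x1 x2 x3 x4 x5 x6"
  then obtain a b c d where h: "V = {a, b, c, d}" "distinct [a, b, c, d]"
     "({a, b} \<in> E) = x1" "({b, c} \<in> E) = x2" "({c, d} \<in> E) = x3"
     "({a, d} \<in> E) = x4" "({a, c} \<in> E) = x5" "({b, d} \<in> E) = x6" unfolding graph4_def by blast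
  show ?thesis unfolding graph4_def
    by (rule exI[of _ b], rule exI[of _ a], rule exI[of _ c], rule exI[of _ d]) (use h in \<open>auto simp: insert_commute\<close>)
qed

lemma graph4_rotate: "graph4 V E x1 x2 x3 x4 x5 x6 \<Longrightarrow> graph4 V E x2 x3 x4 x1 x6 x5"
proof -
  assume "graph4 V E x1 x2 x3 x4 x5 x6"
  then obtain a b c d where h: "V = {a, b, c, d}" "distinct [a, b, c, d]"
     "({a, b} \<in> E) = x1" "({b, c} \<in> E) = x2" "({c, d} \<in> E) = x3"
     "({a, d} \<in> E) = x4" "({a, c} \<in> E) = x5" "({b, d} \<in> E) = x6" unfolding graph4_def by blast
  show ?thesis unfolding graph4_def
    by (rule exI[of _ b], rule exI[of _ c], rule exI[of _ d], rule exI[of _ a]) (use h in \<open>auto simp: insert_commute\<close>)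
qed

text \<open>The 24 facts are all relabellings of the given graph, so each of the 64 flag patterns
  meets one of eleven representatives. The 4-cycle is written as complete bipartite between
  \<open>{a, b}\<close> and \<open>{c, d}\<close>, which makes its colourings easy to count.\<close>

lemma graph4_classification:
  assumes "graph4 V E x1 x2 x3 x4 x5 x6"
  shows "graph4 V E False False False False False False \<or>
    graph4 V E True False False False False False \<or>
    graph4 V E True False True False False False \<or>
    graph4 V E True True False False False False \<or>
    graph4 V E True True False False True False \<or>
    graph4 V E True True True False False False \<or>
    graph4 V E True True False False False True \<or>
    graph4 V E False True False True True True \<or>
    graph4 V E True True False False True True \<or>
    graph4 V E True True False True True True \<or>
    graph4 V E True True True True True True"
proof -
  note g0 = assms
  note g1 = graph4_swap[OF g0]
  note g2 = graph4_rotate[OF g0]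
  note g3 = graph4_rotate[OF g1]
  note g4 = graph4_swap[OF g2]
  note g5 = graph4_rotate[OF g2]
  note g6 = graph4_swap[OF g3]
  note g7 = graph4_rotate[OF g3]
  note g8 = graph4_rotate[OF g4]
  note g9 = graph4_swap[OF g5]
  note g10 = graph4_rotate[OF g5]
  note g11 = graph4_rotate[OF g6]
  note g12 = graph4_swap[OF g7]
  note g13 = graph4_rotate[OF g7]
  note g14 = graph4_rotate[OF g8]
  note g15 = graph4_rotate[OF g9]
  note g16 = graph4_rotate[OF g11]
  note g17 = graph4_rotate[OF g12]
  note g18 = graph4_swap[OF g14]
  note g19 = graph4_rotate[OF g14]
  note g20 = graph4_rotate[OF g15]
  note g21 = graph4_swap[OF g16]
  note g22 = graph4_rotate[OF g16]
  note g23 = graph4_rotate[OF g17]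
  show ?thesis
    using g0 g1 g2 g3 g4 g5 g6 g7 g8 g9 g10 g11 g12 g13 g14 g15 g16 g17 g18 g19 g20 g21 g22 g23
    by (cases x1; cases x2; cases x3; cases x4; cases x5; cases x6; simp only: simp_thms)
qed


lemma graph4_iso:
  assumes "graph4 V E x1 x2 x3 x4 x5 x6" "graph4 U F x1 x2 x3 x4 x5 x6"
    and E: "\<forall>v w. {v, w} \<in> E \<longrightarrow> v \<noteq> w" and F: "\<forall>v w. {v, w} \<in> F \<longrightarrow> v \<noteq> w"
  shows "coxeter_group V E (\<lambda>_. n) \<cong> coxeter_group U F (\<lambda>_. n)"
proof -
  obtain a b c d where V: "V = {a, b, c, d}" "distinct [a, b, c, d]"
     "({a, b} \<in> E) = x1" "({b, c} \<in> E) = x2" "({c, d} \<in> E) = x3"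
     "({a, d} \<in> E) = x4" "({a, c} \<in> E) = x5" "({b, d} \<in> E) = x6" using assms(1) unfolding graph4_def by blast
  obtain a' b' c' d' where U: "U = {a', b', c', d'}" "distinct [a', b', c', d']"
     "({a', b'} \<in> F) = x1" "({b', c'} \<in> F) = x2" "({c', d'} \<in> F) = x3"
     "({a', d'} \<in> F) = x4" "({a', c'} \<in> F) = x5" "({b', d'} \<in> F) = x6" using assms(2) unfolding graph4_def by blast
  define f where "f = (\<lambda>x. if x = a then a' else if x = b then b' else if x = c then c' else d')"
  have f: "f a = a'" "f b = b'" "f c = c'" "f d = d'" using V(2) by (auto simp: f_def)
  have EE: "{x} \<notin> E" for x using E[rule_format, of x x] by auto
  have FF: "{x} \<notin> F" for x using F[rule_format, of x x] by auto
  show ?thesis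
  proof (rule coxeter_group_iso_of_bij)
    show "bij_betw f V U"
      using V(2) U(2) unfolding V(1) U(1) bij_betw_def inj_on_def by (auto simp: f)
    fix v w assume "v \<in> V" "w \<in> V"
    then have v: "v = a \<or> v = b \<or> v = c \<or> v = d" and w: "w = a \<or> w = b \<or> w = c \<or> w = d" by (auto simp: V(1))
    show "{v, w} \<in> E \<longleftrightarrow> {f v, f w} \<in> F"
      using v w V(3-) U(3-) by (elim disjE) (simp_all add: f EE FF insert_commute)
  qed simp
qed

section \<open>Counting colourings\<close>

definition colourings :: "'a set \<Rightarrow> 'a set set \<Rightarrow> 'c set \<Rightarrow> ('c \<Rightarrow> 'c \<Rightarrow> bool) \<Rightarrow> ('a \<Rightarrow> 'c) set" where
  "colourings V E S R = {x \<in> V \<rightarrow>\<^sub>E S. \<forall>v\<in>V. \<forall>w\<in>V. {v, w} \<in> E \<longrightarrow> R (x v) (x w)}"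

text \<open>The vertices are coloured one after another, each restricted by its edges to earlier
  ones; symmetry of \<open>R\<close> accounts for edges being unordered.\<close>

lemma card_colourings_graph4:
  assumes "graph4 V E x1 x2 x3 x4 x5 x6" and E: "\<forall>v w. {v, w} \<in> E \<longrightarrow> v \<noteq> w"
    and S: "finite S" and R: "\<And>x y. R x y = R y x"
  shows "card (colourings V E S R) = (\<Sum>i\<in>S. \<Sum>j\<in>{j \<in> S. x1 \<longrightarrow> R i j}. \<Sum>k\<in>{k \<in> S. (x5 \<longrightarrow> R i k) \<and> (x2 \<longrightarrow> R j k)}.
     card {l \<in> S. (x4 \<longrightarrow> R i l) \<and> (x6 \<longrightarrow> R j l) \<and> (x3 \<longrightarrow> R k l)})"
proof -
  obtain a b c d where V: "V = {a, b, c, d}" "distinct [a, b, c, d]"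
     "({a, b} \<in> E) = x1" "({b, c} \<in> E) = x2" "({c, d} \<in> E) = x3"
     "({a, d} \<in> E) = x4" "({a, c} \<in> E) = x5" "({b, d} \<in> E) = x6" using assms(1) unfolding graph4_def by blast
  have EE: "{x} \<notin> E" for x using E[rule_format, of x x] by auto
  let ?D = "SIGMA i:S. SIGMA j:{j \<in> S. x1 \<longrightarrow> R i j}. SIGMA k:{k \<in> S. (x5 \<longrightarrow> R i k) \<and> (x2 \<longrightarrow> R j k)}.
     {l \<in> S. (x4 \<longrightarrow> R i l) \<and> (x6 \<longrightarrow> R j l) \<and> (x3 \<longrightarrow> R k l)}"
  let ?f = "\<lambda>x. (x a, x b, x c, x d)"
  let ?g = "\<lambda>(i, j, k, l). \<lambda>v\<in>V. if v = a then i else if v = b then j else if v = c then k else l"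
  have cond: "(\<forall>v\<in>V. \<forall>w\<in>V. {v, w} \<in> E \<longrightarrow> R (x v) (x w)) \<longleftrightarrow>
      (x1 \<longrightarrow> R (x a) (x b)) \<and> (x2 \<longrightarrow> R (x b) (x c)) \<and> (x3 \<longrightarrow> R (x c) (x d)) \<and>
      (x4 \<longrightarrow> R (x a) (x d)) \<and> (x5 \<longrightarrow> R (x a) (x c)) \<and> (x6 \<longrightarrow> R (x b) (x d))" for x
    unfolding V(1) V(3-)[symmetric] using R by (simp add: EE insert_commute) blast
  have mem: "x \<in> colourings V E S R \<longleftrightarrow> x \<in> V \<rightarrow>\<^sub>E S \<and>
      (x1 \<longrightarrow> R (x a) (x b)) \<and> (x2 \<longrightarrow> R (x b) (x c)) \<and> (x3 \<longrightarrow> R (x c) (x d)) \<and>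
      (x4 \<longrightarrow> R (x a) (x d)) \<and> (x5 \<longrightarrow> R (x a) (x c)) \<and> (x6 \<longrightarrow> R (x b) (x d))" for x
    unfolding colourings_def mem_Collect_eq cond ..
  have ne: "a \<noteq> b" "a \<noteq> c" "a \<noteq> d" "b \<noteq> c" "b \<noteq> d" "c \<noteq> d" "b \<noteq> a" "c \<noteq> a" "d \<noteq> a" "c \<noteq> b" "d \<noteq> b" "d \<noteq> c"
    and inV: "a \<in> V" "b \<in> V" "c \<in> V" "d \<in> V" using V(1,2) by auto
  have gv: "?g (i, j, k, l) a = i" "?g (i, j, k, l) b = j" "?g (i, j, k, l) c = k" "?g (i, j, k, l) d = l" for i j k l
    using ne inV by simp_all
  have "bij_betw ?f (colourings V E S R) ?D"
  proof (rule bij_betwI[of _ _ _ ?g])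
    show "?f \<in> colourings V E S R \<rightarrow> ?D"
    proof
      fix x assume x: "x \<in> colourings V E S R"
      then have "x a \<in> S" "x b \<in> S" "x c \<in> S" "x d \<in> S" using inV PiE_mem[of x V "\<lambda>_. S"] unfolding mem by blast+
      then show "?f x \<in> ?D" using x unfolding mem by simp
    qed
    show "?g \<in> ?D \<rightarrow> colourings V E S R"
    proof
      fix y assume y: "y \<in> ?D"
      obtain i j k l where ijkl: "y = (i, j, k, l)" by (cases y)
      have "?g y \<in> V \<rightarrow>\<^sub>E S" using y by (auto simp: ijkl)
      then show "?g y \<in> colourings V E S R" unfolding mem using y unfolding ijkl gv by simp
    qed
    show "?g (?f x) = x" if x: "x \<in> colourings V E S R" for x
    proof
      fix v show "?g (?f x) v = x v"
        using x ne unfolding mem by (cases "v \<in> V") (auto simp: V(1) PiE_def extensional_def)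
    qed
    show "?f (?g y) = y" if "y \<in> ?D" for y
    proof -
      obtain i j k l where ijkl: "y = (i, j, k, l)" by (cases y)
      show ?thesis unfolding ijkl gv ..
    qed
  qed
  then have "card (colourings V E S R) = card ?D" by (rule bij_betw_same_card)
  also have "\<dots> = (\<Sum>i\<in>S. \<Sum>j\<in>{j \<in> S. x1 \<longrightarrow> R i j}. \<Sum>k\<in>{k \<in> S. (x5 \<longrightarrow> R i k) \<and> (x2 \<longrightarrow> R j k)}.
     card {l \<in> S. (x4 \<longrightarrow> R i l) \<and> (x6 \<longrightarrow> R j l) \<and> (x3 \<longrightarrow> R k l)})"
    using S by (simp add: card_SigmaI finite_SigmaI)
  finally show ?thesis .
qed

lemma card_excluding:
  assumes "finite S" "card S = k + 3"
  shows "i \<in> S \<Longrightarrow> card {l \<in> S. i \<noteq> l} = k + 2"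
    "i \<in> S \<Longrightarrow> j \<in> S \<Longrightarrow> i \<noteq> j \<Longrightarrow> card {l \<in> S. i \<noteq> l \<and> j \<noteq> l} = k + 1"
    "i \<in> S \<Longrightarrow> j \<in> S \<Longrightarrow> h \<in> S \<Longrightarrow> i \<noteq> j \<Longrightarrow> i \<noteq> h \<Longrightarrow> j \<noteq> h \<Longrightarrow> card {l \<in> S. i \<noteq> l \<and> j \<noteq> l \<and> h \<noteq> l} = k"
proof -
  have e1: "{l \<in> S. i \<noteq> l} = S - {i}" for i by auto
  have e2: "{l \<in> S. i \<noteq> l \<and> j \<noteq> l} = S - {i, j}" for i j by auto
  have e3: "{l \<in> S. i \<noteq> l \<and> j \<noteq> l \<and> h \<noteq> l} = S - {i, j, h}" for i j h by auto
  show "i \<in> S \<Longrightarrow> card {l \<in> S. i \<noteq> l} = k + 2" unfolding e1 using assms by simp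
  show "i \<in> S \<Longrightarrow> j \<in> S \<Longrightarrow> i \<noteq> j \<Longrightarrow> card {l \<in> S. i \<noteq> l \<and> j \<noteq> l} = k + 1"
    unfolding e2 using assms by (subst card_Diff_subset) auto
  show "i \<in> S \<Longrightarrow> j \<in> S \<Longrightarrow> h \<in> S \<Longrightarrow> i \<noteq> j \<Longrightarrow> i \<noteq> h \<Longrightarrow> j \<noteq> h \<Longrightarrow> card {l \<in> S. i \<noteq> l \<and> j \<noteq> l \<and> h \<noteq> l} = k"
    unfolding e3 using assms by (subst card_Diff_subset) auto
qed

text \<open>The chromatic polynomials of the connected graphs on four vertices. Writing the number
  of colours as \<open>k + 3\<close> avoids truncated subtraction in the factors.\<close>

lemma card_proper_colourings:
  assumes E: "\<forall>v w. {v, w} \<in> E \<longrightarrow> v \<noteq> w" and q: "q = int k + 3"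
  shows "graph4 V E True True True False False False \<Longrightarrow> card (proper_colourings V E q) = (k + 3) * (k + 2) ^ 3"
    "graph4 V E True True False False False True \<Longrightarrow> card (proper_colourings V E q) = (k + 3) * (k + 2) ^ 3"
    "graph4 V E False True False True True True \<Longrightarrow> card (proper_colourings V E q) = (k + 3) * ((k + 2) ^ 2 + (k + 2) * (k + 1) ^ 2)"
    "graph4 V E True True False False True True \<Longrightarrow> card (proper_colourings V E q) = (k + 3) * (k + 2) ^ 2 * (k + 1)"
    "graph4 V E True True False True True True \<Longrightarrow> card (proper_colourings V E q) = (k + 3) * (k + 2) * (k + 1) ^ 2"
    "graph4 V E True True True True True True \<Longrightarrow> card (proper_colourings V E q) = (k + 3) * (k + 2) * (k + 1) * k"
proof -
  let ?S = "{0..<q}"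
  have S: "finite ?S" "card ?S = k + 3" using q by simp_all
  have eq: "proper_colourings V E q = colourings V E ?S (\<lambda>x y. x \<noteq> y)"
    by (simp add: proper_colourings_def colourings_def)
  have count: "card (proper_colourings V E q) = (\<Sum>i\<in>?S. \<Sum>j\<in>{j \<in> ?S. x1 \<longrightarrow> i \<noteq> j}. \<Sum>k\<in>{k \<in> ?S. (x5 \<longrightarrow> i \<noteq> k) \<and> (x2 \<longrightarrow> j \<noteq> k)}.
     card {l \<in> ?S. (x4 \<longrightarrow> i \<noteq> l) \<and> (x6 \<longrightarrow> j \<noteq> l) \<and> (x3 \<longrightarrow> k \<noteq> l)})"
    if "graph4 V E x1 x2 x3 x4 x5 x6" for x1 x2 x3 x4 x5 x6
    unfolding eq by (rule card_colourings_graph4[OF that E S(1)]) auto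
  note ex = card_excluding[OF S]
  have const: "(\<Sum>j\<in>A. f j) = card A * c" if "\<And>j. j \<in> A \<Longrightarrow> f j = c" for A :: "int set" and f and c :: nat
    using that by simp
  {
    assume g: "graph4 V E True True True False False False"
    show "card (proper_colourings V E q) = (k + 3) * (k + 2) ^ 3"
      unfolding count[OF g] by (simp add: ex S power3_eq_cube del: card_atLeastLessThan_int atLeastLessThan_iff cong: sum.cong_simp)
  next
    assume g: "graph4 V E True True False False False True"
    show "card (proper_colourings V E q) = (k + 3) * (k + 2) ^ 3"
      unfolding count[OF g] by (simp add: ex S power3_eq_cube del: card_atLeastLessThan_int atLeastLessThan_iff cong: sum.cong_simp)
  next
    assume g: "graph4 V E False True False True True True"
    \<comment> \<open>The two vertices \<open>c\<close> and \<open>d\<close> are chosen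
      independently among the colours avoiding both \<open>i\<close> and \<open>j\<close>, hence the
      square. The term with \<open>i = j\<close> is larger and is split off.\<close>
    have inner: "(\<Sum>j\<in>?S. card {l \<in> ?S. i \<noteq> l \<and> j \<noteq> l} * card {l \<in> ?S. i \<noteq> l \<and> j \<noteq> l}) = (k + 2) ^ 2 + (k + 2) * (k + 1) ^ 2"
      if i: "i \<in> ?S" for i
    proof -
      have "(\<Sum>j\<in>?S. card {l \<in> ?S. i \<noteq> l \<and> j \<noteq> l} * card {l \<in> ?S. i \<noteq> l \<and> j \<noteq> l}) =
        card {l \<in> ?S. i \<noteq> l} * card {l \<in> ?S. i \<noteq> l} + (\<Sum>j\<in>?S - {i}. card {l \<in> ?S. i \<noteq> l \<and> j \<noteq> l} * card {l \<in> ?S. i \<noteq> l \<and> j \<noteq> l})"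
        using sum.remove[OF S(1) i, of "\<lambda>j. card {l \<in> ?S. i \<noteq> l \<and> j \<noteq> l} * card {l \<in> ?S. i \<noteq> l \<and> j \<noteq> l}"] by simp
      also have "(\<Sum>j\<in>?S - {i}. card {l \<in> ?S. i \<noteq> l \<and> j \<noteq> l} * card {l \<in> ?S. i \<noteq> l \<and> j \<noteq> l}) = card (?S - {i}) * ((k + 1) * (k + 1))"
      proof (rule const)
        fix j assume "j \<in> ?S - {i}"
        then show "card {l \<in> ?S. i \<noteq> l \<and> j \<noteq> l} * card {l \<in> ?S. i \<noteq> l \<and> j \<noteq> l} = (k + 1) * (k + 1)"
          using ex(2)[OF i, of j] by auto
      qed
      also have "card (?S - {i}) = k + 2" using S i by (subst card_Diff_singleton) simp_all
      finally show ?thesis using ex(1)[OF i] by (simp add: power2_eq_square)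
    qed
    have "card (proper_colourings V E q) = (\<Sum>i\<in>?S. \<Sum>j\<in>?S. card {l \<in> ?S. i \<noteq> l \<and> j \<noteq> l} * card {l \<in> ?S. i \<noteq> l \<and> j \<noteq> l})"
      unfolding count[OF g] by (simp del: atLeastLessThan_iff)
    also have "\<dots> = card ?S * ((k + 2) ^ 2 + (k + 2) * (k + 1) ^ 2)" by (rule const[OF inner])
    finally show "card (proper_colourings V E q) = (k + 3) * ((k + 2) ^ 2 + (k + 2) * (k + 1) ^ 2)" by (simp only: S(2))
  next
    assume g: "graph4 V E True True False False True True"
    show "card (proper_colourings V E q) = (k + 3) * (k + 2) ^ 2 * (k + 1)"
      unfolding count[OF g] by (simp add: ex S power2_eq_square del: card_atLeastLessThan_int atLeastLessThan_iff cong: sum.cong_simp) (simp add: algebra_simps)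
  next
    assume g: "graph4 V E True True False True True True"
    show "card (proper_colourings V E q) = (k + 3) * (k + 2) * (k + 1) ^ 2"
      unfolding count[OF g] by (simp add: ex S power2_eq_square del: card_atLeastLessThan_int atLeastLessThan_iff cong: sum.cong_simp) (simp add: algebra_simps)
  next
    assume g: "graph4 V E True True True True True True"
    show "card (proper_colourings V E q) = (k + 3) * (k + 2) * (k + 1) * k"
      unfolding count[OF g] by (simp add: ex S del: card_atLeastLessThan_int atLeastLessThan_iff cong: sum.cong_simp) (simp add: algebra_simps)
  }
qed

text \<open>Two involutions of a dihedral group of large prime degree satisfy a relation of even length
  iff they are equal or one of them is trivial; the identity $(1, 0)$ acts as a blank colour.\<close>

definition blank_rel :: "int \<times> int \<Rightarrow> int \<times> int \<Rightarrow> bool" where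
  "blank_rel x y \<longleftrightarrow> x = y \<or> x = (1, 0) \<or> y = (1, 0)"

definition blank_set :: "int \<Rightarrow> (int \<times> int) set" where
  "blank_set N = insert (1, 0) ({-1} \<times> {0..<N})"

lemma sum_blank_set:
  "(\<Sum>i\<in>blank_set N. f i) = f (1, 0) + (\<Sum>i\<in>{-1} \<times> {0..<N}. f i)" for f :: "int \<times> int \<Rightarrow> nat"
  unfolding blank_set_def by (subst sum.insert) auto

lemma blank_sets:
  fixes i j :: "int \<times> int"
  shows "{l \<in> blank_set N. blank_rel (1, 0) l} = blank_set N"
    "i \<in> {-1} \<times> {0..<N} \<Longrightarrow> {l \<in> blank_set N. blank_rel i l} = {(1, 0), i}"
    "{l \<in> blank_set N. blank_rel (1, 0) l \<and> P l} = {l \<in> blank_set N. P l}"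
    "{l \<in> blank_set N. P l \<and> blank_rel (1, 0) l} = {l \<in> blank_set N. P l}"
    "i \<in> {-1} \<times> {0..<N} \<Longrightarrow> {l \<in> blank_set N. blank_rel i l \<and> P l} = {l \<in> {(1, 0), i}. P l}"
  by (auto simp: blank_set_def blank_rel_def)

text \<open>Adjacent non-blank vertices share their colour, so the count is the sum, over all vertex
  sets, of \<open>m\<close> to the number of components of the induced subgraph. These polynomials
  are pairwise different, even for path and star.\<close>

lemma card_blank_colourings:
  fixes V :: "'a set"
  assumes E: "\<forall>v w. {v, w} \<in> E \<longrightarrow> v \<noteq> w" and m: "m > 0"
  defines "c \<equiv> card (colourings V E (blank_set (int m)) blank_rel)"
  shows "graph4 V E False False False False False False \<Longrightarrow> c = (m + 1) ^ 4"
    "graph4 V E True False False False False False \<Longrightarrow> c = (3 * m + 1) * (m + 1) ^ 2"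
    "graph4 V E True False True False False False \<Longrightarrow> c = (3 * m + 1) ^ 2"
    "graph4 V E True True False False False False \<Longrightarrow> c = (1 + 6 * m + m ^ 2) * (m + 1)"
    "graph4 V E True True False False True False \<Longrightarrow> c = (1 + 7 * m) * (m + 1)"
    "graph4 V E True True True False False False \<Longrightarrow> c = 1 + 10 * m + 5 * m ^ 2"
    "graph4 V E True True False False False True \<Longrightarrow> c = 1 + 11 * m + 3 * m ^ 2 + m ^ 3"
    "graph4 V E False True False True True True \<Longrightarrow> c = 1 + 13 * m + 2 * m ^ 2"
    "graph4 V E True True False False True True \<Longrightarrow> c = 1 + 12 * m + 3 * m ^ 2"
    "graph4 V E True True False True True True \<Longrightarrow> c = 1 + 14 * m + m ^ 2"
    "graph4 V E True True True True True True \<Longrightarrow> c = 1 + 15 * m"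
proof -
  let ?B = "{-1 :: int} \<times> {0..<int m}"
  let ?z = "(1, 0) :: int \<times> int"
  let ?S = "blank_set (int m)"
  have finB: "finite ?B" and cB: "card ?B = m" by simp_all
  have zB: "?z \<notin> ?B" by simp
  have S: "finite ?S" and cS: "card ?S = m + 1" by (simp_all add: blank_set_def card_insert_if)
  have R: "blank_rel x y = blank_rel y x" for x y by (auto simp: blank_rel_def)
  have count: "c = (\<Sum>i\<in>?S. \<Sum>j\<in>{j \<in> ?S. x1 \<longrightarrow> blank_rel i j}. \<Sum>k\<in>{k \<in> ?S. (x5 \<longrightarrow> blank_rel i k) \<and> (x2 \<longrightarrow> blank_rel j k)}.
     card {l \<in> ?S. (x4 \<longrightarrow> blank_rel i l) \<and> (x6 \<longrightarrow> blank_rel j l) \<and> (x3 \<longrightarrow> blank_rel k l)})"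
    if "graph4 V E x1 x2 x3 x4 x5 x6" for x1 x2 x3 x4 x5 x6
    unfolding c_def by (rule card_colourings_graph4[OF that E S R])
  have nz: "i \<noteq> ?z" "?z \<noteq> i" if "i \<in> ?B" for i using that by auto
  have zz: "blank_rel i ?z" "blank_rel ?z i" "blank_rel i i" for i by (simp_all add: blank_rel_def)
  have ij: "blank_rel i j \<longleftrightarrow> i = j" if "i \<in> ?B" "j \<in> ?B" for i j using that by (auto simp: blank_rel_def)
  have pair: "{l \<in> {?z, i}. P l} = (if P ?z then {?z} else {}) \<union> (if P i then {i} else {})" for i P by auto
  have sum2: "(\<Sum>j\<in>{?z, i}. f j) = f ?z + f i" if "i \<in> ?B" for i and f :: "_ \<Rightarrow> nat" using nz[OF that] by simp
  have c2: "card {?z, i} = 2" if "i \<in> ?B" for i using nz[OF that] by simp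
  have sumc: "(\<Sum>j\<in>?B. f j) = m * k" if "\<And>j. j \<in> ?B \<Longrightarrow> f j = k" for f and k :: nat
    using that cB by simp
  have N1: "{l \<in> ?S. blank_rel i l \<and> blank_rel j l} = (if i = ?z then {l \<in> ?S. blank_rel j l} else if j = ?z then {l \<in> ?S. blank_rel i l}
      else if i = j then {?z, i} else {?z})" if "i \<in> ?S" "j \<in> ?S" for i j
    using that by (auto simp: blank_set_def blank_rel_def)
  have S_cases: "(\<Sum>i\<in>?S. f i) = f ?z + (\<Sum>i\<in>?B. f i)" for f :: "_ \<Rightarrow> nat" by (rule sum_blank_set)
  define d where "d i = card {l \<in> ?S. blank_rel i l}" for i
  have dz: "d ?z = m + 1" by (simp add: d_def blank_sets(1) cS)
  have dB: "d i = 2" if "i \<in> ?B" for i unfolding d_def blank_sets(2)[OF that] by (rule c2[OF that])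
  define h where "h i j = card {l \<in> ?S. blank_rel i l \<and> blank_rel j l}" for i j
  have hz: "h ?z j = d j" "h i ?z = d i" for i j by (simp_all add: h_def d_def blank_sets(3,4))
  have hB: "h i j = (if i = j then 2 else 1)" if "i \<in> ?B" "j \<in> ?B" for i j
    using that nz c2[OF that(1)] N1[of i j] by (auto simp: h_def blank_set_def)
  have NS: "(\<Sum>j\<in>{j \<in> ?S. blank_rel ?z j}. f j) = f ?z + (\<Sum>i\<in>?B. f i)" for f :: "_ \<Rightarrow> nat"
    by (simp only: blank_sets(1) S_cases)
  have NB: "(\<Sum>j\<in>{j \<in> ?S. blank_rel i j}. f j) = f ?z + f i" if "i \<in> ?B" for i and f :: "_ \<Rightarrow> nat"
    by (simp only: blank_sets(2)[OF that] sum2[OF that])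
  have nested: "(\<Sum>i\<in>?S. \<Sum>j\<in>{j \<in> ?S. blank_rel i j}. g i j) = g ?z ?z + (\<Sum>i\<in>?B. g ?z i) + (\<Sum>i\<in>?B. g i ?z + g i i)"
    for g :: "_ \<Rightarrow> _ \<Rightarrow> nat" by (simp add: S_cases NS NB cong: sum.cong_simp)
  have nested0: "(\<Sum>i\<in>?S. \<Sum>j\<in>?S. g i j) = g ?z ?z + (\<Sum>i\<in>?B. g ?z i) + (\<Sum>i\<in>?B. g i ?z + (\<Sum>j\<in>?B. g i j))"
    for g :: "_ \<Rightarrow> _ \<Rightarrow> nat" by (simp add: S_cases)
  have D: "(\<Sum>k\<in>?S. d k) = 3 * m + 1" by (simp add: S_cases dz dB cong: sum.cong_simp)
  have DN: "(\<Sum>k\<in>{k \<in> ?S. blank_rel ?z k}. d k) = 3 * m + 1" by (simp only: blank_sets(1) D)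
  have DB: "(\<Sum>k\<in>{k \<in> ?S. blank_rel i k}. d k) = m + 3" if "i \<in> ?B" for i by (simp add: NB[OF that] dz dB[OF that])
  {
    assume "graph4 V E False False False False False False"
    from count[OF this] show "c = (m + 1) ^ 4" by (simp add: cS numeral_eq_Suc)
  next
    assume "graph4 V E True False False False False False"
    from count[OF this] have "c = (\<Sum>i\<in>?S. d i * ((m + 1) * (m + 1)))"
      by (simp add: cS d_def del: mult_Suc mult_Suc_right)
    also have "\<dots> = (\<Sum>i\<in>?S. d i) * ((m + 1) * (m + 1))" by (rule sum_distrib_right[symmetric])
    finally show "c = (3 * m + 1) * (m + 1) ^ 2" by (simp only: D power2_eq_square)
  next
    assume "graph4 V E True False True False False False"
    from count[OF this] have "c = (\<Sum>i\<in>?S. d i * (3 * m + 1))"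
      by (simp add: D d_def[symmetric] del: mult_Suc mult_Suc_right)
    also have "\<dots> = (\<Sum>i\<in>?S. d i) * (3 * m + 1)" by (rule sum_distrib_right[symmetric])
    finally show "c = (3 * m + 1) ^ 2" by (simp only: D power2_eq_square)
  next
    assume "graph4 V E True True False False False False"
    from count[OF this] show "c = (1 + 6 * m + m ^ 2) * (m + 1)"
      by (simp add: cS nested flip: d_def) (simp add: dz dB power2_eq_square algebra_simps cong: sum.cong_simp)
  next
    assume "graph4 V E True True False False True False"
    from count[OF this] show "c = (1 + 7 * m) * (m + 1)"
      by (simp add: cS nested flip: h_def) (simp add: hz hB dz dB algebra_simps cong: sum.cong_simp)
  next
    assume "graph4 V E True True True False False False"
    from count[OF this] show "c = 1 + 10 * m + 5 * m ^ 2"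
      by (simp add: nested flip: d_def) (simp add: DN DB dz dB power2_eq_square algebra_simps cong: sum.cong_simp)
  next
    assume "graph4 V E True True False False False True"
    from count[OF this] show "c = 1 + 11 * m + 3 * m ^ 2 + m ^ 3"
      by (simp add: nested flip: d_def) (simp add: dz dB power2_eq_square power3_eq_cube algebra_simps cong: sum.cong_simp)
  next
    assume "graph4 V E False True False True True True"
    then have "c = (\<Sum>i\<in>?S. \<Sum>j\<in>?S. h i j * h i j)" using count by (simp add: h_def)
    also have "\<dots> = h ?z ?z * h ?z ?z + (\<Sum>i\<in>?B. h ?z i * h ?z i) + (\<Sum>i\<in>?B. h i ?z * h i ?z + (\<Sum>j\<in>?B. h i j * h i j))"
      by (rule nested0)
    \<comment> \<open>For a non-blank \<open>i\<close>, the blank contributes 4, the colour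
      \<open>i\<close> itself 4, and each of the \<open>m - 1\<close> other colours 1.\<close>
    also have "(\<Sum>i\<in>?B. h i ?z * h i ?z + (\<Sum>j\<in>?B. h i j * h i j)) = (\<Sum>i\<in>?B. 4 + (m + 3))"
    proof (rule sum.cong)
      fix i assume i: "i \<in> ?B"
      have "(\<Sum>j\<in>?B. h i j * h i j) = h i i * h i i + (\<Sum>j\<in>?B - {i}. h i j * h i j)" by (rule sum.remove[OF finB i])
      also have "(\<Sum>j\<in>?B - {i}. h i j * h i j) = (\<Sum>j\<in>?B - {i}. 1)" using hB[OF i] by (intro sum.cong) auto
      also have "\<dots> = card (?B - {i})" by simp
      also have "card (?B - {i}) = m - 1" using card_Diff_singleton[OF i] cB by simp
      finally show "h i ?z * h i ?z + (\<Sum>j\<in>?B. h i j * h i j) = 4 + (m + 3)" using m hB[OF i i] dB[OF i] by (simp add: hz)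
    qed simp
    also have "(\<Sum>i\<in>?B. h ?z i * h ?z i) = (\<Sum>i\<in>?B. 4)" using dB by (intro sum.cong) (simp_all add: hz)
    finally show "c = 1 + 13 * m + 2 * m ^ 2" by (simp add: hz dz power2_eq_square algebra_simps)
  next
    assume "graph4 V E True True False False True True"
    then have "c = (\<Sum>i\<in>?S. \<Sum>j\<in>{j \<in> ?S. blank_rel i j}. h i j * d j)" using count by (simp add: h_def d_def)
    then show "c = 1 + 12 * m + 3 * m ^ 2"
      by (simp add: nested) (simp add: hz hB dz dB power2_eq_square algebra_simps cong: sum.cong_simp)
  next
    assume "graph4 V E True True False True True True"
    then have "c = (\<Sum>i\<in>?S. \<Sum>j\<in>{j \<in> ?S. blank_rel i j}. h i j * h i j)" using count by (simp add: h_def)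
    then show "c = 1 + 14 * m + m ^ 2"
      by (simp add: nested) (simp add: hz hB dz dB power2_eq_square algebra_simps cong: sum.cong_simp)
  next
    assume "graph4 V E True True True True True True"
    define t where "t i j k = card {l \<in> ?S. blank_rel i l \<and> blank_rel j l \<and> blank_rel k l}" for i j k
    define s where "s i j = (\<Sum>k\<in>{k \<in> ?S. blank_rel i k \<and> blank_rel j k}. t i j k)" for i j
    have tz: "t ?z j k = h j k" "t i ?z k = h i k" "t i i k = h i k" for i j k
      by (simp_all add: t_def h_def zz)
    have "s ?z ?z = (\<Sum>k\<in>?S. d k)" by (simp add: s_def tz hz blank_sets(1,3))
    then have szz: "s ?z ?z = 3 * m + 1" by (simp add: D)
    have szB: "s ?z i = 4" "s i ?z = 4" "s i i = 4" if i: "i \<in> ?B" for i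
    proof -
      have *: "(\<Sum>k\<in>{k \<in> ?S. blank_rel i k}. h i k) = 4" using NB[OF i, of "h i"] hB[OF i i] dB[OF i] by (simp add: hz)
      show "s ?z i = 4" "s i ?z = 4" "s i i = 4" using * by (simp_all add: s_def tz zz)
    qed
    have "c = (\<Sum>i\<in>?S. \<Sum>j\<in>{j \<in> ?S. blank_rel i j}. s i j)" using count[OF \<open>graph4 V E True True True True True True\<close>] by (simp add: s_def t_def)
    then show "c = 1 + 15 * m"
      by (simp add: nested) (simp add: szz szB cong: sum.cong_simp)
  }
qed

section \<open>Even labels\<close>

definition dih_invol :: "int \<Rightarrow> (int \<times> int) set" where
  "dih_invol N = {x \<in> carrier (dih N). x \<otimes>\<^bsub>dih N\<^esub> x = \<one>\<^bsub>dih N\<^esub>}"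

lemma finite_dih_invol: "finite (dih_invol N)"
  using finite_dih by (simp add: dih_invol_def)

lemma cox_homs_alt:
  "cox_homs V E m (dih N) = {x \<in> V \<rightarrow>\<^sub>E dih_invol N. \<forall>v\<in>V. \<forall>w\<in>V. {v, w} \<in> E \<longrightarrow>
     (x v \<otimes>\<^bsub>dih N\<^esub> x w) [^]\<^bsub>dih N\<^esub> m {v, w} = \<one>\<^bsub>dih N\<^esub>}"
  by (auto simp: cox_homs_def dih_invol_def PiE_def Pi_def)

lemma dih_exponent:
  assumes N: "N > 0" and z: "z \<in> carrier (dih N)" and k: "N dvd int k" "even k"
  shows "z [^]\<^bsub>dih N\<^esub> k = \<one>\<^bsub>dih N\<^esub>"
proof -
  obtain e t where [simp]: "z = (e, t)" by (cases z)
  have "t \<in> {0..<N}" "e = 1 \<or> e = -1" using z by (auto simp: dih_simps(1))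
  then show ?thesis
    using dih_rot_pow[OF N, of t k] dih_refl_pow_even[OF N, of t k] k by (auto simp: dih_simps(3))
qed

text \<open>An odd exponent forces the product to be a rotation, and coprimality to \<open>N\<close>
  forces that rotation to be trivial.\<close>

lemma dih_odd_pow_iff:
  assumes N: "N > 0" and x: "x \<in> dih_invol N" "y \<in> dih_invol N" and k: "odd k" "coprime (int k) N"
  shows "(x \<otimes>\<^bsub>dih N\<^esub> y) [^]\<^bsub>dih N\<^esub> (k::nat) = \<one>\<^bsub>dih N\<^esub> \<longleftrightarrow> x = y"
proof
  interpret group "dih N" using group_dih[OF N] .
  have c: "x \<in> carrier (dih N)" "y \<in> carrier (dih N)" and i: "x \<otimes>\<^bsub>dih N\<^esub> x = \<one>\<^bsub>dih N\<^esub>" "y \<otimes>\<^bsub>dih N\<^esub> y = \<one>\<^bsub>dih N\<^esub>"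
    using x by (auto simp: dih_invol_def)
  show "x = y \<Longrightarrow> (x \<otimes>\<^bsub>dih N\<^esub> y) [^]\<^bsub>dih N\<^esub> k = \<one>\<^bsub>dih N\<^esub>" using i by simp
  assume pow: "(x \<otimes>\<^bsub>dih N\<^esub> y) [^]\<^bsub>dih N\<^esub> k = \<one>\<^bsub>dih N\<^esub>"
  obtain e s where z: "x \<otimes>\<^bsub>dih N\<^esub> y = (e, s)" by (cases "x \<otimes>\<^bsub>dih N\<^esub> y")
  have zc: "(e, s) \<in> carrier (dih N)" using c z by (metis m_closed)
  have "e ^ k = 1" using dih_sign_pow[of N "(e, s)" k] pow z by (simp add: dih_simps(3))
  then have e: "e = 1" using zc k(1) by (auto simp: dih_simps(1))
  have s: "s \<in> {0..<N}" using zc by (simp add: dih_simps(1))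
  then have "N dvd int k * s" using dih_rot_pow[OF N, of s k] pow z e by (simp add: dih_simps(3) dvd_eq_mod_eq_0)
  then have "N dvd s" using k(2) by (simp add: coprime_dvd_mult_right_iff coprime_commute)
  then have "s = 0" using s by (auto simp: dvd_eq_mod_eq_0)
  then have "x \<otimes>\<^bsub>dih N\<^esub> y = \<one>\<^bsub>dih N\<^esub>" using z e by (simp add: dih_simps(3))
  then have "x \<otimes>\<^bsub>dih N\<^esub> y = y \<otimes>\<^bsub>dih N\<^esub> y" using i by simp
  then show "x = y" using c by simp
qed

lemma dih_invol_odd:
  assumes "odd N" "N > 0" shows "dih_invol N = blank_set N"
proof (intro equalityI subsetI)
  fix x assume "x \<in> dih_invol N"
  then have x: "x \<in> carrier (dih N)" "x = \<one>\<^bsub>dih N\<^esub> \<or> fst x = -1"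
    using dih_involution_cases[of x N] assms(1) by (auto simp: dih_invol_def)
  then show "x \<in> blank_set N" by (cases x) (auto simp: blank_set_def dih_simps)
qed (use assms in \<open>auto simp: dih_invol_def blank_set_def dih_simps\<close>)

text \<open>A reflection paired with the identity is killed by every even power. The product of two
  distinct reflections is a rotation of prime order \<open>N\<close>, which \<open>k\<close> does
  not kill.\<close>

lemma dih_even_pow_iff:
  assumes N: "prime N" "odd N" and x: "x \<in> blank_set N" "y \<in> blank_set N" and k: "even k" "\<not> N dvd int k"
  shows "(x \<otimes>\<^bsub>dih N\<^esub> y) [^]\<^bsub>dih N\<^esub> (k::nat) = \<one>\<^bsub>dih N\<^esub> \<longleftrightarrow> blank_rel x y"
proof -
  have N0: "N > 0" using N(1) by (simp add: prime_gt_0_int)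
  interpret group "dih N" using group_dih[OF N0] .
  have one: "(1, 0) = \<one>\<^bsub>dih N\<^esub>" by (simp add: dih_simps)
  have c: "z \<in> carrier (dih N)" if "z \<in> blank_set N" for z using that N0 by (auto simp: blank_set_def dih_simps)
  have refl: "(-1, t) [^]\<^bsub>dih N\<^esub> k = \<one>\<^bsub>dih N\<^esub>" if "t \<in> {0..<N}" for t
    using dih_refl_pow_even[OF N0 that k(1)] .
  consider "x = (1, 0)" | "y = (1, 0)" | t s where "x = (-1, t)" "y = (-1, s)" "t \<in> {0..<N}" "s \<in> {0..<N}"
    using x by (auto simp: blank_set_def)
  then show ?thesis
  proof cases
    case 1
    then have "(x \<otimes>\<^bsub>dih N\<^esub> y) [^]\<^bsub>dih N\<^esub> k = y [^]\<^bsub>dih N\<^esub> k" using c[OF x(2)] by (simp add: one)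
    also have "\<dots> = \<one>\<^bsub>dih N\<^esub>" using x(2) refl by (auto simp: blank_set_def one)
    finally show ?thesis using 1 by (simp add: blank_rel_def)
  next
    case 2
    then have "(x \<otimes>\<^bsub>dih N\<^esub> y) [^]\<^bsub>dih N\<^esub> k = x [^]\<^bsub>dih N\<^esub> k" using c[OF x(1)] by (simp add: one)
    also have "\<dots> = \<one>\<^bsub>dih N\<^esub>" using x(1) refl by (auto simp: blank_set_def one)
    finally show ?thesis using 2 by (simp add: blank_rel_def)
  next
    case 3
    then show ?thesis
      using dih_refl_pow_iff[OF N0, of t s k] dvd_mult_diff_eq_iff[OF N(1) k(2) 3(3,4)] by (auto simp: blank_rel_def)
  qed
qed

lemma bij_betw_colourings_quotient:
  fixes E0 :: "'a set set"
  assumes E: "\<forall>v w. {v, w} \<in> E \<longrightarrow> v \<in> V \<and> w \<in> V" and E0: "E0 \<subseteq> E" and R: "\<And>x. R x x"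
  defines "pr \<equiv> comp_of E0"
  shows "bij_betw (\<lambda>y. \<lambda>v\<in>V. y (pr v)) (colourings (pr ` V) (quotient_edges V E pr) S R)
    {x \<in> V \<rightarrow>\<^sub>E S. \<forall>v\<in>V. \<forall>w\<in>V. {v, w} \<in> E \<longrightarrow> (if {v, w} \<in> E0 then x v = x w else R (x v) (x w))}"
proof -
  let ?f = "\<lambda>y. \<lambda>v\<in>V. y (pr v)"
  have E0V: "\<forall>v w. {v, w} \<in> E0 \<longrightarrow> v \<in> V \<and> w \<in> V" using E E0 by blast
  have bij: "bij_betw ?f (pr ` V \<rightarrow>\<^sub>E S) {f \<in> V \<rightarrow>\<^sub>E S. \<forall>v w. {v, w} \<in> E0 \<longrightarrow> f v = f w}"
    unfolding pr_def by (rule bij_betw_comp_functions[OF E0V])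
  have pr0: "pr v = pr w" if "{v, w} \<in> E0" for v w unfolding pr_def using that by (rule comp_of_edge)
  have "bij_betw ?f {y \<in> pr ` V \<rightarrow>\<^sub>E S. y \<in> colourings (pr ` V) (quotient_edges V E pr) S R}
    {x \<in> {f \<in> V \<rightarrow>\<^sub>E S. \<forall>v w. {v, w} \<in> E0 \<longrightarrow> f v = f w}. \<forall>v\<in>V. \<forall>w\<in>V. {v, w} \<in> E \<longrightarrow> (if {v, w} \<in> E0 then x v = x w else R (x v) (x w))}"
  proof (rule bij_betw_Collect[OF bij])
    fix y assume y: "y \<in> pr ` V \<rightarrow>\<^sub>E S"
    show "(\<forall>v\<in>V. \<forall>w\<in>V. {v, w} \<in> E \<longrightarrow> (if {v, w} \<in> E0 then ?f y v = ?f y w else R (?f y v) (?f y w))) \<longleftrightarrow>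
      y \<in> colourings (pr ` V) (quotient_edges V E pr) S R" (is "?L \<longleftrightarrow> ?R")
    proof
      assume L: ?L
      show ?R
        unfolding colourings_def
      proof (intro CollectI conjI ballI impI)
        show "y \<in> pr ` V \<rightarrow>\<^sub>E S" by fact
        fix a b assume "{a, b} \<in> quotient_edges V E pr"
        then obtain v w where vw: "{v, w} \<in> E" "pr v = a" "pr w = b" "a \<noteq> b" using quotient_edges_iff[OF E] by metis
        then have "v \<in> V" "w \<in> V" "{v, w} \<notin> E0" using E pr0 by auto
        then show "R (y a) (y b)" using L vw by fastforce
      qed
    next
      assume Rt: ?R
      show ?L
      proof (intro ballI impI)
        fix v w assume vw: "v \<in> V" "w \<in> V" "{v, w} \<in> E"
        have "R (y (pr v)) (y (pr w))"
        proof (cases "pr v = pr w")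
          case False
          then have "{pr v, pr w} \<in> quotient_edges V E pr" using vw unfolding quotient_edges_def by blast
          then show ?thesis using Rt vw unfolding colourings_def by blast
        qed (simp add: R)
        then show "if {v, w} \<in> E0 then ?f y v = ?f y w else R (?f y v) (?f y w)" using vw pr0[of v w] by simp
      qed
    qed
  qed
  moreover have "{y \<in> pr ` V \<rightarrow>\<^sub>E S. y \<in> colourings (pr ` V) (quotient_edges V E pr) S R} = colourings (pr ` V) (quotient_edges V E pr) S R"
    by (auto simp: colourings_def)
  moreover have "{x \<in> {f \<in> V \<rightarrow>\<^sub>E S. \<forall>v w. {v, w} \<in> E0 \<longrightarrow> f v = f w}. \<forall>v\<in>V. \<forall>w\<in>V. {v, w} \<in> E \<longrightarrow> (if {v, w} \<in> E0 then x v = x w else R (x v) (x w))}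
    = {x \<in> V \<rightarrow>\<^sub>E S. \<forall>v\<in>V. \<forall>w\<in>V. {v, w} \<in> E \<longrightarrow> (if {v, w} \<in> E0 then x v = x w else R (x v) (x w))}"
    using E0 E0V by (auto 0 4 split: if_splits)
  ultimately show ?thesis by simp
qed

lemma cox_homs_exponent:
  assumes "N > 0" and m: "\<forall>e\<in>E. N dvd int (m e) \<and> even (m e)"
  shows "cox_homs V E m (dih N) = V \<rightarrow>\<^sub>E dih_invol N"
proof -
  interpret group "dih N" using group_dih[OF assms(1)] .
  have "(x v \<otimes>\<^bsub>dih N\<^esub> x w) [^]\<^bsub>dih N\<^esub> m {v, w} = \<one>\<^bsub>dih N\<^esub>"
    if "x \<in> V \<rightarrow>\<^sub>E dih_invol N" "v \<in> V" "w \<in> V" "{v, w} \<in> E" for x v w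
  proof -
    have "x v \<in> carrier (dih N)" "x w \<in> carrier (dih N)"
      using PiE_mem[OF that(1)] that(2,3) by (auto simp: dih_invol_def)
    then show ?thesis using m that(4) by (intro dih_exponent assms(1)) auto
  qed
  then show ?thesis unfolding cox_homs_alt by blast
qed

section \<open>Fibres over sign assignments\<close>

lemma PiE_fibre:
  assumes "\<chi> \<in> extensional V"
  shows "{x \<in> V \<rightarrow>\<^sub>E S. restrict (p \<circ> x) V = \<chi>} = PiE V (\<lambda>v. {y \<in> S. p y = \<chi> v})"
proof (intro equalityI subsetI)
  fix x assume "x \<in> {x \<in> V \<rightarrow>\<^sub>E S. restrict (p \<circ> x) V = \<chi>}"
  then show "x \<in> PiE V (\<lambda>v. {y \<in> S. p y = \<chi> v})" by (auto simp: PiE_def Pi_def)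
next
  fix x assume x: "x \<in> PiE V (\<lambda>v. {y \<in> S. p y = \<chi> v})"
  have "restrict (p \<circ> x) V v = \<chi> v" for v
    using x assms by (cases "v \<in> V") (auto simp: PiE_def Pi_def extensional_def)
  then show "x \<in> {x \<in> V \<rightarrow>\<^sub>E S. restrict (p \<circ> x) V = \<chi>}" using x by (auto simp: PiE_def Pi_def)
qed

lemma card_PiE_fibre:
  assumes V: "finite V" and \<chi>: "\<chi> \<in> V \<rightarrow>\<^sub>E {(1, 0), (-1, 0) :: int \<times> int}"
    and a: "card {y \<in> S. p y = (-1, 0)} = a" and b: "card {y \<in> S. p y = (1, 0)} = b"
  shows "card {x \<in> V \<rightarrow>\<^sub>E S. restrict (p \<circ> x) V = \<chi>} =
    a ^ card {v \<in> V. \<chi> v = (-1, 0)} * b ^ (card V - card {v \<in> V. \<chi> v = (-1, 0)})"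
proof -
  have "\<chi> \<in> extensional V" using \<chi> by (simp add: PiE_def)
  then have "card {x \<in> V \<rightarrow>\<^sub>E S. restrict (p \<circ> x) V = \<chi>} = (\<Prod>v\<in>V. card {y \<in> S. p y = \<chi> v})"
    using V by (simp add: PiE_fibre card_PiE)
  also have "\<dots> = (\<Prod>v\<in>V. if \<chi> v = (-1, 0) then a else b)"
  proof (rule prod.cong)
    fix v assume "v \<in> V"
    then have "\<chi> v = (1, 0) \<or> \<chi> v = (-1, 0)" using PiE_mem[OF \<chi>] by auto
    then show "card {y \<in> S. p y = \<chi> v} = (if \<chi> v = (-1, 0) then a else b)" using a b by auto
  qed simp
  also have "\<dots> = a ^ card {v \<in> V. \<chi> v = (-1, 0)} * b ^ card {v \<in> V. \<chi> v \<noteq> (-1, 0)}"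
    using V by (simp add: prod.If_cases Int_def Collect_neg_eq[symmetric])
  also have "{v \<in> V. \<chi> v \<noteq> (-1, 0)} = V - {v \<in> V. \<chi> v = (-1, 0)}" by auto
  also have "card \<dots> = card V - card {v \<in> V. \<chi> v = (-1, 0)}" using V by (intro card_Diff_subset) auto
  finally show ?thesis .
qed

lemma dih_1_invol: "dih_invol 1 = {(1, 0), (-1, 0)}"
  by (auto simp: dih_invol_def dih_simps)

text \<open>The identity, the half turn and two reflections are even, the other two reflections are
  odd. The sizes 2 and 4 differ, so the size of a fibre tells how many generators have value
  -1.\<close>

lemma card_parity_fibre:
  "card {y \<in> dih_invol 4. dih_parity y = (-1, 0)} = 2" "card {y \<in> dih_invol 4. dih_parity y = (1, 0)} = 4"
proof -
  have i4: "{0..<4::int} = {0, 1, 2, 3}" by auto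
  have "dih_invol 4 = {(1, 0), (1, 2), (-1, 0), (-1, 1), (-1, 2), (-1, 3)}"
    by (auto simp: dih_invol_def dih_simps i4)
  then have "{y \<in> dih_invol 4. dih_parity y = (-1, 0)} = {(-1, 1), (-1, 3)}"
    "{y \<in> dih_invol 4. dih_parity y = (1, 0)} = {(1, 0), (1, 2), (-1, 0), (-1, 2)}"
    by (auto simp: dih_parity_def)
  then show "card {y \<in> dih_invol 4. dih_parity y = (-1, 0)} = 2" "card {y \<in> dih_invol 4. dih_parity y = (1, 0)} = 4"
    by simp_all
qed

lemma card_sign_fibre:
  assumes "odd u" "u > 0"
  shows "card {y \<in> dih_invol u. dih_sign y = (-1, 0)} = nat u" "card {y \<in> dih_invol u. dih_sign y = (1, 0)} = 1"
proof -
  have "{y \<in> dih_invol u. dih_sign y = (-1, 0)} = {-1} \<times> {0..<u}" "{y \<in> dih_invol u. dih_sign y = (1, 0)} = {(1, 0)}"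
    using assms by (auto simp: dih_invol_odd blank_set_def dih_sign_def)
  then show "card {y \<in> dih_invol u. dih_sign y = (-1, 0)} = nat u" "card {y \<in> dih_invol u. dih_sign y = (1, 0)} = 1"
    by (simp_all add: card_cartesian_product_singleton)
qed

text \<open>The fibres over a sign assignment to the parity map of the dihedral group of order eight
  determine the number of generators of sign $-1$; the fibres to a dihedral group of odd degree
  u then show that reflections attached to two different classes are independent.\<close>

lemma odd_part_divides_cross_label:
  fixes pr :: "'b \<Rightarrow> 'c"
  assumes G': "coxeter_graph V' E' m'" and u: "odd u" "u > 0"
    and edge: "\<forall>v w. {v, w} \<in> E' \<longrightarrow> pr v = pr w \<or> even (m' {v, w})"
    and fibres: "\<forall>c \<in> pr ` V' \<rightarrow>\<^sub>E {(1, 0), (-1, 0)}. card {x \<in> cox_homs V' E' m' (dih u). restrict (dih_sign \<circ> x) V' = (\<lambda>v\<in>V'. c (pr v))}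
       = nat u ^ card {a \<in> pr ` V'. c a = (-1, 0)}"
    and vw: "{v, w} \<in> E'" "pr v \<noteq> pr w"
  shows "u dvd int (m' {v, w})"
proof -
  have V: "v \<in> V'" "w \<in> V'" using coxeter_graph_edgeD[OF G' vw(1)] by auto
  have finV: "finite V'" using G' by (simp add: coxeter_graph_def)
  interpret D: group "dih u" using group_dih[OF u(2)] .
  have one: "(1, 0) = \<one>\<^bsub>dih u\<^esub>" by (simp add: dih_simps)
  define s where "s A = (\<lambda>a\<in>pr ` V'. if a \<in> A then (-1, 0) else (1, 0) :: int \<times> int)" for A
  define Z where "Z A = {x \<in> cox_homs V' E' m' (dih u). restrict (dih_sign \<circ> x) V' = (\<lambda>v\<in>V'. s A (pr v))}" for A
  have sP: "s A \<in> pr ` V' \<rightarrow>\<^sub>E {(1, 0), (-1, 0)}" for A by (auto simp: s_def)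
  have cZ: "card (Z A) = nat u ^ card A" if "A \<subseteq> pr ` V'" for A
  proof -
    have "{a \<in> pr ` V'. s A a = (-1, 0)} = A" using that by (auto simp: s_def)
    then show ?thesis using fibres[rule_format, OF sP[of A]] by (simp add: Z_def)
  qed
  have finZ: "finite (Z A)" for A unfolding Z_def using cox_homs_mono_finite[OF finV finite_dih[of u], of E' m'] by simp
  have Zsign: "fst (x y) = (if pr y \<in> A then -1 else 1)" if "x \<in> Z A" "y \<in> V'" for x y A
  proof -
    have "restrict (dih_sign \<circ> x) V' y = (\<lambda>v\<in>V'. s A (pr v)) y" using that(1) by (simp add: Z_def)
    then show ?thesis using that(2) by (simp add: dih_sign_def s_def split: if_splits)
  qed
  have invol: "x y \<in> blank_set u" if "x \<in> cox_homs V' E' m' (dih u)" "y \<in> V'" for x y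
    using cox_homsD(1,3)[OF that] dih_invol_odd[OF u] by (auto simp: dih_invol_def)
  have blank1: "z = (1, 0)" if "z \<in> blank_set u" "fst z = 1" for z using that by (auto simp: blank_set_def)
  \<comment> \<open>Replaces the images outside the classes in \<open>A\<close> by the identity. The
    relations survive because edges between different classes have even labels, and even powers kill
    single involutions.\<close>
  let ?r = "\<lambda>A x. \<lambda>y\<in>V'. if pr y \<in> A then x y else (1, 0)"
  have rZ: "?r A x \<in> Z A" if x: "x \<in> Z B" and AB: "A \<subseteq> B" for A B x
  proof -
    have xh: "x \<in> cox_homs V' E' m' (dih u)" using x by (simp add: Z_def)
    have pow1: "z [^]\<^bsub>dih u\<^esub> k = \<one>\<^bsub>dih u\<^esub>" if "z \<in> blank_set u" "even k" for z and k :: nat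
      using that dih_refl_pow_even[OF u(2) _ that(2)] by (auto simp: blank_set_def one)
    have bc: "z \<in> carrier (dih u)" if "z \<in> blank_set u" for z using that u(2) by (auto simp: blank_set_def dih_simps)
    have "?r A x \<in> cox_homs V' E' m' (dih u)"
    proof (rule cox_homsI)
      fix y z assume yz: "y \<in> V'" "z \<in> V'" "{y, z} \<in> E'"
      note b = invol[OF xh yz(1)] invol[OF xh yz(2)]
      show "(?r A x y \<otimes>\<^bsub>dih u\<^esub> ?r A x z) [^]\<^bsub>dih u\<^esub> m' {y, z} = \<one>\<^bsub>dih u\<^esub>"
      proof (cases "pr y = pr z")
        case True
        then show ?thesis using cox_homsD(4)[OF xh yz] yz by (simp add: one)
      next
        case False
        then have "even (m' {y, z})" using edge yz(3) by blast
        then show ?thesis using yz pow1[OF b(1)] pow1[OF b(2)] bc[OF b(1)] bc[OF b(2)] cox_homsD(4)[OF xh yz]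
          by (simp add: one)
      qed
    qed (use cox_homsD(1,3)[OF xh] in \<open>auto simp: one\<close>)
    moreover have "restrict (dih_sign \<circ> ?r A x) V' = (\<lambda>v\<in>V'. s A (pr v))"
      using Zsign[OF x] AB by (intro restrict_ext) (auto simp: dih_sign_def s_def)
    ultimately show ?thesis by (simp add: Z_def)
  qed
  let ?A = "{pr v}" and ?B = "{pr w}"
  let ?f = "\<lambda>x. (?r ?A x, ?r ?B x)"
  \<comment> \<open>An injection between sets of the same size \<open>u ^ 2\<close>: prescribed
    reflections on the two classes always have a common extension.\<close>
  have "?f ` Z (?A \<union> ?B) = Z ?A \<times> Z ?B"
  proof (rule card_subset_eq)
    show "?f ` Z (?A \<union> ?B) \<subseteq> Z ?A \<times> Z ?B" using rZ by blast
    have inj: "inj_on ?f (Z (?A \<union> ?B))"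
    proof (rule inj_onI)
      fix x x' assume x: "x \<in> Z (?A \<union> ?B)" "x' \<in> Z (?A \<union> ?B)" "?f x = ?f x'"
      have xh: "x \<in> cox_homs V' E' m' (dih u)" "x' \<in> cox_homs V' E' m' (dih u)" using x by (auto simp: Z_def)
      show "x = x'"
      proof
        fix y
        show "x y = x' y"
        proof (cases "y \<in> V'")
          case True
          have rA: "?r ?A x y = ?r ?A x' y" and rB: "?r ?B x y = ?r ?B x' y" 
          proof -
            have "?r ?A x = ?r ?A x'" "?r ?B x = ?r ?B x'" using x(3) by (simp_all only: prod.inject)
            then show "?r ?A x y = ?r ?A x' y" "?r ?B x y = ?r ?B x' y" by (simp_all only:)
          qed
          show ?thesis
          proof (cases "pr y = pr v \<or> pr y = pr w")
            case True then show ?thesis using rA rB \<open>y \<in> V'\<close> by auto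
          next
            case False
            then have "fst (x y) = 1" "fst (x' y) = 1" using Zsign[OF x(1) \<open>y \<in> V'\<close>] Zsign[OF x(2) \<open>y \<in> V'\<close>] by auto
            then show ?thesis using blank1[OF invol[OF xh(1) \<open>y \<in> V'\<close>]] blank1[OF invol[OF xh(2) \<open>y \<in> V'\<close>]] by simp
          qed
        qed (use cox_homsD(2)[OF xh(1)] cox_homsD(2)[OF xh(2)] in simp)
      qed
    qed
    have "card (?A \<union> ?B) = 2" using vw(2) by simp
    then have "card (Z (?A \<union> ?B)) = nat u ^ 2" using V cZ[of "?A \<union> ?B"] by simp
    moreover have "card (Z ?A) = nat u" "card (Z ?B) = nat u" using V by (simp_all add: cZ)
    ultimately show "card (?f ` Z (?A \<union> ?B)) = card (Z ?A \<times> Z ?B)"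
      using card_image[OF inj] by (simp add: card_cartesian_product power2_eq_square)
  qed (use finZ in simp)
  moreover
  have const: "(\<lambda>y\<in>V'. if pr y \<in> A then (-1, t) else (1, 0)) \<in> Z A" if t: "t \<in> {0..<u}" for A t
  proof -
    let ?x = "\<lambda>y\<in>V'. if pr y \<in> A then (-1, t) else (1, 0) :: int \<times> int"
    have tc: "(-1, t) \<in> carrier (dih u)" using t by (simp add: dih_simps)
    have t2: "(-1, t) \<otimes>\<^bsub>dih u\<^esub> (-1, t) = \<one>\<^bsub>dih u\<^esub>" by (simp add: dih_simps)
    have "?x \<in> cox_homs V' E' m' (dih u)"
    proof (rule cox_homsI)
      fix y z assume yz: "y \<in> V'" "z \<in> V'" "{y, z} \<in> E'"
      show "(?x y \<otimes>\<^bsub>dih u\<^esub> ?x z) [^]\<^bsub>dih u\<^esub> m' {y, z} = \<one>\<^bsub>dih u\<^esub>"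
      proof (cases "pr y = pr z")
        case True then show ?thesis using yz t2 by (simp add: one)
      next
        case False
        then have "even (m' {y, z})" using edge yz(3) by blast
        then show ?thesis using yz dih_refl_pow_even[OF u(2) t] tc t2 by (simp add: one)
      qed
    qed (use tc t2 in \<open>simp_all add: one\<close>)
    moreover have "restrict (dih_sign \<circ> ?x) V' = (\<lambda>v\<in>V'. s A (pr v))"
      by (intro restrict_ext) (simp add: dih_sign_def s_def)
    ultimately show ?thesis by (simp add: Z_def)
  qed
  \<comment> \<open>Reflections at positions 1 and 0 turn the edge relation into divisibility by
    \<open>u\<close>; \<open>1 mod u\<close> covers the degree 1, where 0 is the only
    position.\<close>
  let ?xA = "\<lambda>y\<in>V'. if pr y \<in> ?A then (-1, 1 mod u) else (1, 0)" and ?xB = "\<lambda>y\<in>V'. if pr y \<in> ?B then (-1, 0) else (1, 0)"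
  have "(?xA, ?xB) \<in> Z ?A \<times> Z ?B" using const[of "1 mod u" ?A] const[of 0 ?B] u(2) by simp
  ultimately have "(?xA, ?xB) \<in> ?f ` Z (?A \<union> ?B)" by simp
  then obtain x where x: "(?xA, ?xB) = ?f x" "x \<in> Z (?A \<union> ?B)" by (rule imageE)
  have xh: "x \<in> cox_homs V' E' m' (dih u)" using x(2) by (simp add: Z_def)
  have "?xA = ?r ?A x" "?xB = ?r ?B x" using x(1) by (simp_all only: prod.inject)
  then have "?xA v = ?r ?A x v" "?xB w = ?r ?B x w" by (simp_all only:)
  then have "x v = (-1, 1 mod u)" "x w = (-1, 0)" using V by simp_all
  with cox_homsD(4)[OF xh V vw(1)] have "u dvd int (m' {v, w}) * (1 mod u - 0)"
    using dih_refl_pow_iff[OF u(2), of "1 mod u" 0 "m' {v, w}"] by simp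
  then show ?thesis by (simp add: dvd_eq_mod_eq_0 mod_mult_right_eq)
qed

text \<open>Both sides are powers of two, with exponents \<open>8 - i\<close> and
  \<open>8 - j\<close>.\<close>

lemma power_fibre_count_inj:
  assumes "(2::nat) ^ i * 4 ^ (4 - i) = 2 ^ j * 4 ^ (4 - j)" "i \<le> 4" "j \<le> 4"
  shows "i = j"
proof -
  have "(2::nat) ^ i * 4 ^ (4 - i) = 2 ^ (8 - i)" if "i \<le> 4" for i
  proof -
    have "(4::nat) ^ (4 - i) = 2 ^ (2 * (4 - i))" by (simp add: power_mult)
    moreover have "i + 2 * (4 - i) = 8 - i" using that by simp
    ultimately show ?thesis by (metis power_add)
  qed
  then have "(2::nat) ^ (8 - i) = 2 ^ (8 - j)" using assms by simp
  then have "8 - i = 8 - j" by simp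
  then show ?thesis using assms(2,3) by simp
qed

text \<open>Odd labels inside a class are prime to the 2-part of \<open>n\<close>, so dihedral
  groups of that degree can be used directly. They may share factors with the odd part
  \<open>u\<close>, which is therefore reached through fibres over signs.\<close>

lemma even_label_classes:
  fixes V' :: "'b set"
  assumes G: "coxeter_graph V E m" "card V = 4" and n: "n \<ge> 2" "even n" "n = 2 \<or> 4 dvd n" and mn: "\<And>e. e \<in> E \<Longrightarrow> m e = n"
    and G': "coxeter_graph V' E' m'" and w: "pc_iso_witness V' E' m' V E m \<phi>"
  shows "\<exists>(pr :: 'b \<Rightarrow> 'b set) N. N \<ge> 20 \<and> card (pr ` V') = 4 \<and>
      (\<forall>v w. {v, w} \<in> E' \<longrightarrow> pr v \<noteq> pr w \<longrightarrow> n dvd m' {v, w}) \<and>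
      card (colourings (pr ` V') (quotient_edges V' E' pr) (blank_set (int N)) blank_rel) = card (colourings V E (blank_set (int N)) blank_rel)"
proof -
  have fin: "finite V" "finite V'" using G(1) G' by (simp_all add: coxeter_graph_def)
  have EV: "\<forall>v w. {v, w} \<in> E \<longrightarrow> v \<in> V \<and> w \<in> V" using coxeter_graph_edgeD[OF G(1)] by blast
  have EV': "\<forall>v w. {v, w} \<in> E' \<longrightarrow> v \<in> V' \<and> w \<in> V'" using coxeter_graph_edgeD[OF G'] by blast
  define E0 where "E0 = {e \<in> E'. odd (m' e)}"
  define pr where "pr = comp_of E0"
  let ?U = "pr ` V'" and ?F = "quotient_edges V' E' pr"
  let ?lift = "\<lambda>y. \<lambda>v\<in>V'. y (pr v)"
  have E0E: "E0 \<subseteq> E'" by (auto simp: E0_def)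
  have E0V: "\<forall>v w. {v, w} \<in> E0 \<longrightarrow> v \<in> V' \<and> w \<in> V'" using EV' E0E by blast
  have pr0: "pr v = pr w" if "{v, w} \<in> E0" for v w unfolding pr_def using that by (rule comp_of_edge)
  have finU: "finite ?U" using fin by simp
  have edge: "\<forall>v w. {v, w} \<in> E' \<longrightarrow> pr v = pr w \<or> even (m' {v, w})"
    using pr0 by (auto simp: E0_def)
  let ?C = "\<lambda>S. {f \<in> V' \<rightarrow>\<^sub>E S. \<forall>v w. {v, w} \<in> E0 \<longrightarrow> f v = f w}"
  have bijC: "bij_betw ?lift (?U \<rightarrow>\<^sub>E S) (?C S)" for S
    unfolding pr_def by (rule bij_betw_comp_functions[OF E0V])
  have cardC: "card (?C S) = card S ^ card ?U" if "finite S" for S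
    using bij_betw_same_card[OF bijC[of S]] finU that by (simp add: card_PiE)
  have odd_edge: "x v = x w" if "x \<in> cox_homs V' E' m' (dih N)" "N > 0" "\<forall>e\<in>E0. coprime (int (m' e)) N" "{v, w} \<in> E0" for x N v w
  proof -
    have V: "v \<in> V'" "w \<in> V'" "{v, w} \<in> E'" using that(4) E0V E0E by auto
    have "x v \<in> dih_invol N" "x w \<in> dih_invol N" using cox_homsD(1,3)[OF that(1)] V by (auto simp: dih_invol_def)
    then show ?thesis
      using dih_odd_pow_iff[OF that(2), of "x v" "x w" "m' {v, w}"] cox_homsD(4)[OF that(1) V] that(3,4) by (auto simp: E0_def)
  qed
  have sub: "cox_homs V' E' m' (dih N) \<subseteq> ?C (dih_invol N)" if "N > 0" "\<forall>e\<in>E0. coprime (int (m' e)) N" for N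
    using odd_edge[OF _ that] unfolding cox_homs_alt by blast
  have transfer: "card (cox_homs V' E' m' (dih N)) = card (cox_homs V E m (dih N))" if "N > 0" for N
    using bij_betw_same_card[OF cox_transfer_bij[OF w group_dih[OF that] finite_dih]] by simp
  have homs1: "cox_homs V' E' m' (dih 1) = ?C (dih_invol 1)"
  proof
    show "cox_homs V' E' m' (dih 1) \<subseteq> ?C (dih_invol 1)" by (rule sub) simp_all
    show "?C (dih_invol 1) \<subseteq> cox_homs V' E' m' (dih 1)"
    proof
      fix x assume x: "x \<in> ?C (dih_invol 1)"
      have "(x v \<otimes>\<^bsub>dih 1\<^esub> x w) [^]\<^bsub>dih 1\<^esub> m' {v, w} = \<one>\<^bsub>dih 1\<^esub>" if vw: "v \<in> V'" "w \<in> V'" "{v, w} \<in> E'" for v w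
      proof -
        interpret D: group "dih 1" by (rule group_dih) simp
        have i: "x v \<in> dih_invol 1" "x w \<in> dih_invol 1" using x vw by (auto simp: PiE_def Pi_def)
        show ?thesis
        proof (cases "{v, w} \<in> E0")
          case True
          then have "x v = x w" using x by blast
          then show ?thesis using i by (simp add: dih_invol_def)
        next
          case False
          then have "even (m' {v, w})" using vw by (auto simp: E0_def)
          then show ?thesis using i by (intro dih_exponent) (auto simp: dih_invol_def)
        qed
      qed
      then show "x \<in> cox_homs V' E' m' (dih 1)" using x unfolding cox_homs_alt by blast
    qed
  qed
  have Wexp: "cox_homs V E m (dih N) = V \<rightarrow>\<^sub>E dih_invol N" if "N > 0" "N dvd int n" for N
    using mn n(2) that by (intro cox_homs_exponent) auto
  have cardW: "card (cox_homs V E m (dih N)) = card (dih_invol N) ^ 4" if "N > 0" "N dvd int n" for N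
    using fin G(2) by (simp add: Wexp[OF that] card_PiE)
  have "card (dih_invol 1) ^ card ?U = card (dih_invol 1) ^ 4"
    using transfer[of 1] cardW[of 1] cardC[OF finite_dih_invol[of 1]] by (simp add: homs1)
  then have "(2::nat) ^ card ?U = 2 ^ 4" by (simp add: dih_1_invol)
  then have card4: "card ?U = 4" by (rule power_inject_exp[THEN iffD1, rotated]) simp
  \<comment> \<open>The homomorphisms are among the functions constant on classes, and the count
    transferred from the first group equals the number of all such functions.\<close>
  have full: "cox_homs V' E' m' (dih N) = ?C (dih_invol N)"
    if N: "N > 0" "N dvd int n" "\<forall>e\<in>E0. coprime (int (m' e)) N" for N
  proof (rule card_subset_eq)
    show "finite (?C (dih_invol N))"
      using finite_PiE[OF fin(2) finite_dih_invol[of N]] by (rule rev_finite_subset) auto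
    show "cox_homs V' E' m' (dih N) \<subseteq> ?C (dih_invol N)" by (rule sub[OF N(1,3)])
    show "card (cox_homs V' E' m' (dih N)) = card (?C (dih_invol N))"
      using transfer[OF N(1)] cardW[OF N(1,2)] cardC[OF finite_dih_invol[of N]] card4 by simp
  qed
  have label2: "N dvd int (m' {v, w})"
    if N: "N > 0" "N dvd int n" "\<forall>e\<in>E0. coprime (int (m' e)) N" and vw: "{v, w} \<in> E'" "pr v \<noteq> pr w" for N v w
  proof -
    have V: "v \<in> V'" "w \<in> V'" using vw EV' by auto
    \<comment> \<open>Position 1 on the class of \<open>v\<close> and 0 elsewhere is constant on
      classes, hence a homomorphism; its relation along the cross edge is the divisibility
      sought.\<close>
    let ?x = "\<lambda>y\<in>V'. (-1, if pr y = pr v then 1 mod N else 0) :: int \<times> int"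
    have "?x \<in> ?C (dih_invol N)" using N(1) pr0 E0V by (auto simp: dih_invol_def dih_simps)
    then have x: "?x \<in> cox_homs V' E' m' (dih N)" by (simp only: full[OF N])
    have "?x v = (-1, 1 mod N)" using V by simp
    moreover have "?x w = (-1, 0)" using V(2) vw(2)[symmetric] by simp
    ultimately have "((-1, 1 mod N) \<otimes>\<^bsub>dih N\<^esub> (-1, 0)) [^]\<^bsub>dih N\<^esub> m' {v, w} = \<one>\<^bsub>dih N\<^esub>"
      using cox_homsD(4)[OF x V vw(1)] by (simp only:)
    then have "N dvd int (m' {v, w}) * (1 mod N - 0)" using dih_refl_pow_iff[OF N(1)] by blast
    then show ?thesis by (simp add: dvd_eq_mod_eq_0 mod_mult_right_eq)
  qed
  have label: "n dvd m' {v, w}" if vw: "{v, w} \<in> E'" "pr v \<noteq> pr w" for v w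
  proof (cases "n = 2")
    case True
    then show ?thesis using edge vw by auto
  next
    case False
    then have n4: "4 dvd n" using n(3) by simp
    have "n \<noteq> 0" using n(1) by simp
    obtain u where nu: "n = 2 ^ multiplicity 2 n * u" "\<not> 2 dvd u"
      using multiplicity_decompose'[of n 2] \<open>n \<noteq> 0\<close> by (metis not_is_unit_0 prime_nat_iff two_is_prime_nat multiplicity_decompose' nat_dvd_1_iff_1 numeral_eq_one_iff semiring_norm(85))
    have cop: "\<forall>e\<in>E0. coprime (int (m' e)) (2 ^ k)" for k by (auto simp: E0_def)
    have two: "2 ^ multiplicity 2 n dvd int (m' {v, w})"
    proof (rule label2[OF _ _ cop vw])
      have "2 ^ multiplicity 2 n dvd n" by (rule multiplicity_dvd)
      then show "2 ^ multiplicity 2 n dvd int n" by (metis of_nat_dvd_iff of_nat_numeral of_nat_power)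
    qed simp
    have u: "odd (int u)" "int u > 0" using nu \<open>n \<noteq> 0\<close> by (auto intro!: gr0I)
    have un: "int u dvd int n" using nu(1) by (metis dvd_triv_right of_nat_dvd_iff)
    have n4': "(4::int) dvd int n" using n4 by presburger
    \<comment> \<open>Divisibility of \<open>n\<close> by 4 enters here: every class function into
      the involutions of the dihedral group of order 8 is a homomorphism.\<close>
    have h4: "cox_homs V' E' m' (dih 4) = ?C (dih_invol 4)" using full[of 4] n4' cop[of 2] by simp
    have "int u dvd int (m' {v, w})"
    proof (rule odd_part_divides_cross_label[OF G' u edge _ vw], intro ballI)
      fix c assume c: "c \<in> ?U \<rightarrow>\<^sub>E {(1, 0), (-1, 0) :: int \<times> int}"
      let ?\<chi>' = "?lift c"
      have \<chi>': "?\<chi>' \<in> cox_homs V' E' m' (dih 1)"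
      proof -
        have "c \<in> ?U \<rightarrow>\<^sub>E dih_invol 1" using c by (simp only: dih_1_invol)
        then have "?\<chi>' \<in> ?lift ` (?U \<rightarrow>\<^sub>E dih_invol 1)" by (rule imageI)
        then show ?thesis by (simp only: homs1 bij_betw_imp_surj_on[OF bijC])
      qed
      have "bij_betw (cox_transfer V' E' m' V E m \<phi> (dih 1)) (cox_homs V E m (dih 1)) (cox_homs V' E' m' (dih 1))"
        by (rule cox_transfer_bij[OF w group_dih finite_dih]) simp
      then have "?\<chi>' \<in> cox_transfer V' E' m' V E m \<phi> (dih 1) ` cox_homs V E m (dih 1)"
        using \<chi>' by (simp only: bij_betw_imp_surj_on)
      then obtain \<chi> where \<chi>: "?\<chi>' = cox_transfer V' E' m' V E m \<phi> (dih 1) \<chi>" "\<chi> \<in> cox_homs V E m (dih 1)" by (rule imageE)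
      have \<chi>P: "\<chi> \<in> V \<rightarrow>\<^sub>E {(1, 0), (-1, 0)}" using \<chi>(2) Wexp[of 1] by (simp add: dih_1_invol)
      let ?i = "card {v \<in> V. \<chi> v = (-1, 0)}" and ?j = "card {a \<in> ?U. c a = (-1, 0)}"
      have fib: "card {x \<in> cox_homs V' E' m' (dih N). restrict (p \<circ> x) V' = ?\<chi>'} = card {x \<in> cox_homs V E m (dih N). restrict (p \<circ> x) V = \<chi>}"
        if "N > 0" "p \<in> hom (dih N) (dih 1)" for p N
        unfolding \<chi>(1) by (rule cox_transfer_fibre[OF w group_dih[OF that(1)] finite_dih group_dih finite_dih that(2) \<chi>(2)]) simp
      have "card {x \<in> cox_homs V' E' m' (dih 4). restrict (dih_parity \<circ> x) V' = ?\<chi>'} = card {y \<in> ?U \<rightarrow>\<^sub>E dih_invol 4. restrict (dih_parity \<circ> y) ?U = c}"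
      proof (rule bij_betw_same_card[symmetric])
        show "bij_betw ?lift {y \<in> ?U \<rightarrow>\<^sub>E dih_invol 4. restrict (dih_parity \<circ> y) ?U = c}
            {x \<in> cox_homs V' E' m' (dih 4). restrict (dih_parity \<circ> x) V' = ?\<chi>'}"
          unfolding h4
        proof (rule bij_betw_Collect[OF bijC])
          fix y assume y: "y \<in> ?U \<rightarrow>\<^sub>E dih_invol 4"
          show "(restrict (dih_parity \<circ> ?lift y) V' = ?\<chi>') \<longleftrightarrow> (restrict (dih_parity \<circ> y) ?U = c)"
          proof
            assume l: "restrict (dih_parity \<circ> ?lift y) V' = ?\<chi>'"
            show "restrict (dih_parity \<circ> y) ?U = c"
            proof
              fix a show "restrict (dih_parity \<circ> y) ?U a = c a"
              proof (cases "a \<in> ?U")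
                case True
                then obtain v where "v \<in> V'" "a = pr v" by auto
                then show ?thesis using fun_cong[OF l, of v] by simp
              qed (use c in \<open>auto simp: PiE_def extensional_def\<close>)
            qed
          next
            assume l: "restrict (dih_parity \<circ> y) ?U = c"
            have "dih_parity (y (pr v)) = c (pr v)" if "v \<in> V'" for v using fun_cong[OF l, of "pr v"] that by simp
            then show "restrict (dih_parity \<circ> ?lift y) V' = ?\<chi>'" by (intro restrict_ext) simp
          qed
        qed
      qed
      also have "\<dots> = 2 ^ ?j * 4 ^ (4 - ?j)"
        using card_PiE_fibre[OF finU c card_parity_fibre] by (simp add: card4)
      finally have "2 ^ ?j * 4 ^ (4 - ?j) = card {x \<in> V \<rightarrow>\<^sub>E dih_invol 4. restrict (dih_parity \<circ> x) V = \<chi>}"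
        using fib[of 4 dih_parity] dih_parity_hom[of 4] Wexp[of 4] n4' by simp
      also have "\<dots> = 2 ^ ?i * 4 ^ (4 - ?i)"
        using card_PiE_fibre[OF fin(1) \<chi>P card_parity_fibre] by (simp add: G(2))
      finally have eq: "(2::nat) ^ ?j * 4 ^ (4 - ?j) = 2 ^ ?i * 4 ^ (4 - ?i)" .
      have "?j \<le> card ?U" by (rule card_mono[OF finU]) blast
      moreover have "?i \<le> card V" by (rule card_mono[OF fin(1)]) blast
      \<comment> \<open>Corresponding sign assignments have equally many values -1, counted on
        classes and on vertices. The fibre for \<open>u\<close>, known for the first group in terms
        of \<open>?i\<close>, thus has the size required in terms of \<open>?j\<close>.\<close>
      ultimately have ji: "?j = ?i" using power_fibre_count_inj[OF eq] by (simp only: card4 G(2))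
      have "card {x \<in> cox_homs V' E' m' (dih (int u)). restrict (dih_sign \<circ> x) V' = ?\<chi>'} = card {x \<in> V \<rightarrow>\<^sub>E dih_invol (int u). restrict (dih_sign \<circ> x) V = \<chi>}"
        using fib[OF u(2) dih_sign_hom] Wexp[OF u(2) un] by simp
      also have "\<dots> = nat (int u) ^ ?i * 1 ^ (card V - ?i)"
        by (rule card_PiE_fibre[OF fin(1) \<chi>P card_sign_fibre[OF u]])
      finally show "card {x \<in> cox_homs V' E' m' (dih (int u)). restrict (dih_sign \<circ> x) V' = ?\<chi>'} = nat (int u) ^ ?j"
        by (simp add: ji)
    qed
    then have "u dvd m' {v, w}" by simp
    moreover have "2 ^ multiplicity 2 n dvd m' {v, w}" using two by (metis of_nat_dvd_iff of_nat_numeral of_nat_power)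
    moreover have "coprime (2 ^ multiplicity 2 n) u" using nu(2) by simp
    ultimately show ?thesis using nu(1) by (metis divides_mult)
  qed
  have finE': "finite E'"
    using fin(2) G' by (intro finite_subset[of E' "Pow V'"]) (auto simp: coxeter_graph_def)
  \<comment> \<open>Beyond all labels, so that it divides none of them, and beyond 20, where the
    counts of colourings with a blank are strictly ordered.\<close>
  obtain l :: nat where l: "prime l" "l > n + sum m' E' + 20" using bigger_prime by blast
  have lp: "prime (int l)" "odd (int l)" "int l > 0" using l prime_odd_nat[OF l(1)] by simp_all
  have lm': "\<not> int l dvd int (m' e)" if "e \<in> E'" for e
  proof -
    have "m' e \<le> sum m' E'" using that finE' by (intro member_le_sum) auto
    moreover have "m' e \<ge> 2" using that G' by (simp add: coxeter_graph_def)
    ultimately show ?thesis using l(2) by (auto dest: dvd_imp_le)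
  qed
  have lm: "\<not> int l dvd int (m e)" if "e \<in> E" for e
    using mn[OF that] l(2) n(1) by (auto dest: dvd_imp_le)
  have "cox_homs V E m (dih (int l)) = colourings V E (blank_set (int l)) blank_rel"
    unfolding cox_homs_alt dih_invol_odd[OF lp(2,3)] colourings_def
    using dih_even_pow_iff[OF lp(1,2)] lm mn n(2) by (intro Collect_cong conj_cong refl ball_cong imp_cong) (auto simp: PiE_def Pi_def)
  moreover have "cox_homs V' E' m' (dih (int l)) = {x \<in> V' \<rightarrow>\<^sub>E blank_set (int l). \<forall>v\<in>V'. \<forall>w\<in>V'. {v, w} \<in> E' \<longrightarrow>
      (if {v, w} \<in> E0 then x v = x w else blank_rel (x v) (x w))}"
  proof -
    have "(x v \<otimes>\<^bsub>dih (int l)\<^esub> x w) [^]\<^bsub>dih (int l)\<^esub> m' {v, w} = \<one>\<^bsub>dih (int l)\<^esub> \<longleftrightarrow>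
        (if {v, w} \<in> E0 then x v = x w else blank_rel (x v) (x w))"
      if x: "x \<in> V' \<rightarrow>\<^sub>E blank_set (int l)" and vw: "v \<in> V'" "w \<in> V'" "{v, w} \<in> E'" for x v w
    proof -
      have b: "x v \<in> blank_set (int l)" "x w \<in> blank_set (int l)" using PiE_mem[OF x] vw by auto
      have cop: "coprime (int (m' {v, w})) (int l)"
        using lm'[OF vw(3)] lp(1) by (simp add: prime_imp_coprime coprime_commute)
      show ?thesis
      proof (cases "{v, w} \<in> E0")
        case True
        then show ?thesis using dih_odd_pow_iff[OF lp(3), of "x v" "x w" "m' {v, w}"] b cop
          by (simp add: dih_invol_odd[OF lp(2,3)] E0_def)
      next
        case False
        then show ?thesis using dih_even_pow_iff[OF lp(1,2) b, of "m' {v, w}"] lm'[OF vw(3)] vw(3) by (simp add: E0_def)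
      qed
    qed
    then show ?thesis unfolding cox_homs_alt dih_invol_odd[OF lp(2,3)] by blast
  qed
  moreover have "blank_rel x x" for x by (simp add: blank_rel_def)
  ultimately have "card (colourings ?U ?F (blank_set (int l)) blank_rel) = card (colourings V E (blank_set (int l)) blank_rel)"
    using bij_betw_same_card[OF bij_betw_colourings_quotient[OF EV' E0E, where R = blank_rel and S = "blank_set (int l)", folded pr_def]]
      transfer[OF lp(3)] by simp
  then show ?thesis using card4 label l(2) by (intro exI[of _ pr] exI[of _ l]) auto
qed

section \<open>Rigidity\<close>

lemma graph4_of_card:
  assumes "card V = 4"
  shows "\<exists>x1 x2 x3 x4 x5 x6. graph4 V E x1 x2 x3 x4 x5 x6"
proof -
  obtain a b c d where "V = {a, b, c, d}" "distinct [a, b, c, d]"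
    using assms by (auto simp: card_Suc_eq numeral_eq_Suc)
  then show ?thesis unfolding graph4_def by blast
qed

lemma graph_connected_cut:
  assumes "graph_connected V E" "C \<subseteq> V" "u \<in> C" "v \<in> V - C"
  shows "\<exists>x\<in>C. \<exists>y. y \<notin> C \<and> {x, y} \<in> E"
proof (rule ccontr)
  assume no: "\<not> ?thesis"
  have "(\<lambda>x y. {x, y} \<in> E)\<^sup>*\<^sup>* u v" using assms by (auto simp: graph_connected_def)
  then have "v \<in> C" by (induction rule: rtranclp_induct) (use no assms(3) in auto)
  then show False using assms(4) by simp
qed

text \<open>Four of the eleven types have \<open>d\<close> as an isolated vertex and one consists of
  two disjoint edges; a cut excludes each of these five.\<close>

lemma connected_graph4_classification:
  assumes g: "card V = 4" and E: "\<forall>v w. {v, w} \<in> E \<longrightarrow> v \<in> V \<and> w \<in> V" and con: "graph_connected V E"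
  shows "graph4 V E True True True False False False \<or>
    graph4 V E True True False False False True \<or>
    graph4 V E False True False True True True \<or>
    graph4 V E True True False False True True \<or>
    graph4 V E True True False True True True \<or>
    graph4 V E True True True True True True"
proof -
  have iso: "\<not> graph4 V E x1 x2 False False x5 False" for x1 x2 x5
  proof
    assume "graph4 V E x1 x2 False False x5 False"
    then obtain a b c d where V: "V = {a, b, c, d}" "distinct [a, b, c, d]" "{c, d} \<notin> E" "{a, d} \<notin> E" "{b, d} \<notin> E"
      unfolding graph4_def by blast
    obtain x y where xy: "x \<in> {a, b, c}" "y \<notin> {a, b, c}" "{x, y} \<in> E"
      using graph_connected_cut[OF con, of "{a, b, c}" a d] V(1,2) by auto
    moreover have "y \<in> V" using E xy(3) by blast
    ultimately show False using V by auto
  qed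
  have "\<not> graph4 V E True False True False False False"
  proof
    assume "graph4 V E True False True False False False"
    then obtain a b c d where V: "V = {a, b, c, d}" "distinct [a, b, c, d]" "{b, c} \<notin> E" "{a, d} \<notin> E" "{a, c} \<notin> E" "{b, d} \<notin> E"
      unfolding graph4_def by blast
    obtain x y where xy: "x \<in> {a, b}" "y \<notin> {a, b}" "{x, y} \<in> E"
      using graph_connected_cut[OF con, of "{a, b}" a d] V(1,2) by auto
    moreover have "y \<in> V" using E xy(3) by blast
    ultimately show False using V by auto
  qed
  moreover obtain x1 x2 x3 x4 x5 x6 where "graph4 V E x1 x2 x3 x4 x5 x6" using graph4_of_card[OF g] by blast
  ultimately show ?thesis
    using graph4_classification[of V E] iso[of False False False] iso[of True False False] iso[of True True False] iso[of True True True]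
    by blast
qed

text \<open>Paths and stars have the same number of proper colourings; the groups agree because sliding the
  last vertex of the path along an odd edge is a twist.\<close>

lemma path_star_iso:
  assumes path: "graph4 V E True True True False False False" and star: "graph4 U F True True False False False True"
    and E: "\<forall>e\<in>E. \<exists>v w. e = {v, w} \<and> v \<in> V \<and> w \<in> V \<and> v \<noteq> w" and F: "\<forall>v w. {v, w} \<in> F \<longrightarrow> v \<noteq> w" and n: "odd n"
  shows "coxeter_group V E (\<lambda>_. n) \<cong> coxeter_group U F (\<lambda>_. n)"
proof -
  obtain a b c d where V: "V = {a, b, c, d}" "distinct [a, b, c, d]" "{a, b} \<in> E" "{b, c} \<in> E" "{c, d} \<in> E"
     "{a, d} \<notin> E" "{a, c} \<notin> E" "{b, d} \<notin> E" using path unfolding graph4_def by blast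
  let ?S = "{{a, b}, {b, c}, {b, d}}"
  have EE: "E = {{a, b}, {b, c}, {c, d}}"
  proof
    show "E \<subseteq> {{a, b}, {b, c}, {c, d}}"
    proof
      fix e assume e: "e \<in> E"
      obtain v w where vw: "e = {v, w}" "v \<in> V" "w \<in> V" "v \<noteq> w" using E e by blast
      then have v: "v = a \<or> v = b \<or> v = c \<or> v = d" and w: "w = a \<or> w = b \<or> w = c \<or> w = d" by (auto simp: V(1))
      then show "e \<in> {{a, b}, {b, c}, {c, d}}" using e vw V by (elim disjE) (simp_all add: insert_commute)
    qed
  qed (use V in auto)
  have "coxeter_group V E (\<lambda>_. n) \<cong> coxeter_group V ?S (\<lambda>_. n)"
    by (rule twist_iso[of b _ c d]) (use V(1,2) n in \<open>auto simp: EE doubleton_eq_iff\<close>)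
  moreover have "graph4 V ?S True True False False False True"
    unfolding graph4_def by (rule exI[of _ a], rule exI[of _ b], rule exI[of _ c], rule exI[of _ d])
      (use V(1,2) in \<open>auto simp: doubleton_eq_iff\<close>)
  then have "coxeter_group V ?S (\<lambda>_. n) \<cong> coxeter_group U F (\<lambda>_. n)"
    by (rule graph4_iso[OF _ star _ F]) (use V(2) in \<open>auto simp: doubleton_eq_iff\<close>)
  ultimately show ?thesis by (rule iso_trans)
qed

text \<open>The chromatic polynomials take strictly ordered values at every \<open>q\<close> from 3
  on, except that the two trees agree; for those the twist supplies the isomorphism.\<close>

lemma odd_graph_rigidity:
  assumes V: "card V = 4" "graph_connected V E" and E: "\<forall>e\<in>E. \<exists>v w. e = {v, w} \<and> v \<in> V \<and> w \<in> V \<and> v \<noteq> w"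
    and U: "card U = 4" "graph_connected U F" and F: "\<forall>e\<in>F. \<exists>v w. e = {v, w} \<and> v \<in> U \<and> w \<in> U \<and> v \<noteq> w"
    and q: "q \<ge> 3" "card (proper_colourings U F q) = card (proper_colourings V E q)" and n: "odd n"
  shows "coxeter_group U F (\<lambda>_. n) \<cong> coxeter_group V E (\<lambda>_. n)"
proof -
  obtain k where k: "q = int k + 3" using q(1) by (metis add.commute zle_iff_zadd)
  have E': "\<forall>v w. {v, w} \<in> E \<longrightarrow> v \<in> V \<and> w \<in> V \<and> v \<noteq> w" using E by (fastforce simp: doubleton_eq_iff)
  have F': "\<forall>v w. {v, w} \<in> F \<longrightarrow> v \<in> U \<and> w \<in> U \<and> v \<noteq> w" using F by (fastforce simp: doubleton_eq_iff)
  have E2: "\<forall>v w. {v, w} \<in> E \<longrightarrow> v \<in> V \<and> w \<in> V" and E3: "\<forall>v w. {v, w} \<in> E \<longrightarrow> v \<noteq> w" using E' by blast+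
  have F2: "\<forall>v w. {v, w} \<in> F \<longrightarrow> v \<in> U \<and> w \<in> U" and F3: "\<forall>v w. {v, w} \<in> F \<longrightarrow> v \<noteq> w" using F' by blast+
  \<comment> \<open>The factors \<open>q\<close> and \<open>q - 1\<close> common to all counts are
    split off; the remaining quadratics in \<open>k\<close> are ordered already at
    \<open>k = 0\<close>.\<close>
  define p where "p i = (k + 3) * (k + 2) * ([(k + 2) ^ 2, k ^ 2 + 3 * k + 3, k ^ 2 + 3 * k + 2, (k + 1) ^ 2, (k + 1) * k] ! i)" for i
  have ps: "(k + 3) * (k + 2) ^ 3 = p 0" "(k + 3) * ((k + 2) ^ 2 + (k + 2) * (k + 1) ^ 2) = p 1"
    "(k + 3) * (k + 2) ^ 2 * (k + 1) = p 2" "(k + 3) * (k + 2) * (k + 1) ^ 2 = p 3" "(k + 3) * (k + 2) * (k + 1) * k = p 4"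
    by (simp_all add: p_def power2_eq_square power3_eq_cube algebra_simps)
  have lt: "p 4 < p 3" "p 3 < p 2" "p 2 < p 1" "p 1 < p 0"
    unfolding p_def by (intro mult_strict_left_mono; simp add: power2_eq_square)+
  note cV = card_proper_colourings[OF E3 k, of V, unfolded ps] and cU = card_proper_colourings[OF F3 k, of U, unfolded ps q(2)]
  let ?c = "card (proper_colourings V E q)"
  have vV: "graph4 V E True True True False False False \<and> ?c = p 0 \<or>
    graph4 V E True True False False False True \<and> ?c = p 0 \<or>
    graph4 V E False True False True True True \<and> ?c = p 1 \<or>
    graph4 V E True True False False True True \<and> ?c = p 2 \<or>
    graph4 V E True True False True True True \<and> ?c = p 3 \<or>
    graph4 V E True True True True True True \<and> ?c = p 4"
    using connected_graph4_classification[OF V(1) E2 V(2)] by - (elim disj_forward; (rule conjI, assumption, erule cV))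
  have vU: "graph4 U F True True True False False False \<and> ?c = p 0 \<or>
    graph4 U F True True False False False True \<and> ?c = p 0 \<or>
    graph4 U F False True False True True True \<and> ?c = p 1 \<or>
    graph4 U F True True False False True True \<and> ?c = p 2 \<or>
    graph4 U F True True False True True True \<and> ?c = p 3 \<or>
    graph4 U F True True True True True True \<and> ?c = p 4"
    using connected_graph4_classification[OF U(1) F2 U(2)] by - (elim disj_forward; (rule conjI, assumption, erule cU))
  have sym: "coxeter_group U F (\<lambda>_. n) \<cong> coxeter_group V E (\<lambda>_. n)"
    if "graph4 V E True True True False False False" "graph4 U F True True False False False True"
    using path_star_iso[OF that E F3 n] by (rule group.iso_sym[OF group_coxeter_group])
  show ?thesis using vU vV lt
    by (elim disjE conjE) (linarith | (rule graph4_iso[OF _ _ F3 E3], assumption, assumption)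
      | (rule path_star_iso[OF _ _ F E3 n], assumption, assumption) | (rule sym, assumption, assumption))+
qed

text \<open>Equal counts place both graphs in the same one of the eleven types, because the eleven
  values are strictly ordered.\<close>

lemma even_graph_rigidity:
  assumes V: "card V = 4" and E: "\<forall>v w. {v, w} \<in> E \<longrightarrow> v \<noteq> w" and U: "card U = 4" and F: "\<forall>v w. {v, w} \<in> F \<longrightarrow> v \<noteq> w"
    and N: "N \<ge> 20" "card (colourings U F (blank_set (int N)) blank_rel) = card (colourings V E (blank_set (int N)) blank_rel)"
  shows "coxeter_group U F (\<lambda>_. n) \<cong> coxeter_group V E (\<lambda>_. n)"
proof -
  have N0: "N > 0" using N(1) by simp
  define p where "p i = [(N + 1) ^ 4, (3 * N + 1) * (N + 1) ^ 2, (1 + 6 * N + N ^ 2) * (N + 1), 1 + 11 * N + 3 * N ^ 2 + N ^ 3,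
    (3 * N + 1) ^ 2, (1 + 7 * N) * (N + 1), 1 + 10 * N + 5 * N ^ 2, 1 + 12 * N + 3 * N ^ 2, 1 + 13 * N + 2 * N ^ 2, 1 + 14 * N + N ^ 2, 1 + 15 * N] ! i" for i
  have ps: "p 0 = (N + 1) ^ 4" "p 1 = (3 * N + 1) * (N + 1) ^ 2" "p 2 = (1 + 6 * N + N ^ 2) * (N + 1)"
    "p 3 = 1 + 11 * N + 3 * N ^ 2 + N ^ 3" "p 4 = (3 * N + 1) ^ 2" "p 5 = (1 + 7 * N) * (N + 1)" "p 6 = 1 + 10 * N + 5 * N ^ 2"
    "p 7 = 1 + 12 * N + 3 * N ^ 2" "p 8 = 1 + 13 * N + 2 * N ^ 2" "p 9 = 1 + 14 * N + N ^ 2" "p 10 = 1 + 15 * N"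
    by (simp_all add: p_def)
  obtain j where j: "N = j + 20" using N(1) by (metis add.commute le_Suc_ex)
  \<comment> \<open>The latest crossing is that of the star with two disjoint edges:
    \<open>p 3\<close> minus \<open>p 4\<close> is N(N - 1)(N - 5). The bound 20 lies safely beyond
    it.\<close>
  have lt: "p 10 < p 9" "p 9 < p 8" "p 8 < p 7" "p 7 < p 6" "p 6 < p 5" "p 5 < p 4" "p 4 < p 3" "p 3 < p 2" "p 2 < p 1" "p 1 < p 0"
    unfolding ps j by (simp_all add: power2_eq_square power3_eq_cube power4_eq_xxxx algebra_simps)
  note cV = card_blank_colourings[OF E N0, of V, folded ps] and cU = card_blank_colourings[OF F N0, of U, folded ps, unfolded N(2)]
  let ?c = "card (colourings V E (blank_set (int N)) blank_rel)"
  have vV: "graph4 V E False False False False False False \<and> ?c = p 0 \<or>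
    graph4 V E True False False False False False \<and> ?c = p 1 \<or>
    graph4 V E True False True False False False \<and> ?c = p 4 \<or>
    graph4 V E True True False False False False \<and> ?c = p 2 \<or>
    graph4 V E True True False False True False \<and> ?c = p 5 \<or>
    graph4 V E True True True False False False \<and> ?c = p 6 \<or>
    graph4 V E True True False False False True \<and> ?c = p 3 \<or>
    graph4 V E False True False True True True \<and> ?c = p 8 \<or>
    graph4 V E True True False False True True \<and> ?c = p 7 \<or>
    graph4 V E True True False True True True \<and> ?c = p 9 \<or>
    graph4 V E True True True True True True \<and> ?c = p 10"
  proof -
    obtain x1 x2 x3 x4 x5 x6 where "graph4 V E x1 x2 x3 x4 x5 x6" using graph4_of_card[OF V] by blast
    from graph4_classification[OF this] show ?thesis by - (elim disj_forward; (rule conjI, assumption, erule cV))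
  qed
  have vU: "graph4 U F False False False False False False \<and> ?c = p 0 \<or>
    graph4 U F True False False False False False \<and> ?c = p 1 \<or>
    graph4 U F True False True False False False \<and> ?c = p 4 \<or>
    graph4 U F True True False False False False \<and> ?c = p 2 \<or>
    graph4 U F True True False False True False \<and> ?c = p 5 \<or>
    graph4 U F True True True False False False \<and> ?c = p 6 \<or>
    graph4 U F True True False False False True \<and> ?c = p 3 \<or>
    graph4 U F False True False True True True \<and> ?c = p 8 \<or>
    graph4 U F True True False False True True \<and> ?c = p 7 \<or>
    graph4 U F True True False True True True \<and> ?c = p 9 \<or>
    graph4 U F True True True True True True \<and> ?c = p 10"
  proof -
    obtain x1 x2 x3 x4 x5 x6 where "graph4 U F x1 x2 x3 x4 x5 x6" using graph4_of_card[OF U] by blast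
    from graph4_classification[OF this] show ?thesis by - (elim disj_forward; (rule conjI, assumption, erule cU))
  qed
  show ?thesis using vU vV lt
    by (elim disjE conjE) (linarith | (rule graph4_iso[OF _ _ F E], assumption, assumption))+
qed

theorem theorem9p18:
  fixes V :: "'a set" and E :: "'a set set" and m :: "'a set \<Rightarrow> nat" and n :: nat
    and V' :: "'b set" and E' :: "'b set set" and m' :: "'b set \<Rightarrow> nat"
  assumes "coxeter_graph V E m"
    and "graph_connected V E"
    and "card V = 4"
    and "n \<ge> 2"
    and "\<forall>e\<in>E. m e = n"
    and "\<forall>k::nat. k \<ge> 1 \<longrightarrow> n \<noteq> 4 * k + 2"
    and "coxeter_graph V' E' m'"
    and "profinite_iso (coxeter_group V' E' m') (coxeter_group V E m)"
  shows "coxeter_group V' E' m' \<cong> coxeter_group V E m"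
proof -
  obtain \<phi> where w: "pc_iso_witness V' E' m' V E m \<phi>"
    using assms(8) by (auto simp: profinite_iso_def pc_iso_witness_def)
  have const: "coxeter_group V E (\<lambda>_. n) \<cong> coxeter_group V E m"
    using assms(5) by (intro coxeter_group_iso_of_bij[of id]) auto
  have E: "\<forall>e\<in>E. \<exists>v w. e = {v, w} \<and> v \<in> V \<and> w \<in> V \<and> v \<noteq> w"
  proof
    fix e assume "e \<in> E"
    then obtain v w where "e = {v, w}" "v \<noteq> w" "v \<in> V" "w \<in> V"
      using assms(1) unfolding coxeter_graph_def by metis
    then show "\<exists>v w. e = {v, w} \<and> v \<in> V \<and> w \<in> V \<and> v \<noteq> w" by blast
  qed
  then have E1: "\<forall>v w. {v, w} \<in> E \<longrightarrow> v \<noteq> w" by (fastforce simp: doubleton_eq_iff)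
  have F: "\<forall>e\<in>quotient_edges V' E' pr. \<exists>v w. e = {v, w} \<and> v \<in> pr ` V' \<and> w \<in> pr ` V' \<and> v \<noteq> w" for pr :: "'b \<Rightarrow> 'b set"
    unfolding quotient_edges_def by blast
  then have F1: "\<forall>v w. {v, w} \<in> quotient_edges V' E' pr \<longrightarrow> v \<noteq> w" for pr :: "'b \<Rightarrow> 'b set" by (fastforce simp: doubleton_eq_iff)
  have "\<exists>pr :: 'b \<Rightarrow> 'b set. (\<forall>v w. {v, w} \<in> E' \<longrightarrow> pr v \<noteq> pr w \<longrightarrow> n dvd m' {v, w}) \<and>
      coxeter_group (pr ` V') (quotient_edges V' E' pr) (\<lambda>_. n) \<cong> coxeter_group V E (\<lambda>_. n)"
  proof (cases "odd n")
    case True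
    obtain pr :: "'b \<Rightarrow> 'b set" and q where pr: "q \<ge> 3" "card (pr ` V') = 4"
      "\<forall>v w. {v, w} \<in> E' \<longrightarrow> pr v \<noteq> pr w \<longrightarrow> n dvd m' {v, w}"
      "graph_connected (pr ` V') (quotient_edges V' E' pr)"
      "card (proper_colourings (pr ` V') (quotient_edges V' E' pr) q) = card (proper_colourings V E q)"
      using odd_label_classes[OF assms(1-4) True _ assms(7) w] assms(5) by blast
    show ?thesis
      using odd_graph_rigidity[OF assms(3,2) E pr(2,4) F pr(1,5) True] pr(3) by blast
  next
    case False
    \<comment> \<open>An even \<open>n\<close> outside these two cases is 2 modulo 4 and larger than
      2, exactly what is excluded.\<close>
    have "n = 2 \<or> 4 dvd n"
    proof (rule ccontr)
      assume c: "\<not> ?thesis"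
      then have "n = 4 * (n div 4) + 2" "n div 4 \<ge> 1" using False assms(4) by presburger+
      then show False using assms(6) by blast
    qed
    then obtain pr :: "'b \<Rightarrow> 'b set" and N where pr: "N \<ge> 20" "card (pr ` V') = 4"
      "\<forall>v w. {v, w} \<in> E' \<longrightarrow> pr v \<noteq> pr w \<longrightarrow> n dvd m' {v, w}"
      "card (colourings (pr ` V') (quotient_edges V' E' pr) (blank_set (int N)) blank_rel) = card (colourings V E (blank_set (int N)) blank_rel)"
      using even_label_classes[OF assms(1,3,4) _ _ _ assms(7) w] False assms(5) by blast
    show ?thesis
      using even_graph_rigidity[OF assms(3) E1 pr(2) F1 pr(1,4)] pr(3) by blast
  qed
  then obtain pr :: "'b \<Rightarrow> 'b set" where pr: "\<forall>v w. {v, w} \<in> E' \<longrightarrow> pr v \<noteq> pr w \<longrightarrow> n dvd m' {v, w}"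
    and iso: "coxeter_group (pr ` V') (quotient_edges V' E' pr) (\<lambda>_. n) \<cong> coxeter_group V E (\<lambda>_. n)" by blast
  note iso' = iso_trans[OF iso const]
  have "coxeter_group V' E' m' \<cong> coxeter_group (pr ` V') (quotient_edges V' E' pr) (\<lambda>_. n)"
    unfolding quotient_edges_def
  proof (rule contraction_rigidity[OF assms(7)], fold quotient_edges_def)
    fix v w assume "{v, w} \<in> E'" "pr v \<noteq> pr w"
    then show "n dvd m' {v, w}" using pr by blast
  next
    fix Q :: "(('b \<Rightarrow> int) \<Rightarrow> ('b \<Rightarrow> int)) monoid" assume Q: "group Q" "finite (carrier Q)"
    show "card (cox_homs (pr ` V') (quotient_edges V' E' pr) (\<lambda>_. n) Q) = card (cox_homs V' E' m' Q)"
      \<comment> \<open>The group of the quotient graph has the counts of the first group by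
        isomorphism, and the second group has them by transfer.\<close>
      using card_cox_homs_iso[OF iso' Q(1)] bij_betw_same_card[OF cox_transfer_bij[OF w Q]] by simp
  qed
  then show ?thesis using iso' by (rule iso_trans)
qed

end
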